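(* Let $(X,T)$ be a transitive locally compact two-sided topological Markov shift over a countably infinite set of states $S$, let $\phi:X^+\to\mathbb{R}$ be a potential function with summable variations, and let $\phi^-:X^-\to\mathbb{R}$ be a potential function with summable variations such that $\phi$ and $\phi^-$ are cohomologous via a uniformly continuous transfer function $\psi:X\to\mathbb{R}$. Let $\lambda>0$. Then the mapping $\pi$ given by $$(\pi(\mu))(x)=\mu(\chi_x),\qquad x\in X^+,$$ is a one-to-one linear correspondence (a linear bijection) between the nonzero $\lambda$-conformal measures on $(X^-,T^{-1},\phi^-)$ and the eigenfunctions in $\mathcal{H}(\lambda)$.
   Context: Let $S$ be a countably infinite set and $\mathbb{A}\in\{0,1\}^{S\times S}$. Let $X^+=\{x\in S^{\{0,1,2,\dots\}}:\mathbb{A}_{(x)_i,(x)_{i+1}}=1\ \forall i\ge0\}$, $X=\{z\in S^{\mathbb{Z}}:\mathbb{A}_{(z)_i,(z)_{i+1}}=1\ \forall i\in\mathbb{Z}\}$, $X^-=\{y\in S^{\{\dots,-2,-1,0\}}:\mathbb{A}_{(y)_i,(y)_{i+1}}=1\ \forall i<0\}$, each with the metric $d(u,v)=2^{-\inf\{|i|:(u)_i\ne(v)_i\}}$. Left shift $(Tu)_i=(u)_{i+1}$ on $X^+$ and $X$; right shift $(T^{-1}u)_i=(u)_{i-1}$ on $X$ and $X^-$. For $z\in X$ let $z^+=((z)_0,(z)_1,\dots)\in X^+$ and $z^-=(\dots,(z)_{-1},(z)_0)\in X^-$. For $y\in X^-$, $x\in X^+$ with $\mathbb{A}_{(y)_0,(x)_0}=1$,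 let $y\cdot x\in X$ be the point $(\dots,(y)_{-1},(y)_0,(x)_0,(x)_1,\dots)$ with $(x)_0$ in position $0$. Transitive: for all $a,b\in S$ there is a finite path $a=a_0,\dots,a_n=b$, $n\ge1$, with $\mathbb{A}_{a_i,a_{i+1}}=1$. Locally compact (two-sided): $\sum_b\mathbb{A}_{a,b}+\sum_b\mathbb{A}_{b,a}<\infty$ for all $a\in S$. Variations: $Var_m(\phi)=\sup\{|\phi(u)-\phi(v)|:(u)_i=(v)_i\ \forall |i|\le m-1\}$ (over the relevant one-sided space); summable variations means $\sum_{m\ge2}Var_m(\phi)<\infty$. Ruelle operators: $(L_\phi f)(x)=\sum_{x'\in X^+:Tx'=x}e^{\phi(x')}f(x')$ on $X^+$, and $(L_{\phi^-}f)(y)=\sum_{y'\in X^-:T^{-1}y'=y}e^{\phi^-(y')}f(y')$ on $X^-$. $\phi$ and $\phi^-$ are cohomologous via $\psi:X\to\mathbb{R}$ if $\phi(z^+)-\phi^-(z^-)=\psi(z)-\psi(Tz)$ for all $z\in X$. A $\lambda$-conformal measure on $(X^-,T^{-1},\phi^-)$ is a positive Radon measure $\mu$ on $X^-$ with $\int L_{\phi^-}1_K\,d\mu=\lambda\mu(K)$ for every compact $K\subseteq X^-$. $$\mathcal{H}(\lambda)=\{f\in C(X^+):f>0,\ L_\phi f=\lambda f,\ \log f\text{ is uniformly continuous}\}.$$ For $x\in X^+$, $\chi_x:X^-\to\mathbb{R}$ is $\chi_x(y)=\exp(-\psi(y\cdot x))$ if $\mathbb{A}_{(y)_0,(x)_0}=1$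 and $\chi_x(y)=0$ otherwise; $\chi_x$ is continuous, non-negative and compactly supported. Linearity of $\pi$ means compatibility with addition and multiplication by positive scalars. *)

theory Defs
  imports "HOL-Analysis.Analysis"
begin

text \<open>
  The three shift spaces are treated uniformly: a sequence indexed by a set \<open>I\<close> of integers is a
  function on \<open>int\<close> that is \<^const>\<open>undefined\<close> outside \<open>I\<close>. Consequently two points
  of the same space never differ at an index outside \<open>I\<close>, and quantifiers over indices at which
  two points (dis)agree need no restriction to \<open>I\<close>.
\<close>

definition shift_space :: "('s \<Rightarrow> 's \<Rightarrow> nat) \<Rightarrow> int set \<Rightarrow> (int \<Rightarrow> 's) set" where
  "shift_space A I =
     {u \<in> I \<rightarrow>\<^sub>E UNIV. \<forall>i. i \<in> I \<and> i + 1 \<in> I \<longrightarrow> A (u i) (u (i + 1)) = 1}"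

abbreviation Xpos :: "('s \<Rightarrow> 's \<Rightarrow> nat) \<Rightarrow> (int \<Rightarrow> 's) set" where
  "Xpos A \<equiv> shift_space A {0..}"

abbreviation Xtwo :: "('s \<Rightarrow> 's \<Rightarrow> nat) \<Rightarrow> (int \<Rightarrow> 's) set" where
  "Xtwo A \<equiv> shift_space A UNIV"

abbreviation Xneg :: "('s \<Rightarrow> 's \<Rightarrow> nat) \<Rightarrow> (int \<Rightarrow> 's) set" where
  "Xneg A \<equiv> shift_space A {..0}"

text \<open>The case distinction is the convention \<open>2 ^ (- inf {}) = 0\<close>.\<close>

definition shift_dist :: "(int \<Rightarrow> 's) \<Rightarrow> (int \<Rightarrow> 's) \<Rightarrow> real" where
  "shift_dist u v =
     (if u = v then 0 else (1 / 2) ^ (INF i\<in>{i. u i \<noteq> v i}. nat \<bar>i\<bar>))"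

lemma Metric_space_shift_dist: "Metric_space Y shift_dist"
proof
  fix u v :: "int \<Rightarrow> 's"
  show "0 \<le> shift_dist u v" by (simp add: shift_dist_def)
  show "shift_dist u v = shift_dist v u" by (simp add: shift_dist_def eq_commute)
  show "shift_dist u v = 0 \<longleftrightarrow> u = v" by (simp add: shift_dist_def)
next
  fix u v w :: "int \<Rightarrow> 's"
  have le: "(1 / 2) ^ nat \<bar>i\<bar> \<le> shift_dist a b" if "a i \<noteq> b i" for a b :: "int \<Rightarrow> 's" and i
  proof -
    have "(INF j\<in>{j. a j \<noteq> b j}. nat \<bar>j\<bar>) \<le> nat \<bar>i\<bar>"
      using that by (intro cINF_lower) auto
    then have "(1 / 2 :: real) ^ nat \<bar>i\<bar> \<le> (1 / 2) ^ (INF j\<in>{j. a j \<noteq> b j}. nat \<bar>j\<bar>)"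
      by (intro power_decreasing) auto
    moreover have "a \<noteq> b" using that by auto
    ultimately show ?thesis by (simp add: shift_dist_def)
  qed
  have nn: "0 \<le> shift_dist a b" for a b :: "int \<Rightarrow> 's"
    by (simp add: shift_dist_def)
  show "shift_dist u w \<le> shift_dist u v + shift_dist v w"
  proof (cases "u = w")
    case True
    then show ?thesis using nn[of u v] nn[of v w] by (simp add: shift_dist_def)
  next
    case False
    then have "(\<lambda>i. nat \<bar>i\<bar>) ` {i. u i \<noteq> w i} \<noteq> {}" by auto
    then have "(INF i\<in>{i. u i \<noteq> w i}. nat \<bar>i\<bar>) \<in> (\<lambda>i. nat \<bar>i\<bar>) ` {i. u i \<noteq> w i}"
      by (rule Inf_nat_def1)
    then obtain i where i: "u i \<noteq> w i" "(INF i\<in>{i. u i \<noteq> w i}. nat \<bar>i\<bar>) = nat \<bar>i\<bar>"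
      by auto
    then have "shift_dist u w = (1 / 2) ^ nat \<bar>i\<bar>" using False by (simp add: shift_dist_def)
    moreover have "u i \<noteq> v i \<or> v i \<noteq> w i" using i by auto
    ultimately show ?thesis using le[of u i v] le[of v i w] nn[of u v] nn[of v w] by auto
  qed
qed

definition shift_metric :: "('s \<Rightarrow> 's \<Rightarrow> nat) \<Rightarrow> int set \<Rightarrow> (int \<Rightarrow> 's) metric" where
  "shift_metric A I = metric (shift_space A I, shift_dist)"

definition left_shift :: "int set \<Rightarrow> (int \<Rightarrow> 's) \<Rightarrow> (int \<Rightarrow> 's)" where
  "left_shift I u = restrict (\<lambda>i. u (i + 1)) I"

definition right_shift :: "int set \<Rightarrow> (int \<Rightarrow> 's) \<Rightarrow> (int \<Rightarrow> 's)" where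
  "right_shift I u = restrict (\<lambda>i. u (i - 1)) I"

definition pos_part :: "(int \<Rightarrow> 's) \<Rightarrow> (int \<Rightarrow> 's)" where
  "pos_part z = restrict z {0..}"

definition neg_part :: "(int \<Rightarrow> 's) \<Rightarrow> (int \<Rightarrow> 's)" where
  "neg_part z = restrict z {..0}"

definition concat_at :: "(int \<Rightarrow> 's) \<Rightarrow> (int \<Rightarrow> 's) \<Rightarrow> (int \<Rightarrow> 's)" where
  "concat_at y x = (\<lambda>i. if 0 \<le> i then x i else y (i + 1))"

definition transitive_shift :: "('s \<Rightarrow> 's \<Rightarrow> nat) \<Rightarrow> bool" where
  "transitive_shift A \<longleftrightarrow>
     (\<forall>a b. \<exists>n\<ge>1. \<exists>p :: nat \<Rightarrow> 's. p 0 = a \<and> p n = b \<and> (\<forall>i<n. A (p i) (p (i + 1)) = 1))"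

definition locally_compact_shift :: "('s \<Rightarrow> 's \<Rightarrow> nat) \<Rightarrow> bool" where
  "locally_compact_shift A \<longleftrightarrow>
     (\<forall>a. (\<Sum>\<^sub>\<infinity>b. of_nat (A a b)) + (\<Sum>\<^sub>\<infinity>b. of_nat (A b a)) < (\<infinity> :: ennreal))"

definition variation :: "(int \<Rightarrow> 's) set \<Rightarrow> ((int \<Rightarrow> 's) \<Rightarrow> real) \<Rightarrow> nat \<Rightarrow> ennreal" where
  "variation Y \<phi> m =
     (SUP (u, v) \<in> {(u, v). u \<in> Y \<and> v \<in> Y \<and> (\<forall>i. \<bar>i\<bar> \<le> int m - 1 \<longrightarrow> u i = v i)}.
        ennreal \<bar>\<phi> u - \<phi> v\<bar>)"

definition summable_variations :: "(int \<Rightarrow> 's) set \<Rightarrow> ((int \<Rightarrow> 's) \<Rightarrow> real) \<Rightarrow> bool" where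
  "summable_variations Y \<phi> \<longleftrightarrow> (\<Sum>m. variation Y \<phi> (m + 2)) < \<infinity>"

definition cohomologous_via ::
  "('s \<Rightarrow> 's \<Rightarrow> nat) \<Rightarrow> ((int \<Rightarrow> 's) \<Rightarrow> real) \<Rightarrow> ((int \<Rightarrow> 's) \<Rightarrow> real) \<Rightarrow> ((int \<Rightarrow> 's) \<Rightarrow> real) \<Rightarrow> bool"
where
  "cohomologous_via A \<phi> \<phi>m \<psi> \<longleftrightarrow>
     (\<forall>z\<in>Xtwo A. \<phi> (pos_part z) - \<phi>m (neg_part z) = \<psi> z - \<psi> (left_shift UNIV z))"

text \<open>
  In a locally compact shift every point has finitely many preimages, so that the two sums below
  are finite.
\<close>

definition ruelle_pos ::
  "('s \<Rightarrow> 's \<Rightarrow> nat) \<Rightarrow> ((int \<Rightarrow> 's) \<Rightarrow> real) \<Rightarrow> ((int \<Rightarrow> 's) \<Rightarrow> real) \<Rightarrow> (int \<Rightarrow> 's) \<Rightarrow> real"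
where
  "ruelle_pos A \<phi> f x = (\<Sum>\<^sub>\<infinity>x'\<in>{x' \<in> Xpos A. left_shift {0..} x' = x}. exp (\<phi> x') * f x')"

definition ruelle_neg ::
  "('s \<Rightarrow> 's \<Rightarrow> nat) \<Rightarrow> ((int \<Rightarrow> 's) \<Rightarrow> real) \<Rightarrow> ((int \<Rightarrow> 's) \<Rightarrow> real) \<Rightarrow> (int \<Rightarrow> 's) \<Rightarrow> real"
where
  "ruelle_neg A \<phi>m f y = (\<Sum>\<^sub>\<infinity>y'\<in>{y' \<in> Xneg A. right_shift {..0} y' = y}. exp (\<phi>m y') * f y')"

text \<open>
  Radon measures on a locally compact Hausdorff space: Borel measures that are finite on compact
  sets, outer regular on Borel sets and inner regular on open sets.
\<close>

definition radon_measure :: "'a topology \<Rightarrow> 'a measure \<Rightarrow> bool" where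
  "radon_measure T \<mu> \<longleftrightarrow>
     sets \<mu> = sets (sigma (topspace T) {U. openin T U}) \<and>
     (\<forall>K. compactin T K \<longrightarrow> emeasure \<mu> K < \<infinity>) \<and>
     (\<forall>B\<in>sets \<mu>. emeasure \<mu> B = (INF U\<in>{U. openin T U \<and> B \<subseteq> U}. emeasure \<mu> U)) \<and>
     (\<forall>U. openin T U \<longrightarrow> emeasure \<mu> U = (SUP K\<in>{K. compactin T K \<and> K \<subseteq> U}. emeasure \<mu> K))"

definition conformal_measure ::
  "('s \<Rightarrow> 's \<Rightarrow> nat) \<Rightarrow> ((int \<Rightarrow> 's) \<Rightarrow> real) \<Rightarrow> real \<Rightarrow> (int \<Rightarrow> 's) measure \<Rightarrow> bool"
where
  "conformal_measure A \<phi>m lam \<mu> \<longleftrightarrow>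
     radon_measure (mtopology_of (shift_metric A {..0})) \<mu> \<and>
     (\<forall>K. compactin (mtopology_of (shift_metric A {..0})) K \<longrightarrow>
        (\<integral>\<^sup>+y. ennreal (ruelle_neg A \<phi>m (indicator K) y) \<partial>\<mu>) = ennreal lam * emeasure \<mu> K)"

definition nonzero_conformal_measures ::
  "('s \<Rightarrow> 's \<Rightarrow> nat) \<Rightarrow> ((int \<Rightarrow> 's) \<Rightarrow> real) \<Rightarrow> real \<Rightarrow> (int \<Rightarrow> 's) measure set"
where
  "nonzero_conformal_measures A \<phi>m lam =
     {\<mu>. conformal_measure A \<phi>m lam \<mu> \<and> emeasure \<mu> (space \<mu>) \<noteq> 0}"

text \<open>
  Functions on \<open>X\<^sup>+\<close> are represented extensionally, so that equality of elements of the
  following set is equality of functions on \<open>X\<^sup>+\<close>.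
\<close>

definition eigenfunctions ::
  "('s \<Rightarrow> 's \<Rightarrow> nat) \<Rightarrow> ((int \<Rightarrow> 's) \<Rightarrow> real) \<Rightarrow> real \<Rightarrow> ((int \<Rightarrow> 's) \<Rightarrow> real) set"
where
  "eigenfunctions A \<phi> lam =
     {f \<in> extensional (Xpos A).
        continuous_map (mtopology_of (shift_metric A {0..})) euclideanreal f \<and>
        (\<forall>x\<in>Xpos A. f x > 0) \<and>
        (\<forall>x\<in>Xpos A. ruelle_pos A \<phi> f x = lam * f x) \<and>
        uniformly_continuous_map (shift_metric A {0..}) euclidean_metric (\<lambda>x. ln (f x))}"

definition chi ::
  "('s \<Rightarrow> 's \<Rightarrow> nat) \<Rightarrow> ((int \<Rightarrow> 's) \<Rightarrow> real) \<Rightarrow> (int \<Rightarrow> 's) \<Rightarrow> (int \<Rightarrow> 's) \<Rightarrow> real"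
where
  "chi A \<psi> x y = (if A (y 0) (x 0) = 1 then exp (- \<psi> (concat_at y x)) else 0)"

definition pi_map ::
  "('s \<Rightarrow> 's \<Rightarrow> nat) \<Rightarrow> ((int \<Rightarrow> 's) \<Rightarrow> real) \<Rightarrow> (int \<Rightarrow> 's) measure \<Rightarrow> (int \<Rightarrow> 's) \<Rightarrow> real"
where
  "pi_map A \<psi> \<mu> = (\<lambda>x\<in>Xpos A. \<integral>y. chi A \<psi> x y \<partial>\<mu>)"

definition add_measure :: "'a measure \<Rightarrow> 'a measure \<Rightarrow> 'a measure" where
  "add_measure \<mu> \<nu> = measure_of (space \<mu>) (sets \<mu>) (\<lambda>B. emeasure \<mu> B + emeasure \<nu> B)"

lemma emeasure_add_measure:
  assumes "sets \<nu> = sets \<mu>" and "B \<in> sets \<mu>"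
  shows "emeasure (add_measure \<mu> \<nu>) B = emeasure \<mu> B + emeasure \<nu> B"
  unfolding add_measure_def
proof (rule emeasure_measure_of_sigma)
  show "countably_additive (sets \<mu>) (\<lambda>B. emeasure \<mu> B + emeasure \<nu> B)"
    using assms(1) by (auto simp: countably_additive_def suminf_add[symmetric] suminf_emeasure)
qed (use assms in \<open>auto simp: positive_def sets.sigma_algebra_axioms\<close>)

end

theory Submission
  imports Defs
begin

text \<open>
  Cohomology makes \<open>\<chi>\<close> intertwine the two Ruelle operators: writing \<open>c x\<close> and \<open>u c\<close> for the one-letter
  extensions, \<open>exp (\<phi> (c x)) \<chi>\<^bsub>c x\<^esub>(u) = exp (\<phi>\<^sup>- (u c)) \<chi>\<^sub>x(u c)\<close>. Hence, for a conformal \<open>\<mu>\<close>, the measures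
  \<open>\<nu>\<^sub>x = \<chi>\<^sub>x \<mu>\<close> have total mass \<open>f(x) = (\<pi> \<mu>)(x)\<close> and satisfy the exact recursion
  \<open>\<lambda> \<nu>\<^sub>x(B \<inter> [c]) = exp (\<phi> (c x)) \<nu>\<^bsub>c x\<^esub>{u. u c \<in> B}\<close>. So \<open>f\<close> is an eigenfunction, and \<open>f\<close> determines every \<open>\<nu>\<^sub>x\<close> on
  cylinders and thus \<open>\<mu>\<close>, which gives injectivity.

  Conversely, for an eigenfunction \<open>f\<close> the recursion defines a consistent content on cylinders: additivity
  is the eigenvalue equation, and countable additivity follows from compactness of cylinders. This gives
  measures \<open>\<nu>\<^sub>x\<close>, and \<open>\<mu>\<close> should be \<open>\<nu>\<^sub>x / \<chi>\<^sub>x\<close> on the support of \<open>\<chi>\<^sub>x\<close>. That \<open>\<nu>\<^sub>x / \<chi>\<^sub>x\<close> does not depend on \<open>x\<close> follows by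
  comparing long cylinders: there the two quotients differ by a factor arbitrarily close to 1, because
  \<open>\<psi>\<close> and \<open>ln f\<close> are uniformly continuous.
\<close>

section \<open>Topology and Borel sets of the one-sided shift\<close>

text \<open>The recursion consumes a word from its last letter, the one next to the origin, whereas
  refining a cylinder adds letters at its far left end. Consistency of the content therefore cannot
  be read off a single step: once all n letters have been moved in front of x, the mass left over is
  f at the extended point, and only there does the eigenvalue equation split it over one further
  letter.

  Along these n steps the cohomology telescopes. The mass of the n-letter cylinder around y becomes
  \<chi>_x(y) times a factor free of x times f(j) / \<chi>_j(b), where j is the word followed by x
  and b is what remains of y. For two choices of x the points j share n letters, which is what makes
  the last quotients comparable.

  The measure \<mu> may be infinite, and no single \<chi>_x is positive everywhere. So \<mu> is
  compared and assembled on the compact open sets \<open>last_cyl A c\<close>, each time with an x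
  that may follow c.\<close>

lemma Xneg_iff: "y \<in> Xneg A \<longleftrightarrow> (\<forall>i>0. y i = undefined) \<and> (\<forall>i<0. A (y i) (y (i + 1)) = 1)"
  by (auto simp: shift_space_def PiE_iff extensional_def)

lemma Xpos_iff: "x \<in> Xpos A \<longleftrightarrow> (\<forall>i<0. x i = undefined) \<and> (\<forall>i\<ge>0. A (x i) (x (i + 1)) = 1)"
  by (auto simp: shift_space_def PiE_iff extensional_def)

lemma Xtwo_iff: "z \<in> Xtwo A \<longleftrightarrow> (\<forall>i. A (z i) (z (i + 1)) = 1)"
  by (auto simp: shift_space_def)

text \<open>The exponents are natural numbers, so the infimum over the indices of disagreement is
  attained, and it exceeds n exactly when every such index does.\<close>

lemma shift_dist_less_iff:
  "shift_dist u v < (1 / 2) ^ n \<longleftrightarrow> (\<forall>i. \<bar>i\<bar> \<le> int n \<longrightarrow> u i = v i)"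
proof (cases "u = v")
  case False
  let ?S = "{i. u i \<noteq> v i}"
  have ne: "(\<lambda>i. nat \<bar>i\<bar>) ` ?S \<noteq> {}" using False by auto
  have "shift_dist u v < (1 / 2) ^ n \<longleftrightarrow> n < (INF i\<in>?S. nat \<bar>i\<bar>)"
    using False by (simp add: shift_dist_def power_strict_decreasing_iff)
  also have "\<dots> \<longleftrightarrow> (\<forall>i\<in>?S. n < nat \<bar>i\<bar>)"
  proof
    assume "n < (INF i\<in>?S. nat \<bar>i\<bar>)"
    then show "\<forall>i\<in>?S. n < nat \<bar>i\<bar>"
      by (meson cINF_lower bdd_below_bot less_le_trans)
  next
    assume "\<forall>i\<in>?S. n < nat \<bar>i\<bar>"
    then show "n < (INF i\<in>?S. nat \<bar>i\<bar>)"
      using Inf_nat_def1[OF ne] by auto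
  qed
  also have "\<dots> \<longleftrightarrow> (\<forall>i. \<bar>i\<bar> \<le> int n \<longrightarrow> u i = v i)"
    by (auto simp: zless_nat_eq_int_zless not_less[symmetric])
  finally show ?thesis .
qed (simp add: shift_dist_def)

lemma mspace_shift_metric [simp]: "mspace (shift_metric A I) = shift_space A I"
  unfolding shift_metric_def by (rule Metric_space.mspace_metric[OF Metric_space_shift_dist])

lemma mdist_shift_metric [simp]: "mdist (shift_metric A I) = shift_dist"
  unfolding shift_metric_def by (rule Metric_space.mdist_metric[OF Metric_space_shift_dist])

lemma half_power_less: "0 < (\<delta>::real) \<Longrightarrow> \<exists>n. (1 / 2) ^ n < \<delta>"
  by (rule real_arch_pow_inv) auto

lemma uniformly_continuous_shift_iff:
  "uniformly_continuous_map (shift_metric A I) euclidean_metric (g :: _ \<Rightarrow> real) \<longleftrightarrow>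
     (\<forall>\<epsilon>>0. \<exists>n::nat. \<forall>u\<in>shift_space A I. \<forall>v\<in>shift_space A I.
        (\<forall>i. \<bar>i\<bar> \<le> int n \<longrightarrow> u i = v i) \<longrightarrow> \<bar>g u - g v\<bar> < \<epsilon>)"
  (is "?L = ?R")
proof
  assume L: ?L
  show ?R
  proof (intro allI impI)
    fix \<epsilon> :: real assume "0 < \<epsilon>"
    with L obtain \<delta> where "\<delta> > 0" and \<delta>: "\<And>x y. x \<in> shift_space A I \<Longrightarrow> y \<in> shift_space A I \<Longrightarrow>
        shift_dist y x < \<delta> \<Longrightarrow> dist (g y) (g x) < \<epsilon>"
      unfolding uniformly_continuous_map_def by auto
    obtain n where "(1 / 2) ^ n < \<delta>" using half_power_less[OF \<open>\<delta> > 0\<close>] by auto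
    then show "\<exists>n::nat. \<forall>u\<in>shift_space A I. \<forall>v\<in>shift_space A I.
        (\<forall>i. \<bar>i\<bar> \<le> int n \<longrightarrow> u i = v i) \<longrightarrow> \<bar>g u - g v\<bar> < \<epsilon>"
      using \<delta> by (intro exI[of _ n]) (fastforce simp: dist_real_def shift_dist_less_iff[symmetric])
  qed
next
  assume R: ?R
  show ?L
    unfolding uniformly_continuous_map_def
  proof (intro conjI allI impI)
    fix \<epsilon> :: real assume "0 < \<epsilon>"
    with R obtain n :: nat where n: "\<And>u v. u \<in> shift_space A I \<Longrightarrow> v \<in> shift_space A I \<Longrightarrow>
        (\<forall>i. \<bar>i\<bar> \<le> int n \<longrightarrow> u i = v i) \<Longrightarrow> \<bar>g u - g v\<bar> < \<epsilon>" by metis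
    then show "\<exists>\<delta>>0. \<forall>x\<in>mspace (shift_metric A I). \<forall>y\<in>mspace (shift_metric A I).
        mdist (shift_metric A I) y x < \<delta> \<longrightarrow> mdist euclidean_metric (g y) (g x) < \<epsilon>"
      by (intro exI[of _ "(1 / 2) ^ n"]) (auto simp: dist_real_def shift_dist_less_iff)
  qed auto
qed

section \<open>Cylinders, open sets and Borel sets of X^-\<close>

definition cyl :: "('s \<Rightarrow> 's \<Rightarrow> nat) \<Rightarrow> nat \<Rightarrow> (int \<Rightarrow> 's) \<Rightarrow> (int \<Rightarrow> 's) set" where
  "cyl A n y = {v \<in> Xneg A. \<forall>i. - int n < i \<longrightarrow> v i = y i}"

abbreviation Tneg :: "('s \<Rightarrow> 's \<Rightarrow> nat) \<Rightarrow> (int \<Rightarrow> 's) topology" where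
  "Tneg A \<equiv> mtopology_of (shift_metric A {..0})"

definition Bneg :: "('s \<Rightarrow> 's \<Rightarrow> nat) \<Rightarrow> (int \<Rightarrow> 's) measure" where
  "Bneg A = sigma (Xneg A) {U. openin (Tneg A) U}"

definition last_cyl :: "('s \<Rightarrow> 's \<Rightarrow> nat) \<Rightarrow> 's \<Rightarrow> (int \<Rightarrow> 's) set" where
  "last_cyl A c = {y \<in> Xneg A. y 0 = c}"

lemma cyl_subset: "cyl A n y \<subseteq> Xneg A"
  by (auto simp: cyl_def)

lemma cyl_self: "y \<in> Xneg A \<Longrightarrow> y \<in> cyl A n y"
  by (auto simp: cyl_def)

lemma cyl_eq: "v \<in> cyl A n y \<Longrightarrow> cyl A n v = cyl A n y"
  by (auto simp: cyl_def)

lemma cyl_antimono: "m \<le> n \<Longrightarrow> cyl A n y \<subseteq> cyl A m y"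
  by (auto simp: cyl_def)

text \<open>The empty word constrains only positive indices, where all points are
  \<open>undefined\<close>. Having the whole space among the cylinders lets total masses enter as
  the case n = 0.\<close>

lemma cyl_0: "y \<in> Xneg A \<Longrightarrow> cyl A 0 y = Xneg A"
  by (auto simp: cyl_def Xneg_iff)

lemma cyl_sub_last: "1 \<le> n \<Longrightarrow> cyl A n y \<subseteq> last_cyl A (y 0)"
  by (auto simp: cyl_def last_cyl_def)

lemma last_cyl_eq: "y \<in> Xneg A \<Longrightarrow> last_cyl A (y 0) = cyl A (Suc 0) y"
proof -
  assume y: "y \<in> Xneg A"
  have "v 0 = y 0 \<longleftrightarrow> (\<forall>i. - int (Suc 0) < i \<longrightarrow> v i = y i)" if v: "v \<in> Xneg A" for v
  proof safe
    fix i :: int assume h: "v 0 = y 0" "- int (Suc 0) < i"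
    show "v i = y i"
    proof (cases "i = 0")
      case False
      then show ?thesis using h v y by (auto simp: Xneg_iff)
    qed (use h in simp)
  qed auto
  then show ?thesis by (auto simp: cyl_def last_cyl_def)
qed

text \<open>The ball of radius (1/2)^n is the cylinder of n + 1 letters; from here on cylinders
  replace the metric of X^-.\<close>

lemma openin_Tneg: "openin (Tneg A) U \<longleftrightarrow> U \<subseteq> Xneg A \<and> (\<forall>y\<in>U. \<exists>n. cyl A n y \<subseteq> U)"
proof -
  interpret Metric_space "Xneg A" shift_dist by (rule Metric_space_shift_dist)
  have ball: "mball y ((1 / 2) ^ n) = cyl A (Suc n) y" if "y \<in> Xneg A" for y n
  proof -
    have "(\<forall>i. \<bar>i\<bar> \<le> int n \<longrightarrow> y i = v i) \<longleftrightarrow> (\<forall>i. - int (Suc n) < i \<longrightarrow> v i = y i)"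
      if v: "v \<in> Xneg A" for v
    proof safe
      fix i assume h: "\<forall>i. \<bar>i\<bar> \<le> int n \<longrightarrow> y i = v i" "- int (Suc n) < i"
      show "v i = y i"
      proof (cases "i \<le> 0")
        case True
        then have "\<bar>i\<bar> \<le> int n" using h(2) by linarith
        then show ?thesis using h(1) by simp
      next
        case False
        then show ?thesis using v \<open>y \<in> Xneg A\<close> by (auto simp: Xneg_iff)
      qed
    qed auto
    then show ?thesis using that by (auto simp: mball_def shift_dist_less_iff cyl_def)
  qed
  show ?thesis
    unfolding shift_metric_def mtopology_of openin_mtopology
  proof safe
    fix y assume U: "U \<subseteq> Xneg A" "\<forall>x. x \<in> U \<longrightarrow> (\<exists>r>0. mball x r \<subseteq> U)" "y \<in> U"
    then obtain r where "r > 0" "mball y r \<subseteq> U" by auto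
    moreover obtain n where "(1 / 2) ^ n < r" using half_power_less[OF \<open>r > 0\<close>] by auto
    ultimately show "\<exists>n. cyl A n y \<subseteq> U"
      using ball[of y n] U mball_subset_concentric[of "(1 / 2) ^ n" r y] by (metis less_imp_le subset_trans subsetD)
  next
    fix y assume U: "U \<subseteq> Xneg A" "\<forall>y\<in>U. \<exists>n. cyl A n y \<subseteq> U" "y \<in> U"
    then obtain n where "cyl A n y \<subseteq> U" by auto
    with U ball[of y n] cyl_antimono[of n "Suc n" A y] have "mball y ((1 / 2) ^ n) \<subseteq> U"
      by (metis le_SucI order_refl subset_iff)
    moreover have "0 < (1 / 2 :: real) ^ n" by simp
    ultimately show "\<exists>r>0. mball y r \<subseteq> U" by blast
  qed
qed

lemma topspace_Tneg [simp]: "topspace (Tneg A) = Xneg A"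
  by simp

lemma space_Bneg [simp]: "space (Bneg A) = Xneg A"
  unfolding Bneg_def by (intro space_measure_of) (auto simp: openin_Tneg)

lemma sets_Bneg: "sets (Bneg A) = sigma_sets (Xneg A) {U. openin (Tneg A) U}"
  unfolding Bneg_def by (intro sets_measure_of) (auto simp: openin_Tneg)

lemma openin_cyl: "openin (Tneg A) (cyl A n y)"
  unfolding openin_Tneg using cyl_eq[of _ A n y] cyl_subset[of A n y] by (metis order_refl)

lemma openin_last_cyl: "openin (Tneg A) (last_cyl A c)"
  unfolding openin_Tneg
proof safe
  fix y assume y: "y \<in> last_cyl A c"
  then show "\<exists>n. cyl A n y \<subseteq> last_cyl A c"
    using last_cyl_eq[of y A] by (intro exI[of _ "Suc 0"]) (auto simp: last_cyl_def)
qed (auto simp: last_cyl_def)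

lemma open_sets_Bneg: "openin (Tneg A) U \<Longrightarrow> U \<in> sets (Bneg A)"
  by (simp add: sets_Bneg sigma_sets.Basic)

lemma cyl_sets [measurable, simp]: "cyl A n y \<in> sets (Bneg A)"
  by (intro open_sets_Bneg openin_cyl)

lemma last_cyl_sets [measurable, simp]: "last_cyl A c \<in> sets (Bneg A)"
  by (intro open_sets_Bneg openin_last_cyl)

lemma closed_sets_Bneg:
  assumes "closedin (Tneg A) K"
  shows "K \<in> sets (Bneg A)"
proof -
  have "Xneg A - K \<in> sets (Bneg A)"
    using assms by (auto simp: closedin_def intro: open_sets_Bneg)
  then have "space (Bneg A) - (Xneg A - K) \<in> sets (Bneg A)" by blast
  moreover have "K \<subseteq> Xneg A" using assms closedin_subset by fastforce
  ultimately show ?thesis by (simp add: double_diff)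
qed

lemma Hausdorff_Tneg: "Hausdorff_space (Tneg A)"
  by (metis Metric_space.Hausdorff_space_mtopology Metric_space_mspace_mdist mtopology_of_def)

lemma compact_sets_Bneg: "compactin (Tneg A) K \<Longrightarrow> K \<in> sets (Bneg A)"
  by (intro closed_sets_Bneg compactin_imp_closedin Hausdorff_Tneg)

text \<open>A cylinder is determined by its word, and there are countably many finite words over
  S.\<close>

lemma countable_cyl:
  assumes "countable (UNIV :: 's set)"
  shows "countable {cyl A n y | n y. y \<in> Xneg (A :: 's \<Rightarrow> 's \<Rightarrow> nat)}"
proof -
  define w where "w n y = map (\<lambda>k. y (- int k)) [0..<n]" for n :: nat and y :: "int \<Rightarrow> 's"
  have w: "cyl A n y = {v \<in> Xneg A. w n v = w n y}" if "y \<in> Xneg A" for n y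
  proof -
    have "(\<forall>i. - int n < i \<longrightarrow> v i = y i) \<longleftrightarrow> w n v = w n y" if "v \<in> Xneg A" for v
    proof -
      have "w n v = w n y \<longleftrightarrow> (\<forall>k<n. v (- int k) = y (- int k))" by (auto simp: w_def)
      also have "\<dots> \<longleftrightarrow> (\<forall>i. - int n < i \<longrightarrow> v i = y i)"
      proof safe
        fix i assume h: "\<forall>k<n. v (- int k) = y (- int k)" "- int n < i"
        show "v i = y i"
        proof (cases "i \<le> 0")
          case True
          then have "i = - int (nat (- i))" "nat (- i) < n" using h(2) by auto
          then show ?thesis using h(1) by metis
        next
          case False
          then show ?thesis using \<open>y \<in> Xneg A\<close> \<open>v \<in> Xneg A\<close> by (auto simp: Xneg_iff)
        qed
      qed auto
      finally show ?thesis ..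
    qed
    then show ?thesis by (auto simp: cyl_def)
  qed
  have "{cyl A n y | n y. y \<in> Xneg A} \<subseteq> (\<lambda>(n, l). {v \<in> Xneg A. w n v = l}) ` (UNIV \<times> UNIV)"
    using w by (auto simp: image_iff) metis
  moreover have "countable (UNIV :: 's list set)"
    using countable_lists[OF assms] by simp
  then have "countable ((\<lambda>(n :: nat, l). {v \<in> Xneg A. w n v = l}) ` (UNIV \<times> UNIV))"
    by (intro countable_image countable_SIGMA) auto
  ultimately show ?thesis by (rule countable_subset)
qed

text \<open>Only nonempty words appear: under finite branching their cylinders are compact
  (\<open>compact_cyl\<close>), which the whole space need not be. Inner regularity rests on
  this.\<close>

lemma open_eq_Union_cyl:
  assumes "openin (Tneg A) U"
  shows "U = \<Union>{C \<in> {cyl A (Suc n) y | n y. y \<in> Xneg A}. C \<subseteq> U}"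
proof
  show "U \<subseteq> \<Union>{C \<in> {cyl A (Suc n) y | n y. y \<in> Xneg A}. C \<subseteq> U}"
  proof
    fix y assume "y \<in> U"
    then obtain n where "cyl A n y \<subseteq> U" "y \<in> Xneg A" using assms unfolding openin_Tneg by blast
    then show "y \<in> \<Union>{C \<in> {cyl A (Suc n) y | n y. y \<in> Xneg A}. C \<subseteq> U}"
      using cyl_self[of y A "Suc n"] cyl_antimono[of n "Suc n" A y] by fastforce
  qed
qed auto

text \<open>The empty set is added because disjoint cylinders occur and the family has to be closed
  under intersection.\<close>

definition cyl_family :: "('s \<Rightarrow> 's \<Rightarrow> nat) \<Rightarrow> (int \<Rightarrow> 's) set set" where
  "cyl_family A = insert {} {cyl A n y | n y. y \<in> Xneg A}"

lemma sets_Bneg_cyl: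
  assumes "countable (UNIV :: 's set)"
  shows "sets (Bneg A) = sigma_sets (Xneg A) (cyl_family (A :: 's \<Rightarrow> 's \<Rightarrow> nat))"
proof
  have "{U. openin (Tneg A) U} \<subseteq> sigma_sets (Xneg A) (cyl_family A)"
  proof
    fix U assume "U \<in> {U. openin (Tneg A) U}"
    then have U: "openin (Tneg A) U" by simp
    interpret S: sigma_algebra "Xneg A" "sigma_sets (Xneg A) (cyl_family A)"
      by (intro sigma_algebra_sigma_sets) (auto simp: cyl_family_def cyl_def)
    have "countable {C \<in> {cyl A (Suc n) y | n y. y \<in> Xneg A}. C \<subseteq> U}"
      by (rule countable_subset[OF _ countable_cyl[OF assms, of A]]) auto
    then have "\<Union>{C \<in> {cyl A (Suc n) y | n y. y \<in> Xneg A}. C \<subseteq> U} \<in> sigma_sets (Xneg A) (cyl_family A)"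
      by (intro S.countable_Union)
        (auto simp: cyl_family_def intro!: sigma_sets.Basic)
    then show "U \<in> sigma_sets (Xneg A) (cyl_family A)" using open_eq_Union_cyl[OF U] by simp
  qed
  then show "sets (Bneg A) \<subseteq> sigma_sets (Xneg A) (cyl_family A)"
    unfolding sets_Bneg by (rule sigma_sets_mono)
  show "sigma_sets (Xneg A) (cyl_family A) \<subseteq> sets (Bneg A)"
    unfolding sets_Bneg
    by (rule sigma_sets_mono') (auto simp: cyl_family_def openin_cyl)
qed

text \<open>Two cylinders that meet are nested, since both can be recentred at a common
  point.\<close>

lemma Int_stable_cyl: "Int_stable (cyl_family A)"
proof (rule Int_stableI)
  fix B C assume BC: "B \<in> cyl_family A" "C \<in> cyl_family A"
  show "B \<inter> C \<in> cyl_family A"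
  proof (cases "B \<inter> C = {}")
    case False
    then obtain v where v: "v \<in> B" "v \<in> C" by auto
    with BC obtain n y m z where *: "B = cyl A n y" "C = cyl A m z"
      by (auto simp: cyl_family_def)
    have "cyl A n v \<inter> cyl A m v = cyl A (max n m) v"
      by (cases "n \<le> m") (auto simp: cyl_def max_def)
    moreover have "v \<in> Xneg A" using v * cyl_subset[of A n y] by auto
    ultimately show ?thesis
      using cyl_eq[of v A n y] cyl_eq[of v A m z] v * by (auto simp: cyl_family_def)
  qed (simp add: cyl_family_def)
qed

text \<open>The whole space is itself a cylinder, so finite total mass replaces an exhaustion by
  sets of finite measure. Infinite measures have to be restricted to some
  \<open>last_cyl A c\<close> first.\<close>

lemma measure_eqI_cyl:
  fixes A :: "'s \<Rightarrow> 's \<Rightarrow> nat"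
  assumes cnt: "countable (UNIV :: 's set)"
    and M: "sets M = sets (Bneg A)" and N: "sets N = sets (Bneg A)"
    and eq: "\<And>n y. y \<in> Xneg A \<Longrightarrow> emeasure M (cyl A n y) = emeasure N (cyl A n y)"
    and fin: "emeasure M (Xneg A) \<noteq> \<infinity>"
  shows "M = N"
proof (cases "Xneg A = {}")
  case True
  then have "space M = {}" "space N = {}"
    using M N sets_eq_imp_space_eq[of M "Bneg A"] sets_eq_imp_space_eq[of N "Bneg A"] by auto
  then show ?thesis by (auto dest!: space_empty)
next
  case False
  then obtain y where y: "y \<in> Xneg A" by auto
  show ?thesis
  proof (rule measure_eqI_generator_eq[of "cyl_family A" "Xneg A" M N "\<lambda>_. Xneg A"])
    show "range (\<lambda>_::nat. Xneg A) \<subseteq> cyl_family A"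
      using y cyl_0[OF y] by (auto simp: cyl_family_def)
  qed (use assms y Int_stable_cyl sets_Bneg_cyl[OF cnt, of A] in
      \<open>auto simp: cyl_family_def cyl_def\<close>)
qed

lemma borel_measurable_Bneg:
  fixes g :: "_ \<Rightarrow> real"
  assumes "\<And>y \<epsilon>. y \<in> Xneg A \<Longrightarrow> \<epsilon> > 0 \<Longrightarrow> \<exists>n. \<forall>v\<in>cyl A n y. \<bar>g v - g y\<bar> < \<epsilon>"
  shows "g \<in> borel_measurable (Bneg A)"
proof (rule borel_measurableI)
  fix S :: "real set" assume "open S"
  have "openin (Tneg A) (g -` S \<inter> Xneg A)"
    unfolding openin_Tneg
  proof safe
    fix y assume y: "g y \<in> S" "y \<in> Xneg A"
    then obtain \<epsilon> where "\<epsilon> > 0" and \<epsilon>: "\<And>t. dist t (g y) < \<epsilon> \<Longrightarrow> t \<in> S"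
      using \<open>open S\<close> by (metis open_dist)
    obtain n where "\<forall>v\<in>cyl A n y. \<bar>g v - g y\<bar> < \<epsilon>" using assms[OF y(2) \<open>\<epsilon> > 0\<close>] by auto
    then show "\<exists>n. cyl A n y \<subseteq> g -` S \<inter> Xneg A"
      using \<epsilon> cyl_subset[of A n y] by (intro exI[of _ n]) (auto simp: dist_real_def)
  qed
  then show "g -` S \<inter> space (Bneg A) \<in> sets (Bneg A)"
    by (simp add: open_sets_Bneg)
qed

text \<open>If no \<open>m\<close> worked, every variation would be at least \<epsilon> and the
  series would diverge.\<close>

lemma summable_variations_small:
  assumes "summable_variations Y \<phi>" "\<epsilon> > 0"
  shows "\<exists>m. \<forall>u\<in>Y. \<forall>v\<in>Y. (\<forall>i. \<bar>i\<bar> \<le> int m - 1 \<longrightarrow> u i = v i) \<longrightarrow> \<bar>\<phi> u - \<phi> v\<bar> < \<epsilon>"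
proof (rule ccontr)
  assume "\<not> ?thesis"
  then have *: "\<exists>u\<in>Y. \<exists>v\<in>Y. (\<forall>i. \<bar>i\<bar> \<le> int m - 1 \<longrightarrow> u i = v i) \<and> \<epsilon> \<le> \<bar>\<phi> u - \<phi> v\<bar>" for m
    by (meson not_le)
  have "ennreal \<epsilon> \<le> variation Y \<phi> m" for m
  proof -
    obtain u v where "u \<in> Y" "v \<in> Y" "\<forall>i. \<bar>i\<bar> \<le> int m - 1 \<longrightarrow> u i = v i" "\<epsilon> \<le> \<bar>\<phi> u - \<phi> v\<bar>"
      using * by blast
    then show ?thesis
      unfolding variation_def by (intro SUP_upper2[of "(u, v)"]) (auto intro: ennreal_leI)
  qed
  then have "(\<Sum>m::nat. ennreal \<epsilon>) \<le> (\<Sum>m. variation Y \<phi> (m + 2))"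
    by (intro suminf_le) auto
  moreover have "(\<Sum>m::nat. ennreal \<epsilon>) = \<infinity>"
    using \<open>\<epsilon> > 0\<close> by (simp flip: nn_integral_count_space_nat)
  ultimately show False using assms(1) by (simp add: summable_variations_def top_unique)
qed

section \<open>Compactness of cylinders and Radon measures\<close>

text \<open>Sets whose membership depends on the last n letters: unions, possibly infinite, of
  n-letter cylinders. Over all n they form a ring of clopen sets, on which the content is defined
  later.\<close>

definition level :: "('s \<Rightarrow> 's \<Rightarrow> nat) \<Rightarrow> nat \<Rightarrow> (int \<Rightarrow> 's) set \<Rightarrow> bool" where
  "level A n K \<longleftrightarrow> K \<subseteq> Xneg A \<and> (\<forall>y\<in>K. cyl A n y \<subseteq> K)"

lemma level_mono: "level A m K \<Longrightarrow> m \<le> n \<Longrightarrow> level A n K"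
  using cyl_antimono[of m n A] by (auto simp: level_def) blast

lemma level_cyl: "level A n (cyl A n y)"
  using cyl_eq[of _ A n y] cyl_subset[of A n y] by (auto simp: level_def)

lemma level_last_cyl: "level A (Suc 0) (last_cyl A c)"
  by (auto simp: level_def last_cyl_def cyl_def)

lemma level_Diff: "level A n K \<Longrightarrow> level A n L \<Longrightarrow> level A n (K - L)"
proof -
  assume KL: "level A n K" "level A n L"
  have "v \<notin> L" if "y \<in> K" "y \<notin> L" "v \<in> cyl A n y" for y v
  proof
    assume "v \<in> L"
    then have "cyl A n y \<subseteq> L" using KL(2) cyl_eq[OF that(3)] by (auto simp: level_def)
    moreover have "y \<in> Xneg A" using KL(1) that(1) by (auto simp: level_def)
    ultimately show False using cyl_self[of y A n] that(2) by auto
  qed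
  then show ?thesis using KL(1) unfolding level_def by (meson DiffD1 DiffD2 DiffI subset_iff)
qed

lemma level_Int:
  assumes "level A n K" "level A n L" shows "level A n (K \<inter> L)"
  unfolding level_def
proof (intro conjI ballI)
  show "K \<inter> L \<subseteq> Xneg A" using assms by (auto simp: level_def)
  fix y assume "y \<in> K \<inter> L"
  then show "cyl A n y \<subseteq> K \<inter> L" using assms by (simp add: level_def)
qed

lemma level_Un: "level A n K \<Longrightarrow> level A n L \<Longrightarrow> level A n (K \<union> L)"
  unfolding level_def by blast

lemma level_Xneg: "level A n (Xneg A)"
  by (auto simp: level_def cyl_def)

lemma level_openin: "level A n K \<Longrightarrow> openin (Tneg A) K"
  unfolding openin_Tneg level_def by blast

lemma level_closedin:
  assumes "level A n K" shows "closedin (Tneg A) K"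
  unfolding closedin_def using level_openin[OF level_Diff[OF level_Xneg assms]] assms
  by (auto simp: level_def)

lemma level_sets: "level A n K \<Longrightarrow> K \<in> sets (Bneg A)"
  by (intro open_sets_Bneg level_openin)

text \<open>Covering \<open>B\<close> and its complement simultaneously makes the statement symmetric under complementation.\<close>

lemma emeasure_finite_approx:
  fixes A :: "'s \<Rightarrow> 's \<Rightarrow> nat"
  assumes cnt: "countable (UNIV :: 's set)"
    and M: "sets \<mu> = sets (Bneg A)" and fin: "emeasure \<mu> (Xneg A) \<noteq> \<infinity>"
    and B: "B \<in> sets (Bneg A)"
  shows "e > 0 \<Longrightarrow> \<exists>U V. openin (Tneg A) U \<and> openin (Tneg A) V \<and> B \<subseteq> U \<and> Xneg A - B \<subseteq> V \<and>
    emeasure \<mu> (U \<inter> V) < ennreal e"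
  using B unfolding sets_Bneg_cyl[OF cnt]
proof (induction arbitrary: e)
  case (Basic C)
  have "level A 0 {}" by (simp add: level_def)
  moreover have "C = {} \<or> (\<exists>n y. C = cyl A n y)" using Basic.hyps by (auto simp: cyl_family_def)
  ultimately obtain n where n: "level A n C" using level_cyl by metis
  show ?case
    using level_openin[OF level_Diff[OF level_Xneg n]] level_openin[OF n] Basic.prems
    by - (rule exI[of _ C], rule exI[of _ "Xneg A - C"], simp)
next
  case Empty
  then show ?case
    using level_openin[OF level_Xneg[of A 0]] by - (rule exI[of _ "{}"], rule exI[of _ "Xneg A"], simp)
next
  case (Compl B)
  obtain U V where "openin (Tneg A) U" "openin (Tneg A) V" "B \<subseteq> U" "Xneg A - B \<subseteq> V"
    "emeasure \<mu> (U \<inter> V) < ennreal e" using Compl.IH[OF Compl.prems] by (elim exE conjE)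
  moreover have "Xneg A - (Xneg A - B) \<subseteq> B" by auto
  ultimately show ?case
    by - (rule exI[of _ V], rule exI[of _ U], (auto simp: Int_commute))
next
  case (Union B)
  \<comment> \<open>The budgets add up to e / 2, which leaves room for a strict inequality after
    summation.\<close>
  have "\<exists>U V. openin (Tneg A) U \<and> openin (Tneg A) V \<and> B i \<subseteq> U \<and> Xneg A - B i \<subseteq> V \<and>
    emeasure \<mu> (U \<inter> V) < ennreal (e / 2 * (1 / 2) ^ Suc i)" for i :: nat
    using Union.prems by (intro Union.IH) simp
  then obtain U V where UV: "\<And>i. openin (Tneg A) (U i)" "\<And>i. openin (Tneg A) (V i)" "\<And>i. B i \<subseteq> U i"
    "\<And>i. Xneg A - B i \<subseteq> V i" "\<And>i. emeasure \<mu> (U i \<inter> V i) < ennreal (e / 2 * (1 / 2) ^ Suc i)"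
    by metis
  have [measurable]: "U i \<in> sets \<mu>" "V i \<in> sets \<mu>" for i
    using open_sets_Bneg[OF UV(1)] open_sets_Bneg[OF UV(2)] M by simp_all
  have VX: "V i \<subseteq> Xneg A" for i using UV(2) openin_Tneg by metis
  \<comment> \<open>The intersection of all \<open>V i\<close> need not be open. Its finite
    truncations are, and since the mass is finite, continuity from above makes one of them good
    enough.\<close>
  define W where "W n = (\<Union>i. U i) \<inter> (Xneg A \<inter> (\<Inter>i\<in>{..<n}. V i))" for n
  have Wop: "openin (Tneg A) (Xneg A \<inter> (\<Inter>i\<in>{..<n}. V i))" for n
  proof (induction n)
    case 0
    then show ?case using level_openin[OF level_Xneg[of A 0]] by simp
  next
    case (Suc n)
    have "Xneg A \<inter> (\<Inter>i\<in>{..<Suc n}. V i) = Xneg A \<inter> (\<Inter>i\<in>{..<n}. V i) \<inter> V n"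
      by (auto simp: lessThan_Suc)
    then show ?case using openin_Int[OF Suc UV(2)[of n]] by simp
  qed
  have Uop: "openin (Tneg A) (\<Union>i. U i)" using UV by auto
  have Wm: "W n \<in> sets \<mu>" for n
    using openin_Int[OF Uop Wop] M by (auto simp: W_def intro: open_sets_Bneg)
  have "(\<lambda>n. emeasure \<mu> (W n)) \<longlonglongrightarrow> emeasure \<mu> (\<Inter>n. W n)"
  proof (rule Lim_emeasure_decseq)
    show "emeasure \<mu> (W n) \<noteq> \<infinity>" for n
    proof -
      have "Xneg A \<in> sets \<mu>" using M level_sets[OF level_Xneg] by blast
      then have "emeasure \<mu> (W n) \<le> emeasure \<mu> (Xneg A)"
        by (intro emeasure_mono) (auto simp: W_def)
      then show ?thesis using fin by (auto simp: top_unique)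
    qed
  qed (use Wm in \<open>auto simp: W_def decseq_def\<close>)
  moreover have "emeasure \<mu> (\<Inter>n. W n) < ennreal e"
  proof -
    have sub: "(\<Inter>n. W n) \<subseteq> (\<Union>i. U i \<inter> V i)" by (auto simp: W_def)
    have "emeasure \<mu> (\<Inter>n. W n) \<le> emeasure \<mu> (\<Union>i. U i \<inter> V i)"
      by (intro emeasure_mono sub) measurable
    also have "\<dots> \<le> (\<Sum>i. emeasure \<mu> (U i \<inter> V i))"
      by (intro emeasure_subadditive_countably) auto
    also have "\<dots> \<le> (\<Sum>i. ennreal (e / 2 * (1 / 2) ^ Suc i))"
      using UV(5) by (intro suminf_le less_imp_le) auto
    also have "\<dots> = ennreal (e / 2 * 1)"
      using Union.prems by (intro suminf_ennreal_eq sums_mult power_half_series) auto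
    also have "\<dots> < ennreal e" using Union.prems by (simp add: ennreal_less_iff)
    finally show ?thesis .
  qed
  ultimately have "\<forall>\<^sub>F n in sequentially. emeasure \<mu> (W n) < ennreal e"
    by (rule order_tendstoD)
  then obtain n where "emeasure \<mu> (W n) < ennreal e" by (auto simp: eventually_sequentially)
  moreover have "(\<Union>i. B i) \<subseteq> (\<Union>i. U i)" using UV(3) by blast
  moreover have "Xneg A - (\<Union>i. B i) \<subseteq> Xneg A \<inter> (\<Inter>i\<in>{..<n}. V i)" using UV(4) by blast
  ultimately show ?case
    using Uop Wop[of n]
    by - (rule exI[of _ "\<Union>i. U i"], rule exI[of _ "Xneg A \<inter> (\<Inter>i\<in>{..<n}. V i)"], (auto simp: W_def))
qed

lemma all_int_Suc:
  "(\<forall>i::int. - int (Suc n) < i \<longrightarrow> P i) \<longleftrightarrow> (\<forall>i. - int n < i \<longrightarrow> P i) \<and> P (- int n)"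
proof (intro iffI conjI allI impI)
  fix i :: int assume h: "(\<forall>i. - int n < i \<longrightarrow> P i) \<and> P (- int n)" "- int (Suc n) < i"
  then show "P i" by (cases "i = - int n") auto
qed auto

text \<open>The form in which transitivity and local compactness enter the topology: a path of
  positive length from a letter to itself supplies its neighbours, and finite row and column sums
  bound their number.\<close>

locale markov_shift =
  fixes A :: "'s \<Rightarrow> 's \<Rightarrow> nat"
  assumes cnt: "countable (UNIV :: 's set)"
    and pred_ex: "\<And>b. \<exists>a. A a b = 1"
    and succ_ex: "\<And>a. \<exists>b. A a b = 1"
    and fin_pred: "\<And>b. finite {a. A a b = 1}"
    and fin_succ: "\<And>a. finite {b. A a b = 1}"
begin

text \<open>Extending to the left means choosing a letter in front of the leftmost fixed one, and
  \<open>fin_pred\<close> bounds these choices. For n = 0 there is no fixed letter.\<close>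

lemma cyl_children:
  assumes y: "y \<in> Xneg A" and n: "1 \<le> n"
  shows "finite (cyl A (Suc n) ` cyl A n y)" "\<Union>(cyl A (Suc n) ` cyl A n y) = cyl A n y"
    "disjoint (cyl A (Suc n) ` cyl A n y)"
proof -
  have *: "cyl A (Suc n) v = {u \<in> cyl A n y. u (- int n) = v (- int n)}" if "v \<in> cyl A n y" for v
  proof -
    have y: "\<forall>i. - int n < i \<longrightarrow> v i = y i" using that by (simp add: cyl_def)
    then have "(\<forall>i. - int n < i \<longrightarrow> u i = v i) \<longleftrightarrow> (\<forall>i. - int n < i \<longrightarrow> u i = y i)" for u by simp
    then show ?thesis unfolding cyl_def all_int_Suc by blast
  qed
  show "finite (cyl A (Suc n) ` cyl A n y)"
  proof (rule finite_surj)
    show "finite {a. A a (y (- int n + 1)) = 1}" by (rule fin_pred)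
    show "cyl A (Suc n) ` cyl A n y \<subseteq> (\<lambda>a. {u \<in> cyl A n y. u (- int n) = a}) ` {a. A a (y (- int n + 1)) = 1}"
    proof safe
      fix v assume v: "v \<in> cyl A n y"
      then have "v \<in> Xneg A" "v (- int n + 1) = y (- int n + 1)" by (auto simp: cyl_def)
      moreover have "- int n < 0" using n by simp
      ultimately have "A (v (- int n)) (y (- int n + 1)) = 1" unfolding Xneg_iff by metis
      then show "cyl A (Suc n) v \<in> (\<lambda>a. {u \<in> cyl A n y. u (- int n) = a}) ` {a. A a (y (- int n + 1)) = 1}"
        using *[OF v] by auto
    qed
  qed
  show "\<Union>(cyl A (Suc n) ` cyl A n y) = cyl A n y" using * by auto
  show "disjoint (cyl A (Suc n) ` cyl A n y)"
    unfolding disjoint_def by (auto simp: *)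
qed

text \<open>Koenig's lemma. A cylinder without finite subcover has, by finite branching, a child
  without one. The resulting branch converges to a point, and the member of the cover around that
  point contains a late cylinder of the branch.\<close>

lemma compact_last_cyl: "compactin (Tneg A) (last_cyl A c)"
  unfolding compactin_def
proof (intro conjI allI impI)
  show "last_cyl A c \<subseteq> topspace (Tneg A)" by (auto simp: last_cyl_def)
next
  fix \<U> assume \<U>: "(\<forall>U\<in>\<U>. openin (Tneg A) U) \<and> last_cyl A c \<subseteq> \<Union>\<U>"
  define good where "good C \<longleftrightarrow> (\<exists>\<F>. finite \<F> \<and> \<F> \<subseteq> \<U> \<and> C \<subseteq> \<Union>\<F>)" for C
  show "\<exists>\<F>. finite \<F> \<and> \<F> \<subseteq> \<U> \<and> last_cyl A c \<subseteq> \<Union>\<F>"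
  proof (rule ccontr)
    assume "\<nexists>\<F>. finite \<F> \<and> \<F> \<subseteq> \<U> \<and> last_cyl A c \<subseteq> \<Union>\<F>"
    then have ng: "\<not> good (last_cyl A c)" by (auto simp: good_def)
    have "\<exists>f. \<forall>n. (f n \<in> last_cyl A c \<and> \<not> good (cyl A (Suc n) (f n))) \<and> f (Suc n) \<in> cyl A (Suc n) (f n)"
    proof (rule dependent_nat_choice)
      have "last_cyl A c \<noteq> {}" using ng by (auto simp: good_def)
      then obtain y where y: "y \<in> last_cyl A c" by auto
      then have "last_cyl A c = cyl A (Suc 0) y"
        using last_cyl_eq[of y A] by (simp add: last_cyl_def)
      with y ng show "\<exists>y. y \<in> last_cyl A c \<and> \<not> good (cyl A (Suc 0) y)" by metis
    next
      fix y n assume y: "y \<in> last_cyl A c \<and> \<not> good (cyl A (Suc n) y)"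
      then have yX: "y \<in> Xneg A" by (auto simp: last_cyl_def)
      show "\<exists>v. (v \<in> last_cyl A c \<and> \<not> good (cyl A (Suc (Suc n)) v)) \<and> v \<in> cyl A (Suc n) y"
      proof (rule ccontr)
        assume contra: "\<nexists>v. (v \<in> last_cyl A c \<and> \<not> good (cyl A (Suc (Suc n)) v)) \<and> v \<in> cyl A (Suc n) y"
        have "v \<in> last_cyl A c" if "v \<in> cyl A (Suc n) y" for v
          using that y by (auto simp: last_cyl_def cyl_def)
        then have "\<forall>C\<in>cyl A (Suc (Suc n)) ` cyl A (Suc n) y. good C" using contra by auto
        then obtain F where F: "\<And>C. C \<in> cyl A (Suc (Suc n)) ` cyl A (Suc n) y \<Longrightarrow>
            finite (F C) \<and> F C \<subseteq> \<U> \<and> C \<subseteq> \<Union>(F C)"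
          unfolding good_def by metis
        have "good (cyl A (Suc n) y)"
          unfolding good_def
        proof (intro exI conjI)
          let ?\<F> = "\<Union>C\<in>cyl A (Suc (Suc n)) ` cyl A (Suc n) y. F C"
          show "finite ?\<F>" using cyl_children(1)[OF yX, of "Suc n"] F by (intro finite_UN_I) auto
          show "?\<F> \<subseteq> \<U>" using F by (intro UN_least) auto
          show "cyl A (Suc n) y \<subseteq> \<Union>?\<F>"
          proof
            fix v assume "v \<in> cyl A (Suc n) y"
            then obtain C where C: "C \<in> cyl A (Suc (Suc n)) ` cyl A (Suc n) y" "v \<in> C"
              using cyl_children(2)[OF yX, of "Suc n"] by (metis UnionE le_add1 plus_1_eq_Suc)
            then have "v \<in> \<Union>(F C)" using F[OF C(1)] by auto
            then show "v \<in> \<Union>?\<F>" using C(1) by blast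
          qed
        qed
        then show False using y by simp
      qed
    qed
    then obtain f where f: "\<And>n. f n \<in> last_cyl A c" "\<And>n. \<not> good (cyl A (Suc n) (f n))"
      "\<And>n. f (Suc n) \<in> cyl A (Suc n) (f n)" by auto
    have fX: "f n \<in> Xneg A" for n using f(1) by (auto simp: last_cyl_def)
    have agree: "f m i = f n i" if "n \<le> m" "- int (Suc n) < i" for m n i
      using that(1)
    proof (induction m rule: dec_induct)
      case (step m)
      then show ?case using f(3)[of m] that(2) by (auto simp: cyl_def)
    qed simp
    \<comment> \<open>Coordinate i no longer changes from index -i of the sequence on, so it is read
      off there.\<close>
    define z where "z i = (if i > 0 then undefined else f (nat (- i)) i)" for i :: int
    have zf: "z i = f n i" if "- int (Suc n) < i" for n i
    proof (cases "i > 0")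
      case True
      then show ?thesis using fX[of n] by (auto simp: z_def Xneg_iff)
    next
      case False
      then show ?thesis using agree[of "nat (- i)" n i] that by (auto simp: z_def)
    qed
    have z: "z \<in> Xneg A"
      unfolding Xneg_iff
    proof (intro conjI allI impI)
      fix i :: int assume "i < 0"
      then show "A (z i) (z (i + 1)) = 1"
        using zf[of "nat (- i)" i] zf[of "nat (- i)" "i + 1"] fX[of "nat (- i)"] by (auto simp: Xneg_iff)
    qed (auto simp: z_def)
    have "z \<in> last_cyl A c"
      using z f(1)[of 0] by (auto simp: last_cyl_def z_def)
    then obtain U where U: "U \<in> \<U>" "z \<in> U" using \<U> by auto
    then obtain n where n: "cyl A n z \<subseteq> U" using \<U> unfolding openin_Tneg by metis
    have "z \<in> cyl A (Suc n) (f n)" using z zf[of n] by (auto simp: cyl_def)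
    then have "cyl A (Suc n) (f n) \<subseteq> U"
      using cyl_eq[of z A "Suc n" "f n"] cyl_antimono[of n "Suc n" A z] n by auto
    then have "good (cyl A (Suc n) (f n))"
      unfolding good_def using U by (intro exI[of _ "{U}"]) auto
    then show False using f(2) by simp
  qed
qed

lemma compact_cyl:
  assumes "y \<in> Xneg A" "1 \<le> n" shows "compactin (Tneg A) (cyl A n y)"
  using closed_compactin[OF compact_last_cyl cyl_sub_last[OF assms(2)] level_closedin[OF level_cyl]] .

lemma Union_last_cyl: "(\<Union>c. last_cyl A c) = Xneg A"
  by (auto simp: last_cyl_def)

lemma compactin_finite_cover:
  assumes "compactin (Tneg A) K"
  shows "\<exists>F. finite F \<and> K \<subseteq> (\<Union>c\<in>F. last_cyl A c)"
proof -
  have "K \<subseteq> Xneg A" using assms compactin_subset_topspace by fastforce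
  then have "K \<subseteq> \<Union>(range (last_cyl A))" using Union_last_cyl by auto
  then obtain \<F> where "finite \<F>" "\<F> \<subseteq> range (last_cyl A)" "K \<subseteq> \<Union>\<F>"
    using compactinD[OF assms, of "range (last_cyl A)"] openin_last_cyl by (metis imageE)
  then show ?thesis by (metis finite_subset_image)
qed

text \<open>Regularity is automatic. Open sets are countable unions of compact cylinders, which
  gives inner regularity; outer regularity is obtained on each piece \<open>last_cyl A c\<close> and
  summed with a geometric budget.\<close>

lemma radon_iff:
  "radon_measure (Tneg A) \<mu> \<longleftrightarrow> sets \<mu> = sets (Bneg A) \<and> (\<forall>c. emeasure \<mu> (last_cyl A c) < \<infinity>)"
  (is "_ \<longleftrightarrow> ?R")
proof
  assume "radon_measure (Tneg A) \<mu>"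
  then show ?R
    using compact_last_cyl unfolding radon_measure_def Bneg_def topspace_Tneg by blast
next
  assume R: ?R
  then have M: "sets \<mu> = sets (Bneg A)" and fin: "\<And>c. emeasure \<mu> (last_cyl A c) < \<infinity>" by auto
  have Lm: "last_cyl A c \<in> sets \<mu>" for c using M by simp
  show "radon_measure (Tneg A) \<mu>"
    unfolding radon_measure_def
  proof (intro conjI ballI allI impI)
    show "sets \<mu> = sets (sigma (topspace (Tneg A)) {U. openin (Tneg A) U})"
      using M by (simp add: Bneg_def)
  next
    fix K assume "compactin (Tneg A) K"
    then obtain F where F: "finite F" "K \<subseteq> (\<Union>c\<in>F. last_cyl A c)" using compactin_finite_cover by blast
    then have "emeasure \<mu> K \<le> emeasure \<mu> (\<Union>c\<in>F. last_cyl A c)"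
      by (intro emeasure_mono) (auto intro: Lm)
    also have "\<dots> \<le> (\<Sum>c\<in>F. emeasure \<mu> (last_cyl A c))"
      using F Lm by (intro emeasure_subadditive_finite) auto
    also have "\<dots> < \<infinity>" using fin F(1) by (simp add: less_top[symmetric])
    finally show "emeasure \<mu> K < \<infinity>" .
  next
    fix B assume B: "B \<in> sets \<mu>"
    define L where "L i = last_cyl A (from_nat_into UNIV i)" for i
    have L[measurable]: "L i \<in> sets \<mu>" for i using Lm by (simp add: L_def)
    have UL: "(\<Union>i. L i) = Xneg A"
      unfolding L_def using Union_last_cyl range_from_nat_into[OF _ cnt] by (metis UNIV_not_empty image_image)
    have BX: "B \<subseteq> Xneg A" using sets.sets_into_space[OF B] M sets_eq_imp_space_eq[OF M] by simp
    show "emeasure \<mu> B = (INF U\<in>{U. openin (Tneg A) U \<and> B \<subseteq> U}. emeasure \<mu> U)"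
    proof (rule antisym)
      show "emeasure \<mu> B \<le> (INF U\<in>{U. openin (Tneg A) U \<and> B \<subseteq> U}. emeasure \<mu> U)"
        using M by (intro INF_greatest emeasure_mono) (auto intro: open_sets_Bneg)
      show "(INF U\<in>{U. openin (Tneg A) U \<and> B \<subseteq> U}. emeasure \<mu> U) \<le> emeasure \<mu> B"
      proof (rule ennreal_le_epsilon)
        fix e :: real assume e: "0 < e"
        \<comment> \<open>\<mu> may be infinite, so the approximation is applied to its restriction
          to the piece \<open>L i\<close>.\<close>
        have "\<exists>U V. openin (Tneg A) U \<and> openin (Tneg A) V \<and> B \<subseteq> U \<and> Xneg A - B \<subseteq> V \<and>
          emeasure (density \<mu> (indicator (L i))) (U \<inter> V) < ennreal (e * (1 / 2) ^ Suc i)" for i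
        proof (rule emeasure_finite_approx[OF cnt])
          have "Xneg A \<in> sets \<mu>" using M level_sets[OF level_Xneg] by blast
          then have "emeasure (density \<mu> (indicator (L i))) (Xneg A) = emeasure \<mu> (L i)"
            using L[of i] by (subst emeasure_restricted) (auto simp: L_def last_cyl_def intro!: arg_cong[of _ _ "emeasure \<mu>"])
          then show "emeasure (density \<mu> (indicator (L i))) (Xneg A) \<noteq> \<infinity>"
            using fin by (simp add: L_def less_top[symmetric])
        qed (use M B e in auto)
        then obtain U V where UV: "\<And>i. openin (Tneg A) (U i)" "\<And>i. openin (Tneg A) (V i)" "\<And>i. B \<subseteq> U i"
          "\<And>i. Xneg A - B \<subseteq> V i"
          "\<And>i. emeasure (density \<mu> (indicator (L i))) (U i \<inter> V i) < ennreal (e * (1 / 2) ^ Suc i)"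
          by metis
        have [measurable]: "U i \<in> sets \<mu>" "V i \<in> sets \<mu>" for i
          using open_sets_Bneg[OF UV(1)] open_sets_Bneg[OF UV(2)] M by simp_all
        have UX: "U i \<subseteq> Xneg A" for i using UV(1) openin_Tneg by metis
        define W where "W = (\<Union>i. U i \<inter> L i)"
        have Wop: "openin (Tneg A) W"
          unfolding W_def L_def by (intro openin_Union) (auto intro!: openin_Int UV(1) openin_last_cyl)
        have [measurable]: "W \<in> sets \<mu>" using Wop open_sets_Bneg M by auto
        have BW: "B \<subseteq> W" 
        proof
          fix b assume b: "b \<in> B"
          then have "b \<in> (\<Union>i. L i)" using BX UL by auto
          then obtain i where "b \<in> L i" by auto
          then show "b \<in> W" using b UV(3)[of i] by (auto simp: W_def)
        qed
        have "W - B \<subseteq> (\<Union>i. L i \<inter> (U i \<inter> V i))" 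
        proof
          fix b assume b: "b \<in> W - B"
          then obtain i where i: "b \<in> U i" "b \<in> L i" by (auto simp: W_def)
          then show "b \<in> (\<Union>i. L i \<inter> (U i \<inter> V i))" using b UV(4)[of i] UX[of i] by auto
        qed
        then have "emeasure \<mu> (W - B) \<le> emeasure \<mu> (\<Union>i. L i \<inter> (U i \<inter> V i))"
          by (intro emeasure_mono) auto
        also have "\<dots> \<le> (\<Sum>i. emeasure \<mu> (L i \<inter> (U i \<inter> V i)))"
          by (intro emeasure_subadditive_countably) auto
        also have "\<dots> \<le> (\<Sum>i. ennreal (e * (1 / 2) ^ Suc i))"
          using UV(5) by (intro suminf_le less_imp_le) (auto simp: emeasure_restricted)
        also have "\<dots> = ennreal (e * 1)"
          using e by (intro suminf_ennreal_eq sums_mult power_half_series) auto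
        finally have "emeasure \<mu> (W - B) \<le> ennreal e" by simp
        moreover have "emeasure \<mu> W = emeasure \<mu> B + emeasure \<mu> (W - B)"
          using BW B by (subst plus_emeasure) (auto intro!: arg_cong[of _ _ "emeasure \<mu>"])
        ultimately have "emeasure \<mu> W \<le> emeasure \<mu> B + ennreal e" by (simp add: add_left_mono)
        then show "(INF U\<in>{U. openin (Tneg A) U \<and> B \<subseteq> U}. emeasure \<mu> U) \<le> emeasure \<mu> B + ennreal e"
          using Wop BW by (intro INF_lower2[of W]) auto
      qed
    qed
  next
    fix U assume U: "openin (Tneg A) U"
    show "emeasure \<mu> U = (SUP K\<in>{K. compactin (Tneg A) K \<and> K \<subseteq> U}. emeasure \<mu> K)"
    proof (rule antisym)
      show "(SUP K\<in>{K. compactin (Tneg A) K \<and> K \<subseteq> U}. emeasure \<mu> K) \<le> emeasure \<mu> U"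
        using M U by (intro SUP_least emeasure_mono) (auto intro: open_sets_Bneg)
      \<comment> \<open>The empty set makes the family nonempty, so that it is the range of an
        enumeration.\<close>
      define \<C> where "\<C> = insert {} {C \<in> {cyl A (Suc n) y | n y. y \<in> Xneg A}. C \<subseteq> U}"
      have "countable \<C>" unfolding \<C>_def
        by (intro countable_insert countable_subset[OF _ countable_cyl[OF cnt, of A]]) auto
      then have r: "range (from_nat_into \<C>) = \<C>"
        by (intro range_from_nat_into) (auto simp: \<C>_def)
      define K where "K n = (\<Union>i<n. from_nat_into \<C> i)" for n
      have C: "compactin (Tneg A) C" "C \<subseteq> U" if "C \<in> \<C>" for C
        using that compact_cyl by (auto simp: \<C>_def)
      have K: "compactin (Tneg A) (K n)" "K n \<subseteq> U" for n
        unfolding K_def using C r by (auto intro!: compactin_Union) blast+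
      have "(\<Union>n. K n) = \<Union>(range (from_nat_into \<C>))" unfolding K_def using lessI by blast
      also have "\<dots> = \<Union>\<C>" using r by simp
      also have "\<dots> = U" using open_eq_Union_cyl[OF U] by (simp add: \<C>_def)
      finally have "emeasure \<mu> U = emeasure \<mu> (\<Union>n. K n)" by simp
      also have "\<dots> = (SUP n. emeasure \<mu> (K n))"
      proof (rule SUP_emeasure_incseq[symmetric])
        show "range K \<subseteq> sets \<mu>" using compact_sets_Bneg[OF K(1)] M by auto
        show "incseq K" unfolding K_def incseq_def by (intro allI impI UN_mono) auto
      qed
      also have "\<dots> \<le> (SUP K\<in>{K. compactin (Tneg A) K \<and> K \<subseteq> U}. emeasure \<mu> K)"
        using K by (intro SUP_mono) auto
      finally show "emeasure \<mu> U \<le> (SUP K\<in>{K. compactin (Tneg A) K \<and> K \<subseteq> U}. emeasure \<mu> K)" .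
    qed
  qed
qed

end

section \<open>One-letter extensions and conformal measures\<close>

definition cons :: "'s \<Rightarrow> (int \<Rightarrow> 's) \<Rightarrow> (int \<Rightarrow> 's)" where
  "cons c x = (\<lambda>i. if i < 0 then undefined else if i = 0 then c else x (i - 1))"

definition snoc :: "(int \<Rightarrow> 's) \<Rightarrow> 's \<Rightarrow> (int \<Rightarrow> 's)" where
  "snoc y c = (\<lambda>i. if i > 0 then undefined else if i = 0 then c else y (i + 1))"

definition butlast_seq :: "(int \<Rightarrow> 's) \<Rightarrow> (int \<Rightarrow> 's)" where
  "butlast_seq y = right_shift {..0} y"

lemma cons_0 [simp]: "cons c x 0 = c" by (simp add: cons_def)
lemma snoc_0 [simp]: "snoc y c 0 = c" by (simp add: snoc_def)
lemma butlast_seq_0 [simp]: "butlast_seq y 0 = y (- 1)"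
  by (simp add: butlast_seq_def right_shift_def)

lemma cons_Xpos: 
  assumes "x \<in> Xpos A" "A c (x 0) = 1"
  shows "cons c x \<in> Xpos A"
  unfolding Xpos_iff
proof (intro conjI allI impI)
  fix i :: int assume "0 \<le> i"
  show "A (cons c x i) (cons c x (i + 1)) = 1"
  proof (cases "i = 0")
    case False
    then have "A (x (i - 1)) (x (i - 1 + 1)) = 1"
      using assms(1) \<open>0 \<le> i\<close> unfolding Xpos_iff by (metis diff_add_cancel int_one_le_iff_zero_less le_less zle_diff1_eq zless_imp_add1_zle diff_ge_0_iff_ge)
    then show ?thesis using False \<open>0 \<le> i\<close> by (simp add: cons_def)
  qed (use assms in \<open>simp add: cons_def\<close>)
qed (simp add: cons_def)

lemma snoc_Xneg:
  assumes "y \<in> Xneg A" "A (y 0) c = 1"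
  shows "snoc y c \<in> Xneg A"
  unfolding Xneg_iff
proof (intro conjI allI impI)
  fix i :: int assume i: "i < 0"
  show "A (snoc y c i) (snoc y c (i + 1)) = 1"
  proof (cases "i = - 1")
    case False
    then have "i + 1 < 0" using i by simp
    then have "A (y (i + 1)) (y (i + 1 + 1)) = 1"
      using assms(1) unfolding Xneg_iff by metis
    then show ?thesis using False i by (simp add: snoc_def)
  qed (use assms in \<open>simp add: snoc_def\<close>)
qed (simp add: snoc_def)

lemma butlast_seq_snoc [simp]: "y \<in> Xneg A \<Longrightarrow> butlast_seq (snoc y c) = y"
  by (auto simp: butlast_seq_def right_shift_def snoc_def Xneg_iff fun_eq_iff)

lemma snoc_butlast_seq: "y \<in> Xneg A \<Longrightarrow> snoc (butlast_seq y) (y 0) = y"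
  by (auto simp: butlast_seq_def right_shift_def snoc_def Xneg_iff fun_eq_iff)

lemma butlast_seq_Xneg:
  assumes "y \<in> Xneg A" shows "butlast_seq y \<in> Xneg A" "A (butlast_seq y 0) (y 0) = 1"
proof -
  show "butlast_seq y \<in> Xneg A"
    unfolding Xneg_iff
  proof (intro conjI allI impI)
    fix i :: int assume i: "i < 0"
    then have "A (y (i - 1)) (y (i - 1 + 1)) = 1"
      using assms unfolding Xneg_iff by (metis less_trans zle_diff1_eq order_refl)
    then show "A (butlast_seq y i) (butlast_seq y (i + 1)) = 1"
      using i by (simp add: butlast_seq_def right_shift_def)
  qed (simp add: butlast_seq_def right_shift_def)
  have "A (y (- 1)) (y (- 1 + 1)) = 1" using assms unfolding Xneg_iff by (metis neg_less_0_iff_less zero_less_one)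
  then show "A (butlast_seq y 0) (y 0) = 1" by simp
qed

lemma left_shift_cons: "x \<in> Xpos A \<Longrightarrow> left_shift {0..} (cons c x) = x"
  by (auto simp: left_shift_def cons_def Xpos_iff fun_eq_iff)

lemma left_shift_fiber:
  assumes x: "x \<in> Xpos A"
  shows "{x' \<in> Xpos A. left_shift {0..} x' = x} = (\<lambda>c. cons c x) ` {c. A c (x 0) = 1}"
proof safe
  fix x' assume x': "x' \<in> Xpos A" "x = left_shift {0..} x'"
  have "x' = cons (x' 0) (left_shift {0..} x')"
    using x'(1) by (auto simp: left_shift_def cons_def Xpos_iff fun_eq_iff)
  moreover have "A (x' 0) (left_shift {0..} x' 0) = 1"
  proof -
    have "A (x' 0) (x' (0 + 1)) = 1" using x'(1) unfolding Xpos_iff by blast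
    then show ?thesis by (simp add: left_shift_def)
  qed
  ultimately show "x' \<in> (\<lambda>c. cons c (left_shift {0..} x')) ` {c. A c (left_shift {0..} x' 0) = 1}"
    by blast
next
  fix c assume "A c (x 0) = 1"
  then show "cons c x \<in> Xpos A" "left_shift {0..} (cons c x) = x"
    using x by (auto intro: cons_Xpos simp: left_shift_cons)
qed

lemma right_shift_fiber:
  assumes y: "y \<in> Xneg A"
  shows "{y' \<in> Xneg A. right_shift {..0} y' = y} = (\<lambda>c. snoc y c) ` {c. A (y 0) c = 1}"
proof safe
  fix y' assume y': "y' \<in> Xneg A" "y = right_shift {..0} y'"
  then show "y' \<in> (\<lambda>c. snoc (right_shift {..0} y') c) ` {c. A (right_shift {..0} y' 0) c = 1}"
    using snoc_butlast_seq[OF y'(1)] butlast_seq_Xneg(2)[OF y'(1)]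
    by (intro image_eqI[of _ _ "y' 0"]) (auto simp: butlast_seq_def)
next
  fix c assume "A (y 0) c = 1"
  then show "snoc y c \<in> Xneg A" "right_shift {..0} (snoc y c) = y"
    using y butlast_seq_snoc[OF y] by (auto intro: snoc_Xneg simp: butlast_seq_def)
qed

lemma ruelle_pos_eq:
  assumes "x \<in> Xpos A" "finite {c. A c (x 0) = 1}"
  shows "ruelle_pos A \<phi> f x = (\<Sum>c | A c (x 0) = 1. exp (\<phi> (cons c x)) * f (cons c x))"
proof -
  have "inj_on (\<lambda>c. cons c x) {c. A c (x 0) = 1}" by (rule inj_onI) (metis cons_0)
  then show ?thesis
    using assms by (simp add: ruelle_pos_def left_shift_fiber sum.reindex)
qed

lemma ruelle_neg_eq:
  assumes "y \<in> Xneg A" "finite {c. A (y 0) c = 1}"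
  shows "ruelle_neg A \<phi> f y = (\<Sum>c | A (y 0) c = 1. exp (\<phi> (snoc y c)) * f (snoc y c))"
proof -
  have "inj_on (\<lambda>c. snoc y c) {c. A (y 0) c = 1}" by (rule inj_onI) (metis snoc_0)
  then show ?thesis
    using assms by (simp add: ruelle_neg_def right_shift_fiber sum.reindex)
qed

lemma concat_at_Xtwo:
  assumes "y \<in> Xneg A" "x \<in> Xpos A" "A (y 0) (x 0) = 1"
  shows "concat_at y x \<in> Xtwo A"
  unfolding Xtwo_iff
proof
  fix i :: int
  consider "i < - 1" | "i = - 1" | "0 \<le> i" by linarith
  then show "A (concat_at y x i) (concat_at y x (i + 1)) = 1"
  proof cases
    case 1
    then have "i + 1 < 0" by simp
    then have "A (y (i + 1)) (y (i + 1 + 1)) = 1" using assms(1) unfolding Xneg_iff by metis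
    then show ?thesis using 1 by (simp add: concat_at_def)
  next
    case 3
    then have "A (x i) (x (i + 1)) = 1" using assms(2) unfolding Xpos_iff by metis
    then show ?thesis using 3 by (simp add: concat_at_def)
  qed (use assms in \<open>simp add: concat_at_def\<close>)
qed

text \<open>A total version of \<open>snoc\<close>; off \<open>before A c\<close> it is the identity only to stay inside the space.\<close>

definition app :: "('s \<Rightarrow> 's \<Rightarrow> nat) \<Rightarrow> 's \<Rightarrow> (int \<Rightarrow> 's) \<Rightarrow> (int \<Rightarrow> 's)" where
  "app A c y = (if A (y 0) c = 1 then snoc y c else y)"

definition before :: "('s \<Rightarrow> 's \<Rightarrow> nat) \<Rightarrow> 's \<Rightarrow> (int \<Rightarrow> 's) set" where
  "before A c = {y \<in> Xneg A. A (y 0) c = 1}"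

lemma app_Xneg: "y \<in> Xneg A \<Longrightarrow> app A c y \<in> Xneg A"
  by (auto simp: app_def intro: snoc_Xneg)

lemma app_before: "y \<in> before A c \<Longrightarrow> app A c y = snoc y c"
  by (simp add: app_def before_def)

lemma level_before: "level A (Suc 0) (before A c)"
  by (auto simp: level_def before_def cyl_def)

lemma before_sets [measurable, simp]: "before A c \<in> sets (Bneg A)"
  by (rule level_sets[OF level_before])

text \<open>The word is nonempty because its last letter decides which branch of \<open>app\<close>
  applies.\<close>

lemma app_cyl:
  assumes "v \<in> cyl A (Suc n) y" shows "app A c v \<in> cyl A (Suc n) (app A c y)"
proof -
  have v: "v \<in> Xneg A" "\<And>i. - int (Suc n) < i \<Longrightarrow> v i = y i" using assms by (auto simp: cyl_def)
  have "app A c v i = app A c y i" if "- int (Suc n) < i" for i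
    using v(2)[of 0] v(2)[of i] v(2)[of "i + 1"] that by (simp add: app_def snoc_def)
  then show ?thesis using app_Xneg[OF v(1)] by (simp add: cyl_def)
qed

lemma app_measurable [measurable, simp]: "app A c \<in> measurable (Bneg A) (Bneg A)"
proof (rule measurable_sigma_sets[OF sets_Bneg])
  show "{U. openin (Tneg A) U} \<subseteq> Pow (Xneg A)" by (auto simp: openin_Tneg)
  show "app A c \<in> space (Bneg A) \<rightarrow> Xneg A" by (simp add: app_Xneg)
  fix U assume "U \<in> {U. openin (Tneg A) U}"
  then have U: "openin (Tneg A) U" by simp
  have "openin (Tneg A) (app A c -` U \<inter> Xneg A)"
    unfolding openin_Tneg
  proof safe
    fix y assume y: "app A c y \<in> U" "y \<in> Xneg A"
    then obtain n where n: "cyl A n (app A c y) \<subseteq> U" using U unfolding openin_Tneg by metis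
    have "cyl A (Suc n) y \<subseteq> app A c -` U \<inter> Xneg A"
    proof
      fix v assume v: "v \<in> cyl A (Suc n) y"
      then have "app A c v \<in> cyl A n (app A c y)"
        using app_cyl[OF v] cyl_antimono[of n "Suc n" A] by fastforce
      then show "v \<in> app A c -` U \<inter> Xneg A" using n v cyl_subset[of A "Suc n" y] by auto
    qed
    then show "\<exists>n. cyl A n y \<subseteq> app A c -` U \<inter> Xneg A" by blast
  qed
  then show "app A c -` U \<inter> space (Bneg A) \<in> sets (Bneg A)" by (simp add: open_sets_Bneg)
qed

text \<open>Continuity on X^-, with the cylinders around y as a basis of neighbourhoods.\<close>

definition loc_cont :: "('s \<Rightarrow> 's \<Rightarrow> nat) \<Rightarrow> ((int \<Rightarrow> 's) \<Rightarrow> real) \<Rightarrow> bool" where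
  "loc_cont A g \<longleftrightarrow> (\<forall>y\<in>Xneg A. \<forall>\<epsilon>>0. \<exists>n. \<forall>v\<in>cyl A n y. \<bar>g v - g y\<bar> < \<epsilon>)"

lemma loc_cont_measurable: "loc_cont A g \<Longrightarrow> g \<in> borel_measurable (Bneg A)"
  by (rule borel_measurable_Bneg) (auto simp: loc_cont_def)

lemma summable_variations_loc_cont:
  assumes "summable_variations (Xneg A) \<phi>"
  shows "loc_cont A \<phi>"
  unfolding loc_cont_def
proof (intro ballI allI impI)
  fix y and \<epsilon> :: real assume y: "y \<in> Xneg A" and "\<epsilon> > 0"
  obtain m where m: "\<And>u v. u \<in> Xneg A \<Longrightarrow> v \<in> Xneg A \<Longrightarrow> (\<forall>i. \<bar>i\<bar> \<le> int m - 1 \<longrightarrow> u i = v i) \<Longrightarrow>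
      \<bar>\<phi> u - \<phi> v\<bar> < \<epsilon>"
    using summable_variations_small[OF assms \<open>\<epsilon> > 0\<close>] by metis
  have "\<bar>\<phi> v - \<phi> y\<bar> < \<epsilon>" if "v \<in> cyl A m y" for v
    using that y by (intro m) (auto simp: cyl_def)
  then show "\<exists>n. \<forall>v\<in>cyl A n y. \<bar>\<phi> v - \<phi> y\<bar> < \<epsilon>" by blast
qed

context markov_shift
begin

text \<open>Compactness of \<open>last_cyl A c\<close>, covered by the open sets where g <
  k.\<close>

lemma loc_cont_bounded:
  assumes "loc_cont A g"
  shows "\<exists>M\<ge>0. \<forall>y\<in>last_cyl A c. g y \<le> M"
proof -
  define U where "U k = {y \<in> Xneg A. g y < real k}" for k :: nat
  have op: "openin (Tneg A) (U k)" for k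
    unfolding openin_Tneg
  proof safe
    fix y assume y: "y \<in> U k"
    then have "y \<in> Xneg A" "real k - g y > 0" by (auto simp: U_def)
    then obtain n where n: "\<forall>v\<in>cyl A n y. \<bar>g v - g y\<bar> < real k - g y"
      using assms unfolding loc_cont_def by metis
    have "cyl A n y \<subseteq> U k"
    proof
      fix v assume v: "v \<in> cyl A n y"
      then have "\<bar>g v - g y\<bar> < real k - g y" using n by blast
      then have "g v < real k" by linarith
      then show "v \<in> U k" using v cyl_subset[of A n y] by (auto simp: U_def)
    qed
    then show "\<exists>n. cyl A n y \<subseteq> U k" by blast
  qed (simp add: U_def)
  have "last_cyl A c \<subseteq> \<Union>(range U)"
  proof
    fix y assume y: "y \<in> last_cyl A c"
    obtain k :: nat where "g y < real k" using reals_Archimedean2 by blast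
    then show "y \<in> \<Union>(range U)" using y by (auto simp: U_def last_cyl_def)
  qed
  then obtain \<F> where F: "finite \<F>" "\<F> \<subseteq> range U" "last_cyl A c \<subseteq> \<Union>\<F>"
    using compactinD[OF compact_last_cyl, of "range U" c] op by (metis imageE)
  then obtain I where I: "finite I" "\<F> = U ` I" by (metis finite_subset_image)
  have "g y \<le> real (Max (insert 0 I))" if "y \<in> last_cyl A c" for y
  proof -
    have "y \<in> \<Union>(U ` I)" using that F(3) I(2) by auto
    then obtain k where "k \<in> I" "y \<in> U k" by blast
    then have "g y < real k" "k \<le> Max (insert 0 I)" using I(1) by (auto simp: U_def)
    then show ?thesis by linarith
  qed
  then show ?thesis by (intro exI[of _ "real (Max (insert 0 I))"]) auto
qed

end

section \<open>Cohomologous potentials, the functions \<chi>_x and conformality\<close>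

locale ruelle_pair = markov_shift A for A :: "'s \<Rightarrow> 's \<Rightarrow> nat" +
  fixes \<phi> \<phi>m \<psi> :: "(int \<Rightarrow> 's) \<Rightarrow> real" and lam :: real
  assumes trans: "transitive_shift A"
    and phim: "loc_cont A \<phi>m"
    and psi: "uniformly_continuous_map (shift_metric A UNIV) euclidean_metric \<psi>"
    and coh: "cohomologous_via A \<phi> \<phi>m \<psi>"
    and lam: "lam > 0"
begin

abbreviation ch :: "(int \<Rightarrow> 's) \<Rightarrow> (int \<Rightarrow> 's) \<Rightarrow> real" where "ch \<equiv> chi A \<psi>"

lemma chi_nonneg [simp]: "0 \<le> ch x y"
  by (simp add: chi_def)

lemma chi_pos: "A (y 0) (x 0) = 1 \<Longrightarrow> 0 < ch x y"
  by (simp add: chi_def)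

text \<open>The cohomology equation at the point z = u.(c x): the shift carries c across the origin,
  so that z^+ = c x, z^- = u c and Tz = (u c).x.\<close>

lemma chi_cons:
  assumes x: "x \<in> Xpos A" "A c (x 0) = 1" and u: "u \<in> Xneg A" "A (u 0) c = 1"
  shows "exp (\<phi> (cons c x)) * ch (cons c x) u = exp (\<phi>m (snoc u c)) * ch x (snoc u c)"
proof -
  let ?z = "concat_at u (cons c x)"
  have z: "?z \<in> Xtwo A" using assms by (intro concat_at_Xtwo cons_Xpos) auto
  have "pos_part ?z = cons c x"
    by (auto simp: pos_part_def concat_at_def cons_def fun_eq_iff)
  moreover have "neg_part ?z = snoc u c"
    by (auto simp: neg_part_def concat_at_def cons_def snoc_def fun_eq_iff)
  moreover have "left_shift UNIV ?z = concat_at (snoc u c) x"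
    by (auto simp: left_shift_def concat_at_def cons_def snoc_def fun_eq_iff)
  ultimately have "\<phi> (cons c x) - \<phi>m (snoc u c) = \<psi> ?z - \<psi> (concat_at (snoc u c) x)"
    using coh z unfolding cohomologous_via_def by metis
  then have "\<phi> (cons c x) - \<psi> ?z = \<phi>m (snoc u c) - \<psi> (concat_at (snoc u c) x)" by simp
  then show ?thesis using assms by (simp add: chi_def flip: exp_add)
qed

text \<open>One window serves both arguments. Admissibility is assumed for the first pair alone: as
  N \<ge> 1, the second pair has the same letters at 0.\<close>

lemma psi_concat_close:
  assumes "\<epsilon> > 0"
  shows "\<exists>N\<ge>1. \<forall>x\<in>Xpos A. \<forall>x'\<in>Xpos A. \<forall>y\<in>Xneg A. \<forall>y'\<in>Xneg A.
    (\<forall>i<int N. x i = x' i) \<longrightarrow> (\<forall>i>- int N. y i = y' i) \<longrightarrow> A (y 0) (x 0) = 1 \<longrightarrow>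
    \<bar>\<psi> (concat_at y x) - \<psi> (concat_at y' x')\<bar> < \<epsilon>"
proof -
  obtain n :: nat where n: "\<And>u v. u \<in> Xtwo A \<Longrightarrow> v \<in> Xtwo A \<Longrightarrow>
      (\<forall>i. \<bar>i\<bar> \<le> int n \<longrightarrow> u i = v i) \<Longrightarrow> \<bar>\<psi> u - \<psi> v\<bar> < \<epsilon>"
    using psi assms unfolding uniformly_continuous_shift_iff by metis
  show ?thesis
  proof (intro exI[of _ "Suc n"] conjI ballI impI)
    fix x x' y y' assume *: "x \<in> Xpos A" "x' \<in> Xpos A" "y \<in> Xneg A" "y' \<in> Xneg A"
      "\<forall>i<int (Suc n). x i = x' i" "\<forall>i>- int (Suc n). y i = y' i" "A (y 0) (x 0) = 1"
    then have "y 0 = y' 0" "x 0 = x' 0" by auto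
    show "\<bar>\<psi> (concat_at y x) - \<psi> (concat_at y' x')\<bar> < \<epsilon>"
    proof (rule n)
      show "concat_at y x \<in> Xtwo A" "concat_at y' x' \<in> Xtwo A"
        using * \<open>y 0 = y' 0\<close> \<open>x 0 = x' 0\<close> by (auto intro!: concat_at_Xtwo)
      show "\<forall>i. \<bar>i\<bar> \<le> int n \<longrightarrow> concat_at y x i = concat_at y' x' i"
        using *(5,6) by (auto simp: concat_at_def)
    qed
  qed simp
qed

text \<open>The multiplicative form of uniform continuity: it survives integration against any
  measure and also holds where both values vanish.\<close>

lemma chi_close:
  assumes "\<epsilon> > 0"
  shows "\<exists>N\<ge>1. \<forall>x\<in>Xpos A. \<forall>x'\<in>Xpos A. \<forall>y\<in>Xneg A. \<forall>y'\<in>Xneg A.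
    (\<forall>i<int N. x i = x' i) \<longrightarrow> (\<forall>i>- int N. y i = y' i) \<longrightarrow> ch x y \<le> exp \<epsilon> * ch x' y'"
proof -
  obtain N where N: "N \<ge> 1" "\<And>x x' y y'. x \<in> Xpos A \<Longrightarrow> x' \<in> Xpos A \<Longrightarrow> y \<in> Xneg A \<Longrightarrow> y' \<in> Xneg A \<Longrightarrow>
    (\<forall>i<int N. x i = x' i) \<Longrightarrow> (\<forall>i>- int N. y i = y' i) \<Longrightarrow> A (y 0) (x 0) = 1 \<Longrightarrow>
    \<bar>\<psi> (concat_at y x) - \<psi> (concat_at y' x')\<bar> < \<epsilon>"
    using psi_concat_close[OF assms] by metis
  show ?thesis
  proof (intro exI[of _ N] conjI ballI impI)
    fix x x' y y' assume *: "x \<in> Xpos A" "x' \<in> Xpos A" "y \<in> Xneg A" "y' \<in> Xneg A"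
      "\<forall>i<int N. x i = x' i" "\<forall>i>- int N. y i = y' i"
    then have eq: "y 0 = y' 0" "x 0 = x' 0" using N(1) by auto
    show "ch x y \<le> exp \<epsilon> * ch x' y'"
    proof (cases "A (y 0) (x 0) = 1")
      case True
      have "- \<psi> (concat_at y x) \<le> \<epsilon> - \<psi> (concat_at y' x')" using N(2)[OF * True] by linarith
      then have "exp (- \<psi> (concat_at y x)) \<le> exp (\<epsilon> - \<psi> (concat_at y' x'))" by simp
      also have "\<dots> = exp \<epsilon> * exp (- \<psi> (concat_at y' x'))" by (simp flip: exp_add)
      finally show ?thesis using True eq by (simp add: chi_def)
    qed (simp add: chi_def)
  qed (use N in simp)
qed

lemma chi_loc_cont:
  assumes x: "x \<in> Xpos A"
  shows "loc_cont A (ch x)"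
  unfolding loc_cont_def
proof (intro ballI allI impI)
  fix y and \<epsilon> :: real assume y: "y \<in> Xneg A" and "\<epsilon> > 0"
  show "\<exists>n. \<forall>v\<in>cyl A n y. \<bar>ch x v - ch x y\<bar> < \<epsilon>"
  proof (cases "A (y 0) (x 0) = 1")
    case False
    then have "\<bar>ch x v - ch x y\<bar> < \<epsilon>" if "v \<in> cyl A (Suc 0) y" for v
      using that \<open>\<epsilon> > 0\<close> by (simp add: chi_def cyl_def)
    then show ?thesis by blast
  next
    case True
    have "isCont (\<lambda>t. exp (- t) :: real) (\<psi> (concat_at y x))" by (intro continuous_intros)
    then obtain \<delta> where \<delta>: "\<delta> > 0" "\<And>t. \<bar>t - \<psi> (concat_at y x)\<bar> < \<delta> \<Longrightarrow>
        \<bar>exp (- t) - exp (- \<psi> (concat_at y x))\<bar> < \<epsilon>"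
      using \<open>\<epsilon> > 0\<close> unfolding continuous_at_eps_delta dist_real_def by metis
    obtain N where N: "N \<ge> 1" "\<And>x x' y y'. x \<in> Xpos A \<Longrightarrow> x' \<in> Xpos A \<Longrightarrow> y \<in> Xneg A \<Longrightarrow> y' \<in> Xneg A \<Longrightarrow>
      (\<forall>i<int N. x i = x' i) \<Longrightarrow> (\<forall>i>- int N. y i = y' i) \<Longrightarrow> A (y 0) (x 0) = 1 \<Longrightarrow>
      \<bar>\<psi> (concat_at y x) - \<psi> (concat_at y' x')\<bar> < \<delta>"
      using psi_concat_close[OF \<delta>(1)] by metis
    have "\<bar>ch x v - ch x y\<bar> < \<epsilon>" if v: "v \<in> cyl A N y" for v
    proof -
      have "v 0 = y 0" "v \<in> Xneg A" using v N(1) by (auto simp: cyl_def)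
      moreover have "\<bar>\<psi> (concat_at v x) - \<psi> (concat_at y x)\<bar> < \<delta>"
        using N(2)[of x x v y] x y v True \<open>v 0 = y 0\<close> by (simp add: cyl_def)
      ultimately show ?thesis using \<delta>(2) True by (simp add: chi_def)
    qed
    then show ?thesis by blast
  qed
qed

lemma chi_measurable [measurable]: "x \<in> Xpos A \<Longrightarrow> ch x \<in> borel_measurable (Bneg A)"
  by (intro loc_cont_measurable chi_loc_cont)

lemma phim_measurable [measurable]: "\<phi>m \<in> borel_measurable (Bneg A)"
  by (intro loc_cont_measurable phim)

text \<open>Conformality, tested on functions of points ending in \<open>c\<close>: there the sum in the Ruelle operator has only one term.\<close>

definition transfers :: "(int \<Rightarrow> 's) measure \<Rightarrow> bool" where
  "transfers \<mu> \<longleftrightarrow> (\<forall>c. \<forall>g\<in>borel_measurable (Bneg A).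
     (\<integral>\<^sup>+u. indicator (before A c) u * ennreal (exp (\<phi>m (app A c u))) * g (app A c u) \<partial>\<mu>) =
     ennreal lam * (\<integral>\<^sup>+y. indicator (last_cyl A c) y * g y \<partial>\<mu>))"

lemma compact_last_cyl_Int_cyl: "compactin (Tneg A) (last_cyl A c \<inter> cyl A n y)"
  by (intro closed_compactin[OF compact_last_cyl] closedin_Int
      level_closedin[OF level_cyl] level_closedin[OF level_last_cyl]) auto

text \<open>Among the preimages of u only u c can lie in K, so the Ruelle sum has a single term, or
  none if u c is not admissible.\<close>

lemma ruelle_neg_indicator:
  assumes u: "u \<in> Xneg A" and K: "K \<subseteq> last_cyl A c"
  shows "ennreal (ruelle_neg A \<phi>m (indicator K) u) =
    indicator (before A c) u * ennreal (exp (\<phi>m (app A c u))) * indicator K (app A c u)"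
proof -
  have z: "indicator K (snoc u b) = (0::real)" if "b \<noteq> c" for b
    using that K by (auto simp: indicator_def last_cyl_def)
  have "ruelle_neg A \<phi>m (indicator K) u =
      (\<Sum>b | A (u 0) b = 1. exp (\<phi>m (snoc u b)) * indicator K (snoc u b))"
    by (rule ruelle_neg_eq[OF u fin_succ])
  also have "\<dots> = (\<Sum>b | A (u 0) b = 1. if b = c then exp (\<phi>m (snoc u c)) * indicator K (snoc u c) else 0)"
    by (rule sum.cong) (simp_all add: z)
  also have "\<dots> = (if A (u 0) c = 1 then exp (\<phi>m (snoc u c)) * indicator K (snoc u c) else 0)"
    by (subst sum.delta[OF fin_succ]) simp
  finally show ?thesis
    using u by (simp add: before_def app_def ennreal_mult' indicator_def)
qed

text \<open>Cylinders cut down to \<open>last_cyl A c\<close> are compact, so conformality makes two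
  measures agree on a generator. One of them is known to be finite, and equality extends to all
  measurable g.\<close>

lemma conformal_transfers:
  assumes "conformal_measure A \<phi>m lam \<mu>"
  shows "transfers \<mu>"
  unfolding transfers_def
proof (intro allI ballI)
  fix c and g :: "_ \<Rightarrow> ennreal" assume g [measurable]: "g \<in> borel_measurable (Bneg A)"
  from assms have M [measurable_cong, simp]: "sets \<mu> = sets (Bneg A)" and fin: "\<And>c. emeasure \<mu> (last_cyl A c) < \<infinity>"
    and conf: "\<And>K. compactin (Tneg A) K \<Longrightarrow>
        (\<integral>\<^sup>+y. ennreal (ruelle_neg A \<phi>m (indicator K) y) \<partial>\<mu>) = ennreal lam * emeasure \<mu> K"
    unfolding conformal_measure_def radon_iff by blast+
  have sp: "space \<mu> = Xneg A" using sets_eq_imp_space_eq[OF M] by simp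
  define P where "P = distr (density \<mu> (\<lambda>u. indicator (before A c) u * ennreal (exp (\<phi>m (app A c u))))) (Bneg A) (app A c)"
  define Q where "Q = density \<mu> (\<lambda>y. ennreal lam * indicator (last_cyl A c) y)"
  have "Q = P"
  proof (rule measure_eqI_cyl[OF cnt])
    show "sets Q = sets (Bneg A)" "sets P = sets (Bneg A)" by (simp_all add: P_def Q_def)
    have Q: "emeasure Q B = ennreal lam * emeasure \<mu> (last_cyl A c \<inter> B)" if "B \<in> sets (Bneg A)" for B
      using that by (simp add: Q_def emeasure_density mult.assoc nn_integral_cmult indicator_inter_arith[symmetric])
    have "Xneg A \<in> sets (Bneg A)" by (rule level_sets[OF level_Xneg])
    moreover have "last_cyl A c \<inter> Xneg A = last_cyl A c" by (auto simp: last_cyl_def)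
    ultimately show "emeasure Q (Xneg A) \<noteq> \<infinity>"
      using fin[of c] by (simp add: Q ennreal_mult_eq_top_iff less_top[symmetric])
    fix n y assume "y \<in> Xneg A"
    let ?K = "last_cyl A c \<inter> cyl A n y"
    have "emeasure P (cyl A n y) = (\<integral>\<^sup>+u. indicator (before A c) u * ennreal (exp (\<phi>m (app A c u))) * indicator (cyl A n y) (app A c u) \<partial>\<mu>)"
    proof -
      have *: "app A c -` cyl A n y \<inter> Xneg A \<in> sets (Bneg A)"
        using measurable_sets[OF app_measurable[of A c] cyl_sets[of A n y]] by simp
      have "emeasure P (cyl A n y) =
          emeasure (density \<mu> (\<lambda>u. indicator (before A c) u * ennreal (exp (\<phi>m (app A c u))))) (app A c -` cyl A n y \<inter> Xneg A)"
        unfolding P_def by (subst emeasure_distr) (simp_all add: sp)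
      also have "\<dots> = (\<integral>\<^sup>+u. indicator (before A c) u * ennreal (exp (\<phi>m (app A c u))) * indicator (app A c -` cyl A n y \<inter> Xneg A) u \<partial>\<mu>)"
        using * by (subst emeasure_density) simp_all
      also have "\<dots> = (\<integral>\<^sup>+u. indicator (before A c) u * ennreal (exp (\<phi>m (app A c u))) * indicator (cyl A n y) (app A c u) \<partial>\<mu>)"
        by (intro nn_integral_cong) (simp add: indicator_def sp)
      finally show ?thesis .
    qed
    also have "\<dots> = (\<integral>\<^sup>+y. ennreal (ruelle_neg A \<phi>m (indicator ?K) y) \<partial>\<mu>)"
      by (intro nn_integral_cong, subst ruelle_neg_indicator[of _ _ c])
        (auto simp: sp indicator_def before_def app_def last_cyl_def snoc_Xneg)
    also have "\<dots> = ennreal lam * emeasure \<mu> ?K" by (intro conf compact_last_cyl_Int_cyl)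
    finally show "emeasure Q (cyl A n y) = emeasure P (cyl A n y)" by (simp add: Q)
  qed
  then have "(\<integral>\<^sup>+y. g y \<partial>P) = (\<integral>\<^sup>+y. g y \<partial>Q)" by simp
  then show "(\<integral>\<^sup>+u. indicator (before A c) u * ennreal (exp (\<phi>m (app A c u))) * g (app A c u) \<partial>\<mu>) =
     ennreal lam * (\<integral>\<^sup>+y. indicator (last_cyl A c) y * g y \<partial>\<mu>)"
    by (simp add: P_def Q_def nn_integral_distr nn_integral_density mult.assoc nn_integral_cmult)
qed

text \<open>For the converse, K is cut into its parts with last letter c. The sum over c is an
  integral for counting measure, and Tonelli recombines the one-letter identities.\<close>

lemma conformal_iff:
  "conformal_measure A \<phi>m lam \<mu> \<longleftrightarrow>
     sets \<mu> = sets (Bneg A) \<and> (\<forall>c. emeasure \<mu> (last_cyl A c) < \<infinity>) \<and> transfers \<mu>"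
  (is "_ \<longleftrightarrow> ?R")
proof
  assume "conformal_measure A \<phi>m lam \<mu>"
  then show ?R using conformal_transfers unfolding conformal_measure_def radon_iff by blast
next
  assume R: ?R
  then have M [measurable_cong, simp]: "sets \<mu> = sets (Bneg A)" by simp
  have sp: "space \<mu> = Xneg A" using sets_eq_imp_space_eq[OF M] by simp
  have "(\<integral>\<^sup>+y. ennreal (ruelle_neg A \<phi>m (indicator K) y) \<partial>\<mu>) = ennreal lam * emeasure \<mu> K"
    if "compactin (Tneg A) K" for K
  proof -
    have K [measurable, simp]: "K \<in> sets (Bneg A)" using compact_sets_Bneg[OF that] .
    then have KX: "K \<subseteq> Xneg A" using sets.sets_into_space[OF K] by simp
    have "ennreal (ruelle_neg A \<phi>m (indicator K) y) =
      (\<integral>\<^sup>+c. indicator (before A c) y * ennreal (exp (\<phi>m (app A c y))) * indicator K (app A c y) \<partial>count_space UNIV)"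
      if y: "y \<in> Xneg A" for y
    proof -
      have "(\<integral>\<^sup>+c. indicator (before A c) y * ennreal (exp (\<phi>m (app A c y))) * indicator K (app A c y) \<partial>count_space UNIV)
        = (\<Sum>c | A (y 0) c = 1. indicator (before A c) y * ennreal (exp (\<phi>m (app A c y))) * indicator K (app A c y))"
        using fin_succ by (intro nn_integral_count_space') (auto simp: before_def)
      also have "\<dots> = (\<Sum>c | A (y 0) c = 1. ennreal (exp (\<phi>m (snoc y c)) * indicator K (snoc y c)))"
        using y by (intro sum.cong) (auto simp: before_def app_def indicator_def)
      also have "\<dots> = ennreal (ruelle_neg A \<phi>m (indicator K) y)"
        using y fin_succ by (subst ruelle_neg_eq) (auto simp: sum_ennreal)
      finally show ?thesis by simp
    qed
    then have "(\<integral>\<^sup>+y. ennreal (ruelle_neg A \<phi>m (indicator K) y) \<partial>\<mu>) =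
      (\<integral>\<^sup>+y. \<integral>\<^sup>+c. indicator (before A c) y * ennreal (exp (\<phi>m (app A c y))) * indicator K (app A c y) \<partial>count_space UNIV \<partial>\<mu>)"
      by (intro nn_integral_cong) (simp add: sp)
    also have "\<dots> = (\<integral>\<^sup>+c. \<integral>\<^sup>+y. indicator (before A c) y * ennreal (exp (\<phi>m (app A c y))) * indicator K (app A c y) \<partial>\<mu> \<partial>count_space UNIV)"
      by (intro nn_integral_count_space_nn_integral cnt) measurable
    also have "\<dots> = (\<integral>\<^sup>+c. ennreal lam * (\<integral>\<^sup>+y. indicator (last_cyl A c) y * indicator K y \<partial>\<mu>) \<partial>count_space UNIV)"
      using R by (intro nn_integral_cong) (auto simp: transfers_def)
    also have "\<dots> = ennreal lam * (\<integral>\<^sup>+c. \<integral>\<^sup>+y. indicator (last_cyl A c) y * indicator K y \<partial>\<mu> \<partial>count_space UNIV)"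
      by (intro nn_integral_cmult) auto
    also have "(\<integral>\<^sup>+c. \<integral>\<^sup>+y. indicator (last_cyl A c) y * indicator K y \<partial>\<mu> \<partial>count_space UNIV) =
       (\<integral>\<^sup>+y. \<integral>\<^sup>+c. indicator (last_cyl A c) y * indicator K y \<partial>count_space UNIV \<partial>\<mu>)"
      by (intro nn_integral_count_space_nn_integral[symmetric] cnt) measurable
    also have "\<dots> = (\<integral>\<^sup>+y. indicator K y \<partial>\<mu>)"
    proof (intro nn_integral_cong)
      fix y assume "y \<in> space \<mu>"
      then have "(\<integral>\<^sup>+c. indicator (last_cyl A c) y * indicator K y \<partial>count_space UNIV) =
        (\<Sum>c\<in>{y 0}. indicator (last_cyl A c) y * indicator K y)"
        by (intro nn_integral_count_space') (auto simp: last_cyl_def)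
      then show "(\<integral>\<^sup>+c. indicator (last_cyl A c) y * indicator K y \<partial>count_space UNIV) = (indicator K y :: ennreal)"
        using KX by (auto simp: last_cyl_def indicator_def)
    qed
    finally show ?thesis by simp
  qed
  then show "conformal_measure A \<phi>m lam \<mu>"
    using R unfolding conformal_measure_def radon_iff by blast
qed

end

section \<open>From conformal measures to eigenfunctions\<close>

lemma sets_add_measure [simp]: "sets (add_measure \<mu> \<nu>) = sets \<mu>"
  by (simp add: add_measure_def)

lemma space_add_measure [simp]: "space (add_measure \<mu> \<nu>) = space \<mu>"
  by (simp add: add_measure_def)

lemma nn_integral_add_measure:
  assumes s: "sets \<nu> = sets \<mu>" and "g \<in> borel_measurable \<mu>"
  shows "(\<integral>\<^sup>+x. g x \<partial>add_measure \<mu> \<nu>) = (\<integral>\<^sup>+x. g x \<partial>\<mu>) + (\<integral>\<^sup>+x. g x \<partial>\<nu>)"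
proof -
  have meas: "f \<in> borel_measurable (add_measure \<mu> \<nu>)" "f \<in> borel_measurable \<nu>"
    if "f \<in> borel_measurable \<mu>" for f :: "_ \<Rightarrow> ennreal"
    using that by (simp_all add: s cong: measurable_cong_sets)
  show ?thesis
    using assms(2)
  proof (induction rule: borel_measurable_induct)
    case (cong f g)
    have "(\<integral>\<^sup>+x. f x \<partial>M) = (\<integral>\<^sup>+x. g x \<partial>M)" if "space M = space \<mu>" for M
      using cong(3) that by (intro nn_integral_cong) simp
    with cong(4) sets_eq_imp_space_eq[OF s] show ?case by simp
  next
    case (set B)
    then show ?case using s by (simp add: emeasure_add_measure)
  next
    case (mult u c)
    with meas[OF mult(2)] show ?case by (simp add: nn_integral_cmult distrib_left)
  next
    case (add u v)
    then show ?case by (simp add: nn_integral_add meas ac_simps)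
  next
    case (seq U)
    have m: "U i \<in> borel_measurable (add_measure \<mu> \<nu>)" "U i \<in> borel_measurable \<nu>" for i
      using meas[OF seq(1)] by auto
    have inc: "incseq (\<lambda>i. \<integral>\<^sup>+x. U i x \<partial>M)" for M
      using seq(3) by (auto simp: incseq_def le_fun_def intro!: nn_integral_mono)
    have "(SUP i. U i) = (\<lambda>x. SUP i. U i x)" by (auto simp: fun_eq_iff image_comp)
    then show ?case
      using seq m inc
      by (simp add: nn_integral_monotone_convergence_SUP ennreal_SUP_add)
  qed
qed

context markov_shift
begin

lemma exists_Xpos: "\<exists>x\<in>Xpos A. A c (x 0) = 1"
proof -
  define p where "p n = ((\<lambda>a. SOME b. A a b = 1) ^^ n) c" for n
  have p: "A (p n) (p (Suc n)) = 1" for n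
    using someI_ex[OF succ_ex] by (simp add: p_def)
  define x where "x i = (if i < 0 then undefined else p (Suc (nat i)))" for i :: int
  have "x \<in> Xpos A"
    using p by (auto simp: x_def Xpos_iff nat_add_distrib)
  moreover have "A c (x 0) = 1" using p[of 0] by (simp add: p_def x_def)
  ultimately show ?thesis by blast
qed

lemma exists_Xneg: "\<exists>y\<in>Xneg A. A (y 0) b = 1"
proof -
  define p where "p n = ((\<lambda>a. SOME c. A c a = 1) ^^ n) b" for n
  have p: "A (p (Suc n)) (p n) = 1" for n
    using someI_ex[OF pred_ex] by (simp add: p_def)
  define y where "y i = (if i > 0 then undefined else p (Suc (nat (- i))))" for i :: int
  have "A (y i) (y (i + 1)) = 1" if "i < 0" for i
  proof -
    have "nat (- i) = Suc (nat (- (i + 1)))" using that by simp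
    then show ?thesis using p[of "Suc (nat (- (i + 1)))"] that by (simp add: y_def)
  qed
  then have "y \<in> Xneg A" unfolding Xneg_iff by (simp add: y_def)
  moreover have "A (y 0) b = 1" using p[of 0] by (simp add: p_def y_def)
  ultimately show ?thesis by blast
qed

lemma AE_notin_iff:
  assumes "sets M = sets (Bneg A)" "B \<in> sets (Bneg A)"
  shows "(AE y in M. y \<notin> B) \<longleftrightarrow> emeasure M B = 0"
proof (rule AE_iff_measurable)
  show "B \<in> sets M" using assms by simp
  then show "{y \<in> space M. \<not> y \<notin> B} = B" using sets.sets_into_space by auto
qed

text \<open>Both measures may be infinite; the countable partition by last letter reduces equality
  to the pieces.\<close>

lemma measure_eqI_last_cyl:
  assumes M: "sets M = sets (Bneg A)" and N: "sets N = sets (Bneg A)"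
    and eq: "\<And>c B. B \<in> sets (Bneg A) \<Longrightarrow> emeasure M (last_cyl A c \<inter> B) = emeasure N (last_cyl A c \<inter> B)"
  shows "M = N"
proof (rule measure_eqI)
  fix B assume B: "B \<in> sets M"
  have *: "B = (\<Union>c. last_cyl A c \<inter> B)"
    using sets.sets_into_space[OF B] sets_eq_imp_space_eq[OF M] by (auto simp: last_cyl_def)
  have "emeasure R B = (\<integral>\<^sup>+c. emeasure R (last_cyl A c \<inter> B) \<partial>count_space UNIV)"
    if "sets R = sets (Bneg A)" for R
  proof (subst *, rule emeasure_UN_countable[OF _ cnt])
    show "disjoint_family (\<lambda>c. last_cyl A c \<inter> B)"
      by (auto simp: disjoint_family_on_def last_cyl_def)
  qed (use that B M in simp)
  then show "emeasure M B = emeasure N B" using B M N eq by simp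
qed (use assms in simp)

text \<open>By finite branching \<open>before A b\<close> is a finite disjoint union of sets
  \<open>last_cyl A c\<close>.\<close>

lemma nn_integral_before:
  assumes M: "sets M = sets (Bneg A)" and h: "h \<in> borel_measurable (Bneg A)"
  shows "(\<integral>\<^sup>+y. indicator (before A b) y * h y \<partial>M) =
    (\<Sum>c | A c b = 1. \<integral>\<^sup>+y. indicator (last_cyl A c) y * h y \<partial>M)"
proof -
  note [measurable_cong] = M
  note [measurable] = h
  have sp: "space M = Xneg A" using sets_eq_imp_space_eq[OF M] by simp
  have "(\<integral>\<^sup>+y. indicator (before A b) y * h y \<partial>M) =
      (\<integral>\<^sup>+y. (\<Sum>c | A c b = 1. indicator (last_cyl A c) y * h y) \<partial>M)"
  proof (intro nn_integral_cong)
    fix y assume "y \<in> space M"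
    then have "(\<Sum>c | A c b = 1. indicator (last_cyl A c) y * h y) =
        (\<Sum>c | A c b = 1. if c = y 0 then h y else 0)"
      by (intro sum.cong) (auto simp: last_cyl_def sp indicator_def)
    also have "\<dots> = (if A (y 0) b = 1 then h y else 0)" by (subst sum.delta[OF fin_pred]) simp
    finally show "indicator (before A b) y * h y = (\<Sum>c | A c b = 1. indicator (last_cyl A c) y * h y)"
      using \<open>y \<in> space M\<close> by (simp add: sp before_def)
  qed
  also have "\<dots> = (\<Sum>c | A c b = 1. \<integral>\<^sup>+y. indicator (last_cyl A c) y * h y \<partial>M)"
    by (intro nn_integral_sum) measurable
  finally show ?thesis .
qed

end

section \<open>Families of measures that obey the recursion\<close>

context ruelle_pair
begin

text \<open>The properties shared by the measures \<chi>_x \<mu> of a conformal \<mu> and by those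
  constructed from an eigenfunction: mass, support and recursion. Masses in \<open>ennreal\<close>
  allow the notion to be used before finiteness is known.\<close>

definition kernel_family :: "((int \<Rightarrow> 's) \<Rightarrow> (int \<Rightarrow> 's) measure) \<Rightarrow> ((int \<Rightarrow> 's) \<Rightarrow> ennreal) \<Rightarrow> bool" where
  "kernel_family N f \<longleftrightarrow> (\<forall>x\<in>Xpos A.
     sets (N x) = sets (Bneg A) \<and> emeasure (N x) (Xneg A) = f x \<and>
     (AE y in N x. y \<in> before A (x 0)) \<and>
     (\<forall>c. A c (x 0) = 1 \<longrightarrow> (\<forall>h\<in>borel_measurable (Bneg A).
        ennreal (exp (\<phi> (cons c x))) * (\<integral>\<^sup>+u. h (app A c u) \<partial>N (cons c x)) =
        ennreal lam * (\<integral>\<^sup>+y. indicator (last_cyl A c) y * h y \<partial>N x))))"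

lemma kernel_familyD:
  assumes "kernel_family N f" "x \<in> Xpos A"
  shows "sets (N x) = sets (Bneg A)" "emeasure (N x) (Xneg A) = f x"
    "AE y in N x. y \<in> before A (x 0)"
    "\<And>c h. A c (x 0) = 1 \<Longrightarrow> h \<in> borel_measurable (Bneg A) \<Longrightarrow>
        ennreal (exp (\<phi> (cons c x))) * (\<integral>\<^sup>+u. h (app A c u) \<partial>N (cons c x)) =
        ennreal lam * (\<integral>\<^sup>+y. indicator (last_cyl A c) y * h y \<partial>N x)"
  using assms unfolding kernel_family_def by blast+

lemma snoc_cyl_iff:
  assumes "u \<in> before A (y 0)" "y \<in> Xneg A"
  shows "snoc u (y 0) \<in> cyl A (Suc n) y \<longleftrightarrow> u \<in> cyl A n (butlast_seq y)"
proof -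
  have u: "u \<in> Xneg A" "snoc u (y 0) \<in> Xneg A" using assms by (auto simp: before_def intro: snoc_Xneg)
  have "(\<forall>i. - int (Suc n) < i \<longrightarrow> snoc u (y 0) i = y i) \<longleftrightarrow> (\<forall>i. - int n < i \<longrightarrow> u i = butlast_seq y i)"
  proof (intro iffI allI impI)
    fix i assume h: "\<forall>i. - int (Suc n) < i \<longrightarrow> snoc u (y 0) i = y i" "- int n < i"
    show "u i = butlast_seq y i"
    proof (cases "i > 0")
      case True
      then show ?thesis using u(1) butlast_seq_Xneg(1)[OF assms(2)] by (simp add: Xneg_iff)
    next
      case False
      have "snoc u (y 0) (i - 1) = y (i - 1)" using h by auto
      then show ?thesis using False by (simp add: snoc_def butlast_seq_def right_shift_def)
    qed
  next
    fix i assume h: "\<forall>i. - int n < i \<longrightarrow> u i = butlast_seq y i" "- int (Suc n) < i"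
    show "snoc u (y 0) i = y i"
    proof (cases "i \<ge> 0")
      case True
      then show ?thesis using u(2) assms(2) by (cases "i = 0") (simp_all add: Xneg_iff)
    next
      case False
      have "u (i + 1) = butlast_seq y (i + 1)" using h by auto
      then show ?thesis using False by (simp add: snoc_def butlast_seq_def right_shift_def)
    qed
  qed
  then show ?thesis using u by (simp add: cyl_def)
qed

text \<open>The recursion tested on an indicator: the last letter of the word moves in front of
  x.\<close>

lemma kernel_family_cyl_Suc:
  assumes N: "kernel_family N f" and x: "x \<in> Xpos A" and y: "y \<in> Xneg A" "A (y 0) (x 0) = 1"
  shows "ennreal lam * emeasure (N x) (cyl A (Suc n) y) =
    ennreal (exp (\<phi> (cons (y 0) x))) * emeasure (N (cons (y 0) x)) (cyl A n (butlast_seq y))"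
proof -
  have x': "cons (y 0) x \<in> Xpos A" using x y by (intro cons_Xpos)
  note M = kernel_familyD(1)[OF N x] kernel_familyD(1)[OF N x']
  have "emeasure (N x) (cyl A (Suc n) y) = (\<integral>\<^sup>+v. indicator (cyl A (Suc n) y) v \<partial>N x)"
    using M by simp
  also have "\<dots> = (\<integral>\<^sup>+v. indicator (last_cyl A (y 0)) v * indicator (cyl A (Suc n) y) v \<partial>N x)"
    using cyl_sub_last[of "Suc n" A y] by (intro nn_integral_cong) (auto simp: indicator_def)
  finally have "ennreal lam * emeasure (N x) (cyl A (Suc n) y) =
      ennreal (exp (\<phi> (cons (y 0) x))) * (\<integral>\<^sup>+u. indicator (cyl A (Suc n) y) (app A (y 0) u) \<partial>N (cons (y 0) x))"
    using kernel_familyD(4)[OF N x y(2), of "indicator (cyl A (Suc n) y)"] by simp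
  also have "(\<integral>\<^sup>+u. indicator (cyl A (Suc n) y) (app A (y 0) u) \<partial>N (cons (y 0) x)) =
      (\<integral>\<^sup>+u. indicator (cyl A n (butlast_seq y)) u \<partial>N (cons (y 0) x))"
    using kernel_familyD(3)[OF N x'] snoc_cyl_iff[OF _ y(1), of _ n]
    by (intro nn_integral_cong_AE, elim eventually_mono) (simp add: app_before indicator_def)
  also have "\<dots> = emeasure (N (cons (y 0) x)) (cyl A n (butlast_seq y))" using M by simp
  finally show ?thesis .
qed

text \<open>Induction on the word length, with x varying because each step lengthens it. The empty
  word gives the total mass; a word whose last letter cannot precede x has measure zero by the
  support condition.\<close>

lemma kernel_family_unique:
  assumes N: "kernel_family N f" and N': "kernel_family N' f" and x: "x \<in> Xpos A"
    and fin: "f x < \<infinity>"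
  shows "N x = N' x"
proof (rule measure_eqI_cyl[OF cnt kernel_familyD(1)[OF N x] kernel_familyD(1)[OF N' x]])
  fix n y assume "y \<in> Xneg A"
  then show "emeasure (N x) (cyl A n y) = emeasure (N' x) (cyl A n y)"
    using x
  proof (induction n arbitrary: x y)
    case 0
    then show ?case using kernel_familyD(2)[OF N] kernel_familyD(2)[OF N'] by (simp add: cyl_0)
  next
    case (Suc n)
    show ?case
    proof (cases "A (y 0) (x 0) = 1")
      case True
      have "ennreal lam * emeasure (N x) (cyl A (Suc n) y) = ennreal lam * emeasure (N' x) (cyl A (Suc n) y)"
        using Suc.IH[OF butlast_seq_Xneg(1)[OF Suc.prems(1)] cons_Xpos[where A = A, OF Suc.prems(2) True]]
          kernel_family_cyl_Suc[OF N Suc.prems(2,1) True] kernel_family_cyl_Suc[OF N' Suc.prems(2,1) True] by simp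
      then show ?thesis using lam by (simp add: ennreal_mult_cancel_left)
    next
      case False
      moreover have "v 0 = y 0" if "v \<in> cyl A (Suc n) y" for v using that by (simp add: cyl_def)
      ultimately have "\<And>v. v \<in> before A (x 0) \<Longrightarrow> v \<notin> cyl A (Suc n) y" by (auto simp: before_def)
      then have "AE v in N x. v \<notin> cyl A (Suc n) y" "AE v in N' x. v \<notin> cyl A (Suc n) y"
        using kernel_familyD(3)[OF N Suc.prems(2)] kernel_familyD(3)[OF N' Suc.prems(2)]
        by (auto elim!: eventually_mono)
      then show ?thesis
        using AE_notin_iff[OF kernel_familyD(1)[OF N Suc.prems(2)] cyl_sets]
          AE_notin_iff[OF kernel_familyD(1)[OF N' Suc.prems(2)] cyl_sets] by metis
    qed
  qed
qed (use kernel_familyD(2)[OF N x] fin in auto)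

text \<open>The right-hand side of \<open>conformal_iff\<close>, the form in which conformal
  measures are handled from here on.\<close>

definition finite_transfers :: "(int \<Rightarrow> 's) measure \<Rightarrow> bool" where
  "finite_transfers \<mu> \<longleftrightarrow>
     sets \<mu> = sets (Bneg A) \<and> (\<forall>c. emeasure \<mu> (last_cyl A c) < \<infinity>) \<and> transfers \<mu>"

definition chi_integral :: "(int \<Rightarrow> 's) measure \<Rightarrow> (int \<Rightarrow> 's) \<Rightarrow> ennreal" where
  "chi_integral \<mu> x = (\<integral>\<^sup>+y. ennreal (ch x y) \<partial>\<mu>)"

lemma finite_transfersD:
  assumes "finite_transfers \<mu>"
  shows "sets \<mu> = sets (Bneg A)" "space \<mu> = Xneg A" "emeasure \<mu> (last_cyl A c) < \<infinity>" "transfers \<mu>"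
  using assms sets_eq_imp_space_eq[of \<mu> "Bneg A"] by (auto simp: finite_transfers_def)

text \<open>\<open>chi_cons\<close> turns the weights at c x into those at x, after which
  \<open>transfers\<close> applies with g = \<chi>_x h.\<close>

lemma kernel_family_density:
  assumes \<mu>: "finite_transfers \<mu>"
  shows "kernel_family (\<lambda>x. density \<mu> (\<lambda>y. ennreal (ch x y))) (chi_integral \<mu>)"
  unfolding kernel_family_def
proof (intro ballI conjI allI impI)
  note M [measurable_cong, simp] = finite_transfersD(1)[OF \<mu>]
  note sp = finite_transfersD(2)[OF \<mu>]
  fix x assume x: "x \<in> Xpos A"
  note [measurable] = chi_measurable[OF x]
  show "sets (density \<mu> (\<lambda>y. ennreal (ch x y))) = sets (Bneg A)" by simp
  have "Xneg A \<in> sets (Bneg A)" by (rule level_sets[OF level_Xneg])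
  then show "emeasure (density \<mu> (\<lambda>y. ennreal (ch x y))) (Xneg A) = chi_integral \<mu> x"
    unfolding chi_integral_def
    by (subst emeasure_density) (auto intro!: nn_integral_cong simp: sp indicator_def)
  show "AE y in density \<mu> (\<lambda>y. ennreal (ch x y)). y \<in> before A (x 0)"
  proof -
    have "0 < ennreal (ch x y) \<longrightarrow> y \<in> before A (x 0)" if "y \<in> space \<mu>" for y
      using that by (auto simp: before_def sp chi_def)
    then show ?thesis by (subst AE_density) auto
  qed
  fix c and h :: "_ \<Rightarrow> ennreal" assume c: "A c (x 0) = 1" and h [measurable]: "h \<in> borel_measurable (Bneg A)"
  have x': "cons c x \<in> Xpos A" using x c by (intro cons_Xpos)
  note [measurable] = chi_measurable[OF x']
  have "ennreal (exp (\<phi> (cons c x))) * (\<integral>\<^sup>+u. h (app A c u) \<partial>density \<mu> (\<lambda>y. ennreal (ch (cons c x) y))) =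
    (\<integral>\<^sup>+u. ennreal (exp (\<phi> (cons c x))) * (ennreal (ch (cons c x) u) * h (app A c u)) \<partial>\<mu>)"
    by (simp add: nn_integral_density nn_integral_cmult)
  also have "\<dots> = (\<integral>\<^sup>+u. indicator (before A c) u * ennreal (exp (\<phi>m (app A c u))) *
      (ennreal (ch x (app A c u)) * h (app A c u)) \<partial>\<mu>)"
  proof (intro nn_integral_cong)
    fix u assume u: "u \<in> space \<mu>"
    show "ennreal (exp (\<phi> (cons c x))) * (ennreal (ch (cons c x) u) * h (app A c u)) =
      indicator (before A c) u * ennreal (exp (\<phi>m (app A c u))) * (ennreal (ch x (app A c u)) * h (app A c u))"
    proof (cases "A (u 0) c = 1")
      case True
      have "ennreal (exp (\<phi> (cons c x))) * ennreal (ch (cons c x) u) =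
          ennreal (exp (\<phi>m (snoc u c))) * ennreal (ch x (snoc u c))"
        using chi_cons[OF x c u[unfolded sp] True] by (simp flip: ennreal_mult')
      then show ?thesis using u True by (simp add: sp before_def app_def flip: mult.assoc)
    qed (simp add: chi_def before_def)
  qed
  also have "\<dots> = ennreal lam * (\<integral>\<^sup>+y. indicator (last_cyl A c) y * (ennreal (ch x y) * h y) \<partial>\<mu>)"
    using finite_transfersD(4)[OF \<mu>] unfolding transfers_def
    by (elim allE[of _ c] ballE[of _ _ "\<lambda>y. ennreal (ch x y) * h y"]) auto
  also have "(\<integral>\<^sup>+y. indicator (last_cyl A c) y * (ennreal (ch x y) * h y) \<partial>\<mu>) =
      (\<integral>\<^sup>+y. indicator (last_cyl A c) y * h y \<partial>density \<mu> (\<lambda>y. ennreal (ch x y)))"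
    by (simp add: nn_integral_density ac_simps)
  finally show "ennreal (exp (\<phi> (cons c x))) * (\<integral>\<^sup>+u. h (app A c u) \<partial>density \<mu> (\<lambda>y. ennreal (ch (cons c x) y))) =
    ennreal lam * (\<integral>\<^sup>+y. indicator (last_cyl A c) y * h y \<partial>density \<mu> (\<lambda>y. ennreal (ch x y)))" .
qed

section \<open>Finiteness, positivity and eigenvalue equation of \<mu>(\<chi>_x)\<close>

lemma chi_integral_sum:
  assumes \<mu>: "finite_transfers \<mu>" and x: "x \<in> Xpos A"
  shows "chi_integral \<mu> x = (\<Sum>c | A c (x 0) = 1. \<integral>\<^sup>+y. indicator (last_cyl A c) y * ennreal (ch x y) \<partial>\<mu>)"
proof -
  note sp = finite_transfersD(2)[OF \<mu>]
  have "chi_integral \<mu> x = (\<integral>\<^sup>+y. indicator (before A (x 0)) y * ennreal (ch x y) \<partial>\<mu>)"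
    unfolding chi_integral_def
    by (intro nn_integral_cong) (auto simp: sp before_def indicator_def chi_def)
  also have "\<dots> = (\<Sum>c | A c (x 0) = 1. \<integral>\<^sup>+y. indicator (last_cyl A c) y * ennreal (ch x y) \<partial>\<mu>)"
    using chi_measurable[OF x] by (intro nn_integral_before finite_transfersD[OF \<mu>]) simp
  finally show ?thesis .
qed

text \<open>\<open>ch x\<close> lives on finitely many sets \<open>last_cyl A c\<close>, each
  compact and of finite mass.\<close>

lemma chi_integral_finite:
  assumes \<mu>: "finite_transfers \<mu>" and x: "x \<in> Xpos A"
  shows "chi_integral \<mu> x < \<infinity>"
proof -
  note M [measurable_cong, simp] = finite_transfersD(1)[OF \<mu>]
  have "(\<integral>\<^sup>+y. indicator (last_cyl A c) y * ennreal (ch x y) \<partial>\<mu>) < \<infinity>" for c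
  proof -
    obtain K where K: "K \<ge> 0" "\<And>y. y \<in> last_cyl A c \<Longrightarrow> ch x y \<le> K"
      using loc_cont_bounded[OF chi_loc_cont[OF x], of c] by auto
    have "(\<integral>\<^sup>+y. indicator (last_cyl A c) y * ennreal (ch x y) \<partial>\<mu>) \<le>
        (\<integral>\<^sup>+y. ennreal K * indicator (last_cyl A c) y \<partial>\<mu>)"
      using K by (intro nn_integral_mono) (auto simp: indicator_def intro!: ennreal_leI)
    also have "\<dots> = ennreal K * emeasure \<mu> (last_cyl A c)" by (simp add: nn_integral_cmult)
    also have "\<dots> < \<infinity>" using finite_transfersD(3)[OF \<mu>, of c] by (simp add: ennreal_mult_less_top)
    finally show ?thesis .
  qed
  then show ?thesis using fin_pred unfolding chi_integral_sum[OF assms] by simp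
qed

text \<open>The recursion for the family \<chi>_x \<mu>, taken with the constant function 1 and
  summed over the letters that may precede x.\<close>

lemma chi_integral_eigen:
  assumes \<mu>: "finite_transfers \<mu>" and x: "x \<in> Xpos A"
  shows "(\<Sum>c | A c (x 0) = 1. ennreal (exp (\<phi> (cons c x))) * chi_integral \<mu> (cons c x)) =
    ennreal lam * chi_integral \<mu> x"
proof -
  note M [measurable_cong, simp] = finite_transfersD(1)[OF \<mu>]
  note [measurable] = chi_measurable[OF x]
  have "ennreal (exp (\<phi> (cons c x))) * chi_integral \<mu> (cons c x) =
      ennreal lam * (\<integral>\<^sup>+y. indicator (last_cyl A c) y * ennreal (ch x y) \<partial>\<mu>)" if c: "A c (x 0) = 1" for c
  proof -
    have x': "cons c x \<in> Xpos A" using x c by (intro cons_Xpos)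
    note [measurable] = chi_measurable[OF x']
    show ?thesis
      using kernel_familyD(4)[OF kernel_family_density[OF \<mu>] x c, of "\<lambda>_. 1"]
        kernel_familyD(2)[OF kernel_family_density[OF \<mu>] x']
      by (simp add: finite_transfersD(2)[OF \<mu>] emeasure_density mult.commute[of "ennreal (ch x _)"])
  qed
  then show ?thesis by (simp add: chi_integral_sum[OF assms] sum_distrib_left)
qed

text \<open>Conformality propagates positive mass along arrows: if b' may follow b and points ending
  in b have positive mass, so do points ending in b'. Some last letter has positive mass by
  countability, and transitivity leads from it to c.\<close>

lemma last_cyl_pos:
  assumes \<mu>: "finite_transfers \<mu>" and nz: "emeasure \<mu> (space \<mu>) \<noteq> 0"
  shows "emeasure \<mu> (last_cyl A c) \<noteq> 0"
proof -
  note M [measurable_cong, simp] = finite_transfersD(1)[OF \<mu>]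
  note sp = finite_transfersD(2)[OF \<mu>]
  have step: "emeasure \<mu> (last_cyl A b') \<noteq> 0" if "emeasure \<mu> (last_cyl A b) \<noteq> 0" "A b b' = 1" for b b'
  proof
    assume z: "emeasure \<mu> (last_cyl A b') = 0"
    have "(\<integral>\<^sup>+u. indicator (before A b') u * ennreal (exp (\<phi>m (app A b' u))) * 1 \<partial>\<mu>) =
        ennreal lam * (\<integral>\<^sup>+y. indicator (last_cyl A b') y * 1 \<partial>\<mu>)"
      using finite_transfersD(4)[OF \<mu>] unfolding transfers_def
      by (elim allE[of _ b'] ballE[of _ _ "\<lambda>y. 1"]) auto
    also have "\<dots> = 0" using z by simp
    finally have "AE u in \<mu>. indicator (before A b') u * ennreal (exp (\<phi>m (app A b' u))) * 1 = 0"
      by (subst (asm) nn_integral_0_iff_AE) auto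
    then have "AE u in \<mu>. u \<notin> last_cyl A b"
      using that(2) by (auto elim!: eventually_mono simp: indicator_def before_def last_cyl_def split: if_splits)
    then show False using that(1) AE_notin_iff[OF M last_cyl_sets] by blast
  qed
  obtain b where b: "emeasure \<mu> (last_cyl A b) \<noteq> 0"
  proof (rule ccontr)
    assume "\<not> thesis"
    then have "\<And>b. last_cyl A b \<in> null_sets \<mu>" using that by (auto simp: null_sets_def)
    then have "(\<Union>b. last_cyl A b) \<in> null_sets \<mu>" by (intro null_sets_UN' cnt)
    then show False using nz by (simp add: Union_last_cyl sp null_sets_def)
  qed
  obtain n :: nat and p where p: "p 0 = b" "p n = c" "\<forall>i<n. A (p i) (p (i + 1)) = 1"
    using trans[unfolded transitive_shift_def, rule_format, of b c] by (elim exE conjE)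
  have "i \<le> n \<Longrightarrow> emeasure \<mu> (last_cyl A (p i)) \<noteq> 0" for i
  proof (induction i)
    case (Suc i)
    then show ?case using step[of "p i" "p (Suc i)"] p(3) by simp
  qed (use b p in simp)
  then show ?thesis using p(2) by blast
qed

lemma chi_integral_pos:
  assumes \<mu>: "finite_transfers \<mu>" and nz: "emeasure \<mu> (space \<mu>) \<noteq> 0" and x: "x \<in> Xpos A"
  shows "chi_integral \<mu> x \<noteq> 0"
proof
  note M [measurable_cong, simp] = finite_transfersD(1)[OF \<mu>]
  note sp = finite_transfersD(2)[OF \<mu>]
  note [measurable] = chi_measurable[OF x]
  obtain c where c: "A c (x 0) = 1" using pred_ex by auto
  assume "chi_integral \<mu> x = 0"
  then have "AE y in \<mu>. ennreal (ch x y) = 0"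
    unfolding chi_integral_def by (subst (asm) nn_integral_0_iff_AE) auto
  then have "AE y in \<mu>. y \<notin> last_cyl A c"
    using c by (auto elim!: eventually_mono simp: last_cyl_def chi_def)
  then show False using last_cyl_pos[OF \<mu> nz] AE_notin_iff[OF M last_cyl_sets] by blast
qed

lemma pi_map_eq:
  assumes \<mu>: "finite_transfers \<mu>" and x: "x \<in> Xpos A"
  shows "pi_map A \<psi> \<mu> x = enn2real (chi_integral \<mu> x)"
proof -
  have "ch x \<in> borel_measurable \<mu>"
    using chi_measurable[OF x] by (simp add: measurable_cong_sets[OF finite_transfersD(1)[OF \<mu>] refl])
  then show ?thesis using x by (simp add: pi_map_def chi_integral_def integral_eq_nn_integral)
qed

lemma chi_integral_eq:
  assumes "finite_transfers \<mu>" and "x \<in> Xpos A"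
  shows "chi_integral \<mu> x = ennreal (pi_map A \<psi> \<mu> x)"
  using chi_integral_finite[OF assms] by (simp add: pi_map_eq[OF assms])

text \<open>Monotonicity of the integral carries the estimate of \<open>chi_close\<close> over to
  \<mu>(\<chi>_x); the logarithm then turns the factor into an additive error.\<close>

lemma pi_map_eigenfunction:
  assumes \<mu>: "finite_transfers \<mu>" and nz: "emeasure \<mu> (space \<mu>) \<noteq> 0"
  shows "pi_map A \<psi> \<mu> \<in> eigenfunctions A \<phi> lam"
proof -
  note M [measurable_cong, simp] = finite_transfersD(1)[OF \<mu>]
  note sp = finite_transfersD(2)[OF \<mu>]
  let ?f = "pi_map A \<psi> \<mu>"
  have pos: "?f x > 0" if "x \<in> Xpos A" for x
    using chi_integral_pos[OF \<mu> nz that] chi_integral_eq[OF \<mu> that] by (simp add: ennreal_eq_0_iff)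
  have close: "?f x \<le> exp \<epsilon> * ?f x'" if x: "x \<in> Xpos A" "x' \<in> Xpos A"
    and c: "\<And>y. y \<in> Xneg A \<Longrightarrow> ch x y \<le> exp \<epsilon> * ch x' y" for x x' \<epsilon>
  proof -
    note [measurable] = chi_measurable[OF x(1)] chi_measurable[OF x(2)]
    have "chi_integral \<mu> x \<le> (\<integral>\<^sup>+y. ennreal (exp \<epsilon>) * ennreal (ch x' y) \<partial>\<mu>)"
      unfolding chi_integral_def using c
      by (intro nn_integral_mono) (auto simp: sp ennreal_leI simp flip: ennreal_mult')
    also have "\<dots> = ennreal (exp \<epsilon>) * chi_integral \<mu> x'"
      unfolding chi_integral_def by (intro nn_integral_cmult) simp
    finally show ?thesis
      using pos[OF x(2)] by (simp add: chi_integral_eq[OF \<mu>] x flip: ennreal_mult')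
  qed
  have uc: "uniformly_continuous_map (shift_metric A {0..}) euclidean_metric (\<lambda>x. ln (?f x))"
    unfolding uniformly_continuous_shift_iff
  proof (intro allI impI)
    fix \<epsilon> :: real assume "0 < \<epsilon>"
    \<comment> \<open>Half of \<epsilon>, because the bound obtained is weak and a strict one is
      required.\<close>
    then have "0 < \<epsilon> / 2" by simp
    from chi_close[OF this] obtain N where N: "\<And>x x' y y'. x \<in> Xpos A \<Longrightarrow> x' \<in> Xpos A \<Longrightarrow> y \<in> Xneg A \<Longrightarrow> y' \<in> Xneg A \<Longrightarrow>
      (\<forall>i<int N. x i = x' i) \<Longrightarrow> (\<forall>i>- int N. y i = y' i) \<Longrightarrow> ch x y \<le> exp (\<epsilon> / 2) * ch x' y'"
      by metis
    have half: "ln (?f x) \<le> \<epsilon> / 2 + ln (?f x')"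
      if x: "x \<in> Xpos A" "x' \<in> Xpos A" "\<forall>i<int N. x i = x' i" for x x'
    proof -
      have "?f x \<le> exp (\<epsilon> / 2) * ?f x'" using x N by (intro close) auto
      then have "ln (?f x) \<le> ln (exp (\<epsilon> / 2) * ?f x')"
        using pos x by (simp add: ln_le_cancel_iff)
      also have "\<dots> = \<epsilon> / 2 + ln (?f x')" using pos[OF x(2)] by (simp add: ln_mult)
      finally show ?thesis .
    qed
    show "\<exists>n::nat. \<forall>u\<in>Xpos A. \<forall>v\<in>Xpos A. (\<forall>i. \<bar>i\<bar> \<le> int n \<longrightarrow> u i = v i) \<longrightarrow> \<bar>ln (?f u) - ln (?f v)\<bar> < \<epsilon>"
    proof (intro exI[of _ N] ballI impI)
      fix u v assume uv: "u \<in> Xpos A" "v \<in> Xpos A" "\<forall>i. \<bar>i\<bar> \<le> int N \<longrightarrow> u i = v i"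
      have "u i = v i" if "i < int N" for i
        using uv that by (cases "i < 0") (auto simp: Xpos_iff)
      then show "\<bar>ln (?f u) - ln (?f v)\<bar> < \<epsilon>"
        using half[OF uv(1,2)] half[OF uv(2,1)] \<open>0 < \<epsilon>\<close> by force
    qed
  qed
  \<comment> \<open>Continuity is recovered by exponentiating the uniformly continuous
    logarithm.\<close>
  have cont: "continuous_map (mtopology_of (shift_metric A {0..})) euclideanreal ?f"
  proof -
    have "continuous_map (mtopology_of (shift_metric A {0..})) euclideanreal (\<lambda>x. ln (?f x))"
      using uniformly_continuous_imp_continuous_map[OF uc] by simp
    moreover have "continuous_map euclideanreal euclideanreal (exp :: real \<Rightarrow> real)"
      by (simp add: continuous_on_exp)
    ultimately have "continuous_map (mtopology_of (shift_metric A {0..})) euclideanreal (exp \<circ> (\<lambda>x. ln (?f x)))"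
      by (rule continuous_map_compose)
    then show ?thesis by (rule continuous_map_eq) (simp add: pos)
  qed
  have eig: "ruelle_pos A \<phi> ?f x = lam * ?f x" if x: "x \<in> Xpos A" for x
  proof -
    have c: "cons c x \<in> Xpos A" if "A c (x 0) = 1" for c using x that by (intro cons_Xpos)
    have "ennreal (ruelle_pos A \<phi> ?f x) = (\<Sum>c | A c (x 0) = 1. ennreal (exp (\<phi> (cons c x)) * ?f (cons c x)))"
      unfolding ruelle_pos_eq[OF x fin_pred] by (rule sum_ennreal[symmetric]) (use c pos in \<open>simp add: less_imp_le\<close>)
    also have "\<dots> = (\<Sum>c | A c (x 0) = 1. ennreal (exp (\<phi> (cons c x))) * chi_integral \<mu> (cons c x))"
      using c by (intro sum.cong) (auto simp: chi_integral_eq[OF \<mu>] ennreal_mult')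
    also have "\<dots> = ennreal (lam * ?f x)"
      using chi_integral_eigen[OF \<mu> x] lam by (simp add: chi_integral_eq[OF \<mu> x] ennreal_mult')
    finally have eq: "ennreal (ruelle_pos A \<phi> ?f x) = ennreal (lam * ?f x)" .
    have "0 \<le> ruelle_pos A \<phi> ?f x"
      unfolding ruelle_pos_eq[OF x fin_pred] by (rule sum_nonneg) (use c pos in \<open>simp add: less_imp_le\<close>)
    then show ?thesis using eq lam pos[OF x] by (simp add: ennreal_inj less_imp_le)
  qed
  show ?thesis
    using pos uc cont eig by (simp add: eigenfunctions_def pi_map_def)
qed

text \<open>Equal images give equal total masses, hence \<chi>_x \<mu> = \<chi>_x \<nu> by
  uniqueness. For x that may follow c, \<chi>_x is positive on \<open>last_cyl A c\<close> and can
  be divided out there.\<close>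

lemma pi_map_inj:
  assumes \<mu>: "finite_transfers \<mu>" and \<nu>: "finite_transfers \<nu>"
    and eq: "pi_map A \<psi> \<mu> = pi_map A \<psi> \<nu>"
  shows "\<mu> = \<nu>"
proof (rule measure_eqI_last_cyl[OF finite_transfersD(1)[OF \<mu>] finite_transfersD(1)[OF \<nu>]])
  note [measurable_cong, simp] = finite_transfersD(1)[OF \<mu>] finite_transfersD(1)[OF \<nu>]
  fix c and B assume B [measurable]: "B \<in> sets (Bneg A)"
  obtain x where x: "x \<in> Xpos A" "A c (x 0) = 1" using exists_Xpos by blast
  note [measurable] = chi_measurable[OF x(1)]
  \<comment> \<open>The family of \<nu> with its masses rewritten as those of \<mu>, since
    uniqueness compares families with the same mass function.\<close>
  have fam: "kernel_family (\<lambda>x. density \<nu> (\<lambda>y. ennreal (ch x y))) (chi_integral \<mu>)"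
    using kernel_family_density[OF \<nu>] eq
    by (simp add: kernel_family_def chi_integral_eq[OF \<mu>] chi_integral_eq[OF \<nu>] cong: ball_cong)
  have "density \<mu> (\<lambda>y. ennreal (ch x y)) = density \<nu> (\<lambda>y. ennreal (ch x y))"
    by (rule kernel_family_unique[OF kernel_family_density[OF \<mu>] fam x(1) chi_integral_finite[OF \<mu> x(1)]])
  moreover have "emeasure \<rho> (last_cyl A c \<inter> B) =
      (\<integral>\<^sup>+y. indicator (last_cyl A c \<inter> B) y * ennreal (inverse (ch x y)) \<partial>density \<rho> (\<lambda>y. ennreal (ch x y)))"
    if [measurable_cong, simp]: "sets \<rho> = sets (Bneg A)" for \<rho>
  proof -
    have "emeasure \<rho> (last_cyl A c \<inter> B) = (\<integral>\<^sup>+y. indicator (last_cyl A c \<inter> B) y \<partial>\<rho>)" by simp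
    also have "\<dots> = (\<integral>\<^sup>+y. ennreal (ch x y) * (indicator (last_cyl A c \<inter> B) y * ennreal (inverse (ch x y))) \<partial>\<rho>)"
    proof (intro nn_integral_cong)
      fix y
      show "indicator (last_cyl A c \<inter> B) y = ennreal (ch x y) * (indicator (last_cyl A c \<inter> B) y * ennreal (inverse (ch x y)))"
        using x(2) chi_pos[of y x] by (auto simp: indicator_def last_cyl_def simp flip: ennreal_mult')
    qed
    also have "\<dots> = (\<integral>\<^sup>+y. indicator (last_cyl A c \<inter> B) y * ennreal (inverse (ch x y)) \<partial>density \<rho> (\<lambda>y. ennreal (ch x y)))"
      by (simp add: nn_integral_density)
    finally show ?thesis .
  qed
  ultimately show "emeasure \<mu> (last_cyl A c \<inter> B) = emeasure \<nu> (last_cyl A c \<inter> B)" by simp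
qed

section \<open>Linearity\<close>

lemma add_measure_transfers:
  assumes \<mu>: "finite_transfers \<mu>" and \<nu>: "finite_transfers \<nu>"
  shows "finite_transfers (add_measure \<mu> \<nu>)"
    and "x \<in> Xpos A \<Longrightarrow> pi_map A \<psi> (add_measure \<mu> \<nu>) x = pi_map A \<psi> \<mu> x + pi_map A \<psi> \<nu> x"
proof -
  note [measurable_cong, simp] = finite_transfersD(1)[OF \<mu>] finite_transfersD(1)[OF \<nu>]
  have int: "(\<integral>\<^sup>+x. g x \<partial>add_measure \<mu> \<nu>) = (\<integral>\<^sup>+x. g x \<partial>\<mu>) + (\<integral>\<^sup>+x. g x \<partial>\<nu>)"
    if [measurable]: "g \<in> borel_measurable (Bneg A)" for g
    by (intro nn_integral_add_measure) simp_all
  show ft: "finite_transfers (add_measure \<mu> \<nu>)"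
    unfolding finite_transfers_def transfers_def
  proof (intro conjI allI ballI)
    show "emeasure (add_measure \<mu> \<nu>) (last_cyl A c) < \<infinity>" for c
      using finite_transfersD(3)[OF \<mu>, of c] finite_transfersD(3)[OF \<nu>, of c] by (simp add: emeasure_add_measure)
    fix c and g :: "_ \<Rightarrow> ennreal" assume [measurable]: "g \<in> borel_measurable (Bneg A)"
    then show "(\<integral>\<^sup>+u. indicator (before A c) u * ennreal (exp (\<phi>m (app A c u))) * g (app A c u) \<partial>add_measure \<mu> \<nu>) =
       ennreal lam * (\<integral>\<^sup>+y. indicator (last_cyl A c) y * g y \<partial>add_measure \<mu> \<nu>)"
      using finite_transfersD(4)[OF \<mu>] finite_transfersD(4)[OF \<nu>]
      by (simp add: int transfers_def distrib_left)
  qed simp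
  show "pi_map A \<psi> (add_measure \<mu> \<nu>) x = pi_map A \<psi> \<mu> x + pi_map A \<psi> \<nu> x" if x: "x \<in> Xpos A"
  proof -
    note [measurable] = chi_measurable[OF x]
    have "chi_integral (add_measure \<mu> \<nu>) x = chi_integral \<mu> x + chi_integral \<nu> x"
      unfolding chi_integral_def by (intro int) simp
    then show ?thesis
      using chi_integral_finite[OF \<mu> x] chi_integral_finite[OF \<nu> x]
      by (simp add: pi_map_eq[OF _ x] ft \<mu> \<nu> enn2real_plus)
  qed
qed

lemma scale_measure_transfers:
  assumes \<mu>: "finite_transfers \<mu>" and c: "c > 0"
  shows "finite_transfers (scale_measure (ennreal c) \<mu>)"
    and "x \<in> Xpos A \<Longrightarrow> pi_map A \<psi> (scale_measure (ennreal c) \<mu>) x = c * pi_map A \<psi> \<mu> x"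
proof -
  note [measurable_cong, simp] = finite_transfersD(1)[OF \<mu>]
  show ft: "finite_transfers (scale_measure (ennreal c) \<mu>)"
    unfolding finite_transfers_def transfers_def
  proof (intro conjI allI ballI)
    show "emeasure (scale_measure (ennreal c) \<mu>) (last_cyl A b) < \<infinity>" for b
      using finite_transfersD(3)[OF \<mu>, of b] by (simp add: ennreal_mult_less_top)
    fix b and g :: "_ \<Rightarrow> ennreal" assume [measurable]: "g \<in> borel_measurable (Bneg A)"
    then have "(\<integral>\<^sup>+u. indicator (before A b) u * ennreal (exp (\<phi>m (app A b u))) * g (app A b u) \<partial>\<mu>) =
       ennreal lam * (\<integral>\<^sup>+y. indicator (last_cyl A b) y * g y \<partial>\<mu>)"
      using finite_transfersD(4)[OF \<mu>] unfolding transfers_def by blast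
    then show "(\<integral>\<^sup>+u. indicator (before A b) u * ennreal (exp (\<phi>m (app A b u))) * g (app A b u) \<partial>scale_measure (ennreal c) \<mu>) =
       ennreal lam * (\<integral>\<^sup>+y. indicator (last_cyl A b) y * g y \<partial>scale_measure (ennreal c) \<mu>)"
      by (simp add: nn_integral_scale_measure mult.left_commute)
  qed simp
  show "pi_map A \<psi> (scale_measure (ennreal c) \<mu>) x = c * pi_map A \<psi> \<mu> x" if x: "x \<in> Xpos A"
  proof -
    note [measurable] = chi_measurable[OF x]
    have "chi_integral (scale_measure (ennreal c) \<mu>) x = ennreal c * chi_integral \<mu> x"
      unfolding chi_integral_def by (intro nn_integral_scale_measure) simp
    then show ?thesis
      using c by (simp add: pi_map_eq[OF _ x] ft \<mu> enn2real_mult)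
  qed
qed

end

context markov_shift
begin

text \<open>Estimates will be available only for long words. A property stable under finite disjoint
  unions descends from them to every shorter nonempty word.\<close>

lemma cyl_refine_induct:
  assumes base: "\<And>y. y \<in> last_cyl A c \<Longrightarrow> P (cyl A n y)"
    and union: "\<And>\<C>. finite \<C> \<Longrightarrow> disjoint \<C> \<Longrightarrow> (\<And>C. C \<in> \<C> \<Longrightarrow> C \<in> sets (Bneg A) \<and> P C) \<Longrightarrow> P (\<Union>\<C>)"
    and mn: "1 \<le> m" "m \<le> n" and y: "y \<in> last_cyl A c"
  shows "P (cyl A m y)"
  using mn(2) y
proof (induction arbitrary: y rule: inc_induct)
  case base
  then show ?case by (rule assms(1))
next
  case (step k)
  have k: "1 \<le> k" using step mn(1) by simp
  have yX: "y \<in> Xneg A" "y 0 = c" using step by (auto simp: last_cyl_def)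
  have "P (\<Union>(cyl A (Suc k) ` cyl A k y))"
  proof (rule union[OF cyl_children(1)[OF yX(1) k] cyl_children(3)[OF yX(1) k]])
    fix C assume "C \<in> cyl A (Suc k) ` cyl A k y"
    then obtain v where v: "v \<in> cyl A k y" "C = cyl A (Suc k) v" by auto
    then have "v \<in> last_cyl A c" using cyl_sub_last[OF k, of A y] yX by auto
    then show "C \<in> sets (Bneg A) \<and> P C" using v step.IH by simp
  qed
  then show ?case using cyl_children(2)[OF yX(1) k] by simp
qed

end

section \<open>From eigenfunctions to conformal measures\<close>

locale eigenfunction = ruelle_pair A \<phi> \<phi>m \<psi> lam
  for A :: "'s \<Rightarrow> 's \<Rightarrow> nat" and \<phi> \<phi>m \<psi> lam +
  fixes f :: "(int \<Rightarrow> 's) \<Rightarrow> real"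
  assumes f: "f \<in> eigenfunctions A \<phi> lam"
begin

lemma f_pos: "x \<in> Xpos A \<Longrightarrow> f x > 0"
  using f by (simp add: eigenfunctions_def)

definition weight :: "(int \<Rightarrow> 's) \<Rightarrow> ennreal" where
  "weight x = ennreal (exp (\<phi> x) / lam)"

text \<open>The eigenvalue equation divided by \<lambda>, read as the consistency condition for
  masses: the mass at x is distributed over the one-letter extensions of x.\<close>

lemma eigen_sum:
  assumes x: "x \<in> Xpos A"
  shows "(\<Sum>c | A c (x 0) = 1. weight (cons c x) * ennreal (f (cons c x))) = ennreal (f x)"
proof -
  have pos: "f (cons c x) > 0" if "A c (x 0) = 1" for c using x that by (intro f_pos cons_Xpos)
  have "(\<Sum>c | A c (x 0) = 1. weight (cons c x) * ennreal (f (cons c x))) =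
      (\<Sum>c | A c (x 0) = 1. ennreal (exp (\<phi> (cons c x)) * f (cons c x) / lam))"
    using lam by (intro sum.cong) (auto simp: weight_def simp flip: ennreal_mult')
  also have "\<dots> = ennreal (\<Sum>c | A c (x 0) = 1. exp (\<phi> (cons c x)) * f (cons c x) / lam)"
    by (rule sum_ennreal) (use pos lam in \<open>simp add: less_imp_le\<close>)
  also have "(\<Sum>c | A c (x 0) = 1. exp (\<phi> (cons c x)) * f (cons c x) / lam) = ruelle_pos A \<phi> f x / lam"
    unfolding ruelle_pos_eq[OF x fin_pred] by (simp add: sum_divide_distrib)
  also have "\<dots> = f x" using f x lam by (simp add: eigenfunctions_def)
  finally show ?thesis .
qed

section \<open>The content attached to an eigenfunction\<close>

definition pred_point :: "'s \<Rightarrow> int \<Rightarrow> 's" where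
  "pred_point b = (SOME y. y \<in> before A b)"

lemma pred_point: "pred_point b \<in> before A b"
proof -
  have "\<exists>y. y \<in> before A b" using exists_Xneg[of b] by (auto simp: before_def)
  then show ?thesis unfolding pred_point_def by (rule someI_ex)
qed

definition drop_last :: "'s \<Rightarrow> (int \<Rightarrow> 's) set \<Rightarrow> (int \<Rightarrow> 's) set" where
  "drop_last c K = {u \<in> before A c. snoc u c \<in> K}"

text \<open>The sets of level at most \<open>n\<close> are measured exactly by the \<open>n\<close>-th approximation, which puts point masses
  on words of length \<open>n\<close> followed to the left by an arbitrary point.\<close>

primrec approx_content :: "nat \<Rightarrow> (int \<Rightarrow> 's) \<Rightarrow> (int \<Rightarrow> 's) set \<Rightarrow> ennreal" where
  "approx_content 0 x K = ennreal (f x) * indicator K (pred_point (x 0))"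
| "approx_content (Suc n) x K = (\<Sum>c | A c (x 0) = 1. weight (cons c x) * approx_content n (cons c x) (drop_last c K))"

lemma approx_content_Un:
  "K \<inter> L = {} \<Longrightarrow> approx_content n x (K \<union> L) = approx_content n x K + approx_content n x L"
proof (induction n arbitrary: x K L)
  case 0
  then show ?case by (auto simp: indicator_def)
next
  case (Suc n)
  have "drop_last c (K \<union> L) = drop_last c K \<union> drop_last c L" "drop_last c K \<inter> drop_last c L = {}" for c
    using Suc.prems by (auto simp: drop_last_def)
  then show ?case using Suc.IH by (simp add: distrib_left sum.distrib)
qed

lemma snoc_before: "u \<in> before A c \<Longrightarrow> A c b = 1 \<Longrightarrow> snoc u c \<in> before A b"
  by (auto simp: before_def intro: snoc_Xneg)

text \<open>All point masses sit in \<open>before A (x 0)\<close>, so what a set contains outside is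
  invisible.\<close>

lemma approx_content_cong:
  "K \<inter> before A (x 0) = L \<inter> before A (x 0) \<Longrightarrow> approx_content n x K = approx_content n x L"
proof (induction n arbitrary: x K L)
  case 0
  then have "pred_point (x 0) \<in> K \<longleftrightarrow> pred_point (x 0) \<in> L" using pred_point[of "x 0"] by blast
  then show ?case by (simp add: indicator_def)
next
  case (Suc n)
  have "drop_last c K = drop_last c L" if "A c (x 0) = 1" for c
    using Suc.prems snoc_before[OF _ that] by (auto simp: drop_last_def)
  then show ?case by (auto intro!: sum.cong)
qed

text \<open>Peeling letters reduces the claim to the empty word, where K contains all or none of
  \<open>before A (x 0)\<close> and \<open>eigen_sum\<close> splits f(x) over one more letter. The
  hypothesis is relative to \<open>before A (x 0)\<close> so that \<open>drop_last\<close> passes it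
  on.\<close>

lemma approx_content_stable:
  assumes "x \<in> Xpos A"
    and "\<And>y v. y \<in> K \<inter> before A (x 0) \<Longrightarrow> v \<in> cyl A n y \<inter> before A (x 0) \<Longrightarrow> v \<in> K"
  shows "approx_content (Suc n) x K = approx_content n x K"
  using assms
proof (induction n arbitrary: x K)
  case 0
  have "indicator (drop_last c K) (pred_point c) = (indicator K (pred_point (x 0)) :: ennreal)" if c: "A c (x 0) = 1" for c
  proof -
    have *: "snoc (pred_point c) c \<in> before A (x 0)" using snoc_before[OF pred_point c] .
    \<comment> \<open>Zero-letter cylinders are the whole space, so the hypothesis compares any two
      points of \<open>before A (x 0)\<close>.\<close>
    have XX: "cyl A 0 (snoc (pred_point c) c) = Xneg A" "cyl A 0 (pred_point (x 0)) = Xneg A"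
      using * pred_point[of "x 0"] by (auto intro!: cyl_0 simp: before_def)
    have "snoc (pred_point c) c \<in> K \<longleftrightarrow> pred_point (x 0) \<in> K"
      using "0.prems"(2)[of "snoc (pred_point c) c" "pred_point (x 0)"] "0.prems"(2)[of "pred_point (x 0)" "snoc (pred_point c) c"]
        * pred_point[of "x 0"] XX by (auto simp: before_def)
    then show ?thesis using pred_point[of c] by (simp add: drop_last_def indicator_def)
  qed
  then have "approx_content (Suc 0) x K =
      (\<Sum>c | A c (x 0) = 1. weight (cons c x) * ennreal (f (cons c x)) * indicator K (pred_point (x 0)))"
    unfolding approx_content.simps cons_0 by (intro sum.cong) (auto simp: mult.assoc)
  also have "\<dots> = approx_content 0 x K"
    unfolding sum_distrib_right[symmetric] eigen_sum[OF "0.prems"(1)] by simp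
  finally show ?case .
next
  case (Suc n)
  have "approx_content (Suc n) (cons c x) (drop_last c K) = approx_content n (cons c x) (drop_last c K)" if c: "A c (x 0) = 1" for c
  proof (rule Suc.IH)
    show "cons c x \<in> Xpos A" using Suc.prems c by (intro cons_Xpos)
    fix y v assume y: "y \<in> drop_last c K \<inter> before A (cons c x 0)"
      and v: "v \<in> cyl A n y \<inter> before A (cons c x 0)"
    then have yc: "y \<in> before A c" "snoc y c \<in> K" and vc: "v \<in> before A c" "v \<in> cyl A n y"
      by (auto simp: drop_last_def)
    have "snoc v c \<in> cyl A (Suc n) (snoc y c)"
      using snoc_cyl_iff[of v "snoc y c" n] vc yc by (auto simp: before_def snoc_Xneg)
    then have "snoc v c \<in> K"
      using Suc.prems(2)[of "snoc y c" "snoc v c"] snoc_before[OF yc(1) c] snoc_before[OF vc(1) c] yc by blast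
    then show "v \<in> drop_last c K" using vc by (simp add: drop_last_def)
  qed
  then show ?case by (subst (1 2) approx_content.simps(2)) (auto intro!: sum.cong)
qed

lemma approx_content_level:
  assumes x: "x \<in> Xpos A" and K: "level A m K" and mn: "m \<le> n"
  shows "approx_content n x K = approx_content m x K"
  using mn
proof (induction rule: dec_induct)
  case (step k)
  have "approx_content (Suc k) x K = approx_content k x K"
    using level_mono[OF K step(1)] by (intro approx_content_stable[OF x]) (auto simp: level_def)
  then show ?case using step by simp
qed simp

text \<open>The least level is only a canonical choice; by \<open>approx_content_level\<close> every
  level of K gives the same value.\<close>

definition content :: "(int \<Rightarrow> 's) \<Rightarrow> (int \<Rightarrow> 's) set \<Rightarrow> ennreal" where
  "content x K = approx_content (LEAST n. level A n K) x K"

lemma content_eq: "x \<in> Xpos A \<Longrightarrow> level A n K \<Longrightarrow> content x K = approx_content n x K"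
  unfolding content_def using approx_content_level[of x _ K n] by (metis LeastI Least_le)

text \<open>Appending c turns n agreeing letters into n + 1, more than K asks for. At least one
  letter is required to decide membership in \<open>before A c\<close>.\<close>

lemma level_drop_last:
  assumes "level A n K" "1 \<le> n" shows "level A n (drop_last c K)"
  unfolding level_def
proof (intro conjI ballI subsetI)
  fix y v assume y: "y \<in> drop_last c K" and v: "v \<in> cyl A n y"
  have yc: "y \<in> before A c" "snoc y c \<in> K" using y by (auto simp: drop_last_def)
  have vc: "v \<in> before A c" using v yc(1) assms(2) by (auto simp: before_def cyl_def)
  have "snoc v c \<in> cyl A (Suc n) (snoc y c)"
    using snoc_cyl_iff[of v "snoc y c" n] vc yc v by (auto simp: before_def snoc_Xneg)
  then have "snoc v c \<in> K"
    using level_mono[OF assms(1), of "Suc n"] yc(2) unfolding level_def by auto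
  then show "v \<in> drop_last c K" using vc by (simp add: drop_last_def)
qed (auto simp: drop_last_def before_def)

lemma content_Suc:
  assumes x: "x \<in> Xpos A" and K: "level A n K"
  shows "content x K = (\<Sum>c | A c (x 0) = 1. weight (cons c x) * content (cons c x) (drop_last c K))"
proof -
  have K1: "level A (Suc n) K" using K by (rule level_mono) simp
  \<comment> \<open>Depth n + 2 leaves n + 1 after one letter is removed, which is positive as
    \<open>level_drop_last\<close> requires.\<close>
  have K2: "level A (Suc (Suc n)) K" using K by (rule level_mono) simp
  have "content x K = approx_content (Suc (Suc n)) x K" using content_eq[OF x K2] .
  also have "\<dots> = (\<Sum>c | A c (x 0) = 1. weight (cons c x) * content (cons c x) (drop_last c K))"
    using x level_drop_last[OF K1] cons_Xpos[of x A]
    by (subst approx_content.simps(2)) (auto intro!: sum.cong simp: content_eq[of _ "Suc n"])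
  finally show ?thesis .
qed

lemma ring_level: "ring_of_sets (Xneg A) {K. \<exists>n. level A n K}"
proof (rule ring_of_setsI)
  show "{K. \<exists>n. level A n K} \<subseteq> Pow (Xneg A)" by (auto simp: level_def)
  show "{} \<in> {K. \<exists>n. level A n K}" by (auto simp: level_def)
  fix a b assume "a \<in> {K. \<exists>n. level A n K}" "b \<in> {K. \<exists>n. level A n K}"
  then obtain n m where "level A n a" "level A m b" by auto
  then have ab: "level A (max n m) a" "level A (max n m) b" by (auto intro: level_mono)
  show "a \<union> b \<in> {K. \<exists>n. level A n K}" using level_Un[OF ab] by blast
  show "a - b \<in> {K. \<exists>n. level A n K}" using level_Diff[OF ab] by blast
qed

lemma compact_before: "compactin (Tneg A) (before A b)"
proof -
  have "before A b = (\<Union>c\<in>{c. A c b = 1}. last_cyl A c)" by (auto simp: before_def last_cyl_def)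
  then show ?thesis using fin_pred compact_last_cyl by (auto intro!: compactin_Union)
qed

lemma content_cong:
  assumes x: "x \<in> Xpos A" and KL: "level A n K" "level A m L" "K \<inter> before A (x 0) = L \<inter> before A (x 0)"
  shows "content x K = content x L"
  using content_eq[OF x level_mono[OF KL(1), of "max n m"]] content_eq[OF x level_mono[OF KL(2), of "max n m"]]
    approx_content_cong[of K x L, OF KL(3)] by simp

lemma approx_content_empty: "approx_content n x {} = 0"
  by (induction n arbitrary: x) (auto simp: drop_last_def)

lemma level_empty: "level A n {}"
  by (simp add: level_def)

lemma content_empty: "x \<in> Xpos A \<Longrightarrow> content x {} = 0"
  using content_eq[OF _ level_empty] approx_content_empty by simp

lemma content_Union:
  assumes x: "x \<in> Xpos A" and L: "\<And>i. \<exists>n. level A n (L i)" and d: "disjoint_family L"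
  shows "(\<exists>n. level A n (\<Union>i<k. L i)) \<and> content x (\<Union>i<k::nat. L i) = (\<Sum>i<k. content x (L i))"
proof (induction k)
  case 0
  then show ?case using level_empty content_empty[OF x] by auto
next
  case (Suc k)
  then obtain n m where nm: "level A n (\<Union>i<k. L i)" "level A m (L k)" using L[of k] by auto
  then have l: "level A (max n m) (\<Union>i<k. L i)" "level A (max n m) (L k)" by (auto intro: level_mono)
  have un: "(\<Union>i<Suc k. L i) = (\<Union>i<k. L i) \<union> L k" by (auto simp: less_Suc_eq)
  have "(\<Union>i<k. L i) \<inter> L k = {}"
  proof -
    have "L i \<inter> L k = {}" if "i < k" for i using disjoint_family_onD[OF d, of i k] that by simp
    then show ?thesis by blast
  qed
  then have "content x (\<Union>i<Suc k. L i) = content x (\<Union>i<k. L i) + content x (L k)"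
    unfolding un content_eq[OF x level_Un[OF l]] content_eq[OF x l(1)] content_eq[OF x l(2)]
    by (rule approx_content_Un)
  then show ?case using Suc level_Un[OF l] unfolding un by auto
qed

text \<open>Only \<open>before A (x 0)\<close> is charged. It is compact and the \<open>L i\<close>
  are open, so finitely many of them cover its part of the union; by disjointness the others miss it
  and have content zero.\<close>

lemma content_countably_additive:
  assumes x: "x \<in> Xpos A"
  shows "countably_additive {K. \<exists>n. level A n K} (content x)"
  unfolding countably_additive_def
proof (intro allI impI)
  fix L :: "nat \<Rightarrow> (int \<Rightarrow> 's) set"
  assume "range L \<subseteq> {K. \<exists>n. level A n K}" and d: "disjoint_family L" and "(\<Union>i. L i) \<in> {K. \<exists>n. level A n K}"
  then have L: "\<And>i. \<exists>n. level A n (L i)" and U: "\<exists>n. level A n (\<Union>i. L i)" by auto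
  obtain N where N: "level A N (\<Union>i. L i)" using U by auto
  let ?K = "before A (x 0) \<inter> (\<Union>i. L i)"
  have "compactin (Tneg A) ?K"
    by (rule closed_compactin[OF compact_before _ closedin_Int[OF level_closedin[OF level_before] level_closedin[OF N]]]) auto
  then obtain \<F> where F: "finite \<F>" "\<F> \<subseteq> range L" "?K \<subseteq> \<Union>\<F>"
    using compactinD[of "Tneg A" ?K "range L"] L level_openin by (metis Int_lower2 imageE)
  then obtain I where I: "finite I" "\<F> = L ` I" by (metis finite_subset_image)
  define k where "k = Suc (Max (insert 0 I))"
  have Ik: "i < k" if "i \<in> I" for i using that I(1) by (simp add: k_def less_Suc_eq_le)
  have sub: "?K \<subseteq> (\<Union>i<k. L i)" using F(3) I(2) Ik by blast
  have zero: "content x (L i) = 0" if "i \<ge> k" for i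
  proof -
    have "L i \<inter> before A (x 0) = {}"
    proof (rule ccontr)
      assume "L i \<inter> before A (x 0) \<noteq> {}"
      then obtain y where y: "y \<in> L i" "y \<in> before A (x 0)" by auto
      then obtain j where "j < k" "y \<in> L j" using sub by auto
      then show False using disjoint_family_onD[OF d, of i j] y that by auto
    qed
    then have "L i \<inter> before A (x 0) = {} \<inter> before A (x 0)" by simp
    moreover obtain n where "level A n (L i)" using L by blast
    ultimately have "content x (L i) = content x {}"
      using content_cong[OF x _ level_empty] by blast
    then show ?thesis using content_empty[OF x] by simp
  qed
  have fin: "\<exists>n. level A n (\<Union>i<k. L i)" "content x (\<Union>i<k. L i) = (\<Sum>i<k. content x (L i))"
    using content_Union[OF x L d, of k] by auto
  have "(\<Union>i<k. L i) \<inter> before A (x 0) = (\<Union>i. L i) \<inter> before A (x 0)" using sub by blast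
  then have "content x (\<Union>i. L i) = content x (\<Union>i<k. L i)"
    using fin(1) N content_cong[OF x] by metis
  also have "\<dots> = (\<Sum>i. content x (L i))"
    using fin(2) zero by (subst suminf_finite[of "{..<k}"]) (auto simp: not_less)
  finally show "(\<Sum>i. content x (L i)) = content x (\<Union>i. L i)" by simp
qed

lemma sets_Bneg_level: "sets (Bneg A) = sigma_sets (Xneg A) {K. \<exists>n. level A n K}"
proof
  show "sets (Bneg A) \<subseteq> sigma_sets (Xneg A) {K. \<exists>n. level A n K}"
    unfolding sets_Bneg_cyl[OF cnt] cyl_family_def
    by (intro sigma_sets_mono') (use level_cyl level_empty in blast)
  show "sigma_sets (Xneg A) {K. \<exists>n. level A n K} \<subseteq> sets (Bneg A)"
    using sets.sigma_sets_subset[of "{K. \<exists>n. level A n K}" "Bneg A"] level_sets by auto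
qed

lemma exists_kernel:
  assumes x: "x \<in> Xpos A"
  shows "\<exists>M. sets M = sets (Bneg A) \<and> (\<forall>n K. level A n K \<longrightarrow> emeasure M K = content x K)"
proof -
  interpret ring_of_sets "Xneg A" "{K. \<exists>n. level A n K}" by (rule ring_level)
  have "positive {K. \<exists>n. level A n K} (content x)"
    using content_empty[OF x] by (simp add: positive_def)
  then obtain \<mu> where \<mu>: "\<And>K n. level A n K \<Longrightarrow> \<mu> K = content x K"
    "measure_space (Xneg A) (sigma_sets (Xneg A) {K. \<exists>n. level A n K}) \<mu>"
    using caratheodory'[OF _ content_countably_additive[OF x]] by blast
  let ?M = "measure_of (Xneg A) (sets (Bneg A)) \<mu>"
  have ms: "sigma_algebra (Xneg A) (sets (Bneg A))" "positive (sets (Bneg A)) \<mu>" "countably_additive (sets (Bneg A)) \<mu>"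
    using \<mu>(2) by (auto simp: measure_space_def sets_Bneg_level)
  have "sets ?M = sets (Bneg A)" using ms(1) by (simp add: sigma_algebra.sets_measure_of_eq)
  moreover have "emeasure ?M K = content x K" if "level A n K" for n K
    using emeasure_measure_of_sigma[OF ms level_sets[OF that]] \<mu>(1)[OF that] by simp
  ultimately show ?thesis by blast
qed

section \<open>The measures \<nu>_x of an eigenfunction\<close>

definition kernel :: "(int \<Rightarrow> 's) \<Rightarrow> (int \<Rightarrow> 's) measure" where
  "kernel x = (SOME M. sets M = sets (Bneg A) \<and> (\<forall>n K. level A n K \<longrightarrow> emeasure M K = content x K))"

lemma kernel:
  assumes "x \<in> Xpos A"
  shows "sets (kernel x) = sets (Bneg A)" "level A n K \<Longrightarrow> emeasure (kernel x) K = content x K"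
  using someI_ex[OF exists_kernel[OF assms]] unfolding kernel_def by auto

lemma kernel_Xneg: "x \<in> Xpos A \<Longrightarrow> emeasure (kernel x) (Xneg A) = ennreal (f x)"
  using kernel(2)[OF _ level_Xneg[of A 0]] content_eq[OF _ level_Xneg[of A 0]] pred_point[of "x 0"]
  by (simp add: before_def)

lemma kernel_before:
  assumes x: "x \<in> Xpos A" shows "AE y in kernel x. y \<in> before A (x 0)"
proof -
  have l: "level A (Suc 0) (Xneg A - before A (x 0))" by (rule level_Diff[OF level_Xneg level_before])
  have "emeasure (kernel x) (Xneg A - before A (x 0)) = content x {}"
    unfolding kernel(2)[OF x l] by (rule content_cong[OF x l level_empty[of 0]]) auto
  then have "AE y in kernel x. y \<notin> Xneg A - before A (x 0)"
    using AE_notin_iff[OF kernel(1)[OF x] level_sets[OF l]] content_empty[OF x] by simp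
  moreover have "AE y in kernel x. y \<in> Xneg A"
    using sets_eq_imp_space_eq[OF kernel(1)[OF x]] by (metis AE_space space_Bneg)
  ultimately show ?thesis by (auto elim: eventually_elim2)
qed

text \<open>On cylinders this is \<open>content_Suc\<close>, where intersecting with
  \<open>last_cyl A c\<close> leaves a single letter; uniqueness of finite measures extends it to
  all h.\<close>

lemma kernel_step:
  assumes x: "x \<in> Xpos A" and c: "A c (x 0) = 1" and h: "h \<in> borel_measurable (Bneg A)"
  shows "(\<integral>\<^sup>+y. indicator (last_cyl A c) y * h y \<partial>kernel x) = weight (cons c x) * (\<integral>\<^sup>+u. h (app A c u) \<partial>kernel (cons c x))"
proof -
  have x': "cons c x \<in> Xpos A" using x c by (intro cons_Xpos)
  note [measurable] = h
  note [measurable_cong, simp] = kernel(1)[OF x] kernel(1)[OF x']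
  define P where "P = density (kernel x) (indicator (last_cyl A c))"
  define Q where "Q = scale_measure (weight (cons c x)) (distr (kernel (cons c x)) (Bneg A) (app A c))"
  have "P = Q"
  proof (rule measure_eqI_cyl[OF cnt])
    show "sets P = sets (Bneg A)" "sets Q = sets (Bneg A)" by (simp_all add: P_def Q_def)
    have P: "emeasure P K = emeasure (kernel x) (last_cyl A c \<inter> K)" if "K \<in> sets (Bneg A)" for K
      using that by (simp add: P_def emeasure_restricted)
    have "emeasure (kernel x) (last_cyl A c \<inter> Xneg A) \<le> emeasure (kernel x) (Xneg A)"
      by (intro emeasure_mono) (auto simp: level_sets[OF level_Xneg])
    then show "emeasure P (Xneg A) \<noteq> \<infinity>"
      using P[OF level_sets[OF level_Xneg]] kernel_Xneg[OF x] by (auto simp: top_unique)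
    fix n y assume "y \<in> Xneg A"
    have l: "level A (Suc n) (last_cyl A c \<inter> cyl A n y)"
      using level_mono[OF level_last_cyl[of A c], of "Suc n"] level_mono[OF level_cyl[of A n y], of "Suc n"]
      by (rule level_Int) simp_all
    have "emeasure P (cyl A n y) = content x (last_cyl A c \<inter> cyl A n y)"
      by (simp add: P kernel(2)[OF x l])
    also have "\<dots> = (\<Sum>b | A b (x 0) = 1. if b = c then weight (cons c x) * content (cons c x) (drop_last c (last_cyl A c \<inter> cyl A n y)) else 0)"
      unfolding content_Suc[OF x l]
    proof (intro sum.cong refl)
      fix b assume b: "b \<in> {b. A b (x 0) = 1}"
      have "cons b x \<in> Xpos A" using x b by (intro cons_Xpos) auto
      moreover have "drop_last b (last_cyl A c \<inter> cyl A n y) = {}" if "b \<noteq> c"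
        using that by (auto simp: drop_last_def last_cyl_def)
      ultimately show "weight (cons b x) * content (cons b x) (drop_last b (last_cyl A c \<inter> cyl A n y)) =
        (if b = c then weight (cons c x) * content (cons c x) (drop_last c (last_cyl A c \<inter> cyl A n y)) else 0)"
        by (auto simp: content_empty)
    qed
    also have "\<dots> = weight (cons c x) * content (cons c x) (drop_last c (last_cyl A c \<inter> cyl A n y))"
      using c by (subst sum.delta[OF fin_pred]) simp
    also have "content (cons c x) (drop_last c (last_cyl A c \<inter> cyl A n y)) = emeasure (kernel (cons c x)) (drop_last c (last_cyl A c \<inter> cyl A n y))"
      by (rule kernel(2)[OF x' level_drop_last[OF l], symmetric]) simp
    \<comment> \<open>The two sets can differ only outside \<open>before A c\<close>, where
      \<open>app\<close> is the identity, and that region is null.\<close>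
    also have "\<dots> = emeasure (kernel (cons c x)) (app A c -` cyl A n y \<inter> Xneg A)"
    proof (rule emeasure_eq_AE)
      show "AE u in kernel (cons c x). (u \<in> drop_last c (last_cyl A c \<inter> cyl A n y)) = (u \<in> app A c -` cyl A n y \<inter> Xneg A)"
        using kernel_before[OF x'] unfolding cons_0
        by (elim eventually_mono) (auto simp: drop_last_def app_before last_cyl_def, auto simp: before_def snoc_Xneg)
      show "drop_last c (last_cyl A c \<inter> cyl A n y) \<in> sets (kernel (cons c x))"
        using level_sets[OF level_drop_last[OF l]] by simp
      show "app A c -` cyl A n y \<inter> Xneg A \<in> sets (kernel (cons c x))"
        using measurable_sets[OF app_measurable[of A c] cyl_sets[of A n y]] by simp
    qed
    also have "weight (cons c x) * \<dots> = emeasure Q (cyl A n y)"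
      using sets_eq_imp_space_eq[OF kernel(1)[OF x']] by (simp add: Q_def emeasure_distr)
    finally show "emeasure P (cyl A n y) = emeasure Q (cyl A n y)" .
  qed
  then have "(\<integral>\<^sup>+y. h y \<partial>P) = (\<integral>\<^sup>+y. h y \<partial>Q)" by simp
  then show ?thesis
    by (simp add: P_def Q_def nn_integral_density nn_integral_scale_measure nn_integral_distr)
qed

lemma kernel_family_kernel: "kernel_family kernel (\<lambda>x. ennreal (f x))"
  unfolding kernel_family_def
proof (intro ballI conjI allI impI)
  fix x c and h :: "_ \<Rightarrow> ennreal" assume x: "x \<in> Xpos A" and c: "A c (x 0) = 1" and h: "h \<in> borel_measurable (Bneg A)"
  have "ennreal lam * weight (cons c x) = ennreal (exp (\<phi> (cons c x)))"
    using lam by (simp add: weight_def flip: ennreal_mult')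
  then show "ennreal (exp (\<phi> (cons c x))) * (\<integral>\<^sup>+u. h (app A c u) \<partial>kernel (cons c x)) =
        ennreal lam * (\<integral>\<^sup>+y. indicator (last_cyl A c) y * h y \<partial>kernel x)"
    by (simp add: kernel_step[OF x c h] flip: mult.assoc)
qed (simp_all add: kernel kernel_Xneg kernel_before)

end

text \<open>The last n letters of y are moved in front of x, the final one first, so the result
  reads as the word followed by x; \<open>butlasts n y\<close> is what remains of y.\<close>

primrec join_seq :: "nat \<Rightarrow> (int \<Rightarrow> 's) \<Rightarrow> (int \<Rightarrow> 's) \<Rightarrow> (int \<Rightarrow> 's)" where
  "join_seq 0 y x = x"
| "join_seq (Suc n) y x = join_seq n (butlast_seq y) (cons (y 0) x)"

primrec butlasts :: "nat \<Rightarrow> (int \<Rightarrow> 's) \<Rightarrow> (int \<Rightarrow> 's)" where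
  "butlasts 0 y = y"
| "butlasts (Suc n) y = butlasts n (butlast_seq y)"

text \<open>The common prefix grows by one with each prepended letter, so the induction needs k
  general. It is used with k = 0, where agreement is asked only at the undefined negative
  indices.\<close>

lemma join_seq_agree:
  "(\<forall>i<k. x i = x' i) \<Longrightarrow> 0 \<le> k \<Longrightarrow> \<forall>i<k + int n. join_seq n y x i = join_seq n y x' i"
proof (induction n arbitrary: k x x' y)
  case (Suc n)
  have "\<forall>i<k + 1. cons (y 0) x i = cons (y 0) x' i"
    using Suc.prems by (auto simp: cons_def)
  then have "\<forall>i<k + 1 + int n. join_seq n (butlast_seq y) (cons (y 0) x) i = join_seq n (butlast_seq y) (cons (y 0) x') i"
    using Suc.prems by (intro Suc.IH) auto
  then show ?case by (simp add: ac_simps)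
qed simp

section \<open>Independence of x of the quotients \<nu>_x / \<chi>_x\<close>

context eigenfunction
begin

text \<open>The factor of a cylinder measure that does not depend on \<open>x\<close>.\<close>

primrec gibbs :: "nat \<Rightarrow> (int \<Rightarrow> 's) \<Rightarrow> real" where
  "gibbs 0 y = 1"
| "gibbs (Suc n) y = exp (\<phi>m y) / lam * gibbs n (butlast_seq y)"

lemma gibbs_pos: "gibbs n y > 0"
  using lam by (induction n arbitrary: y) auto

lemma join_seq_admissible:
  assumes "x \<in> Xpos A" "y \<in> Xneg A" "A (y 0) (x 0) = 1"
  shows "join_seq n y x \<in> Xpos A \<and> butlasts n y \<in> Xneg A \<and> A (butlasts n y 0) (join_seq n y x 0) = 1"
  using assms
proof (induction n arbitrary: x y)
  case (Suc n)
  have *: "cons (y 0) x \<in> Xpos A" "butlast_seq y \<in> Xneg A" "A (butlast_seq y 0) (cons (y 0) x 0) = 1"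
    using Suc.prems butlast_seq_Xneg[OF Suc.prems(2)] by (auto intro: cons_Xpos)
  then show ?case using Suc.IH[OF *] by simp
qed simp

lemmas join_seq_Xpos = join_seq_admissible[THEN conjunct1]
  join_seq_admissible[THEN conjunct2, THEN conjunct1] join_seq_admissible[THEN conjunct2, THEN conjunct2]

text \<open>Each peeling step trades \<phi> for \<phi>^- through \<open>chi_cons\<close>, so the
  factors \<chi> telescope. Apart from \<chi>_x(y), x survives only through
  \<open>join_seq n y x\<close>. The product form avoids dividing extended reals.\<close>

lemma kernel_cyl:
  assumes "x \<in> Xpos A" "y \<in> Xneg A" "A (y 0) (x 0) = 1"
  shows "emeasure (kernel x) (cyl A n y) * ennreal (ch (join_seq n y x) (butlasts n y)) =
    ennreal (ch x y * gibbs n y * f (join_seq n y x))"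
  using assms
proof (induction n arbitrary: x y)
  case 0
  then show ?case by (simp add: cyl_0 kernel_Xneg ennreal_mult' less_imp_le[OF f_pos] mult.commute)
next
  case (Suc n)
  let ?x = "cons (y 0) x" and ?y = "butlast_seq y"
  have *: "?x \<in> Xpos A" "?y \<in> Xneg A" "A (?y 0) (?x 0) = 1"
    using Suc.prems butlast_seq_Xneg[OF Suc.prems(2)] by (auto intro: cons_Xpos)
  have fj: "f (join_seq n ?y ?x) > 0" using join_seq_Xpos(1)[OF *] by (rule f_pos)
  have chi: "exp (\<phi> ?x) * ch ?x ?y = exp (\<phi>m y) * ch x y"
    using chi_cons[OF Suc.prems(1,3) *(2)] butlast_seq_Xneg(2)[OF Suc.prems(2)] snoc_butlast_seq[OF Suc.prems(2)] by simp
  have "ennreal lam * (emeasure (kernel x) (cyl A (Suc n) y) * ennreal (ch (join_seq (Suc n) y x) (butlasts (Suc n) y))) =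
      ennreal (exp (\<phi> ?x)) * (emeasure (kernel ?x) (cyl A n ?y) * ennreal (ch (join_seq n ?y ?x) (butlasts n ?y)))"
    using kernel_family_cyl_Suc[OF kernel_family_kernel Suc.prems, of n] by (simp flip: mult.assoc)
  also have "\<dots> = ennreal (exp (\<phi> ?x) * (ch ?x ?y * gibbs n ?y * f (join_seq n ?y ?x)))"
    unfolding Suc.IH[OF *] by (simp add: ennreal_mult')
  also have "exp (\<phi> ?x) * (ch ?x ?y * gibbs n ?y * f (join_seq n ?y ?x)) =
      lam * (ch x y * gibbs (Suc n) y * f (join_seq (Suc n) y x))"
    using chi lam by (simp flip: mult.assoc)
  also have "ennreal \<dots> = ennreal lam * ennreal (ch x y * gibbs (Suc n) y * f (join_seq (Suc n) y x))"
    by (rule ennreal_mult') (use lam in simp)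
  finally show ?case using lam by (simp add: ennreal_mult_cancel_left)
qed

text \<open>Here \<open>inverse 0 = 0\<close>, but \<open>kernel x\<close> does not charge the zero set of \<open>ch x\<close>.\<close>

definition tilt :: "(int \<Rightarrow> 's) \<Rightarrow> (int \<Rightarrow> 's) measure" where
  "tilt x = density (kernel x) (\<lambda>y. ennreal (inverse (ch x y)))"

lemma sets_tilt: "x \<in> Xpos A \<Longrightarrow> sets (tilt x) = sets (Bneg A)"
  by (simp add: tilt_def kernel)

text \<open>V is the mass the cylinder would have if \<chi>_x were constant on it: \<nu>_x gives it
  mass \<chi>_x(y) V, to be divided by \<chi>_x(y). The oscillation of \<chi>_x costs at most a
  factor exp \<epsilon> either way.\<close>

lemma tilt_cyl_bounds:
  assumes x: "x \<in> Xpos A" and y: "y \<in> Xneg A" "A (y 0) (x 0) = 1" and "1 \<le> n"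
    and close: "\<And>u v. u \<in> cyl A n y \<Longrightarrow> v \<in> cyl A n y \<Longrightarrow> ch x u \<le> exp \<epsilon> * ch x v"
  defines "V \<equiv> gibbs n y * f (join_seq n y x) / ch (join_seq n y x) (butlasts n y)"
  shows "ennreal (exp (- \<epsilon>) * V) \<le> emeasure (tilt x) (cyl A n y)"
    and "emeasure (tilt x) (cyl A n y) \<le> ennreal (exp \<epsilon> * V)"
proof -
  note [measurable_cong, simp] = kernel(1)[OF x]
  note [measurable] = chi_measurable[OF x]
  let ?j = "ch (join_seq n y x) (butlasts n y)"
  have j: "?j > 0" using join_seq_Xpos(3)[OF x y] by (rule chi_pos)
  have chy: "ch x y > 0" using y(2) by (rule chi_pos)
  have V0: "V \<ge> 0"
    using gibbs_pos[of n y] f_pos[OF join_seq_Xpos(1)[OF x y, of n]] j by (simp add: V_def less_imp_le)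
  have k: "emeasure (kernel x) (cyl A n y) = ennreal (ch x y * V)"
  proof -
    have "emeasure (kernel x) (cyl A n y) * ennreal ?j = ennreal (ch x y * V) * ennreal ?j"
    proof -
      have "ch x y * gibbs n y * f (join_seq n y x) = (ch x y * V) * ?j" using j by (simp add: V_def)
      moreover have "0 \<le> ch x y * V" using V0 by simp
      ultimately show ?thesis unfolding kernel_cyl[OF x y] by (simp only: ennreal_mult')
    qed
    then have "ennreal ?j * emeasure (kernel x) (cyl A n y) = ennreal ?j * ennreal (ch x y * V)"
      by (simp only: mult.commute)
    then show ?thesis using j by (simp add: ennreal_mult_cancel_left)
  qed
  have pos: "ch x u > 0" if "u \<in> cyl A n y" for u
    using that y(2) \<open>1 \<le> n\<close> by (intro chi_pos) (simp add: cyl_def)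
  have t: "emeasure (tilt x) (cyl A n y) = (\<integral>\<^sup>+u. ennreal (inverse (ch x u)) * indicator (cyl A n y) u \<partial>kernel x)"
    unfolding tilt_def by (simp add: emeasure_density)
  have yc: "y \<in> cyl A n y" using y(1) by (rule cyl_self)
  have "(\<integral>\<^sup>+u. ennreal (inverse (ch x u)) * indicator (cyl A n y) u \<partial>kernel x) \<le>
      (\<integral>\<^sup>+u. ennreal (exp \<epsilon> / ch x y) * indicator (cyl A n y) u \<partial>kernel x)"
  proof (intro nn_integral_mono)
    fix u
    show "ennreal (inverse (ch x u)) * indicator (cyl A n y) u \<le> ennreal (exp \<epsilon> / ch x y) * indicator (cyl A n y) u"
      using close[OF yc, of u] pos[of u] chy by (auto simp: indicator_def field_simps intro!: ennreal_leI)
  qed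
  also have "\<dots> = ennreal (exp \<epsilon> / ch x y) * ennreal (ch x y * V)"
    by (simp add: nn_integral_cmult k)
  also have "\<dots> = ennreal (exp \<epsilon> * V)" using chy V0 by (simp flip: ennreal_mult')
  finally show "emeasure (tilt x) (cyl A n y) \<le> ennreal (exp \<epsilon> * V)" by (simp add: t)
  have "ennreal (exp (- \<epsilon>) * V) = ennreal (exp (- \<epsilon>) / ch x y) * ennreal (ch x y * V)"
    using chy V0 by (simp flip: ennreal_mult')
  also have "\<dots> = (\<integral>\<^sup>+u. ennreal (exp (- \<epsilon>) / ch x y) * indicator (cyl A n y) u \<partial>kernel x)"
    by (simp add: nn_integral_cmult k)
  also have "\<dots> \<le> (\<integral>\<^sup>+u. ennreal (inverse (ch x u)) * indicator (cyl A n y) u \<partial>kernel x)"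
  proof (intro nn_integral_mono)
    fix u
    show "ennreal (exp (- \<epsilon>) / ch x y) * indicator (cyl A n y) u \<le> ennreal (inverse (ch x u)) * indicator (cyl A n y) u"
      using close[OF _ yc, of u] pos[of u] chy by (auto simp: indicator_def field_simps exp_minus intro!: ennreal_leI)
  qed
  finally show "ennreal (exp (- \<epsilon>) * V) \<le> emeasure (tilt x) (cyl A n y)" by (simp add: t)
qed

text \<open>Two of the four \<epsilon> come from replacing the cylinder masses by V for x and for
  x', one from f and one from \<chi> at the two joined points, which share n letters.\<close>

lemma tilt_close:
  assumes x: "x \<in> Xpos A" "A c (x 0) = 1" and x': "x' \<in> Xpos A" "A c (x' 0) = 1" and \<epsilon>: "\<epsilon> > 0"
  shows "\<exists>n0. \<forall>n\<ge>n0. \<forall>y\<in>last_cyl A c.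
    emeasure (tilt x) (cyl A n y) < \<infinity> \<and>
    emeasure (tilt x) (cyl A n y) \<le> ennreal (exp (4 * \<epsilon>)) * emeasure (tilt x') (cyl A n y)"
proof -
  obtain N where N: "N \<ge> 1" "\<And>x x' y y'. x \<in> Xpos A \<Longrightarrow> x' \<in> Xpos A \<Longrightarrow> y \<in> Xneg A \<Longrightarrow> y' \<in> Xneg A \<Longrightarrow>
    (\<forall>i<int N. x i = x' i) \<Longrightarrow> (\<forall>i>- int N. y i = y' i) \<Longrightarrow> ch x y \<le> exp \<epsilon> * ch x' y'"
    using chi_close[OF \<epsilon>] by metis
  have "uniformly_continuous_map (shift_metric A {0..}) euclidean_metric (\<lambda>x. ln (f x))"
    using f by (simp add: eigenfunctions_def)
  then obtain K :: nat where K: "\<And>u v. u \<in> Xpos A \<Longrightarrow> v \<in> Xpos A \<Longrightarrow> (\<forall>i. \<bar>i\<bar> \<le> int K \<longrightarrow> u i = v i) \<Longrightarrow>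
      \<bar>ln (f u) - ln (f v)\<bar> < \<epsilon>"
    unfolding uniformly_continuous_shift_iff using \<epsilon> by metis
  show ?thesis
  \<comment> \<open>Agreement at the indices below n must contain the window up to K, hence
    \<open>Suc K\<close>.\<close>
  proof (intro exI[of _ "max N (Suc K)"] allI impI ballI)
    fix n y assume n: "max N (Suc K) \<le> n" and "y \<in> last_cyl A c"
    then have y: "y \<in> Xneg A" "y 0 = c" and n1: "1 \<le> n" by (auto simp: last_cyl_def)
    have ax: "A (y 0) (x 0) = 1" "A (y 0) (x' 0) = 1" using x x' y by auto
    have close: "ch z u \<le> exp \<epsilon> * ch z v" if "z \<in> Xpos A" "u \<in> cyl A n y" "v \<in> cyl A n y" for z u v
      using that n by (intro N(2)) (auto simp: cyl_def)
    let ?j = "join_seq n y x" and ?j' = "join_seq n y x'" and ?b = "butlasts n y"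
    have j: "?j \<in> Xpos A" "?j' \<in> Xpos A" "?b \<in> Xneg A" "A (?b 0) (?j 0) = 1" "A (?b 0) (?j' 0) = 1"
      using join_seq_Xpos[OF x(1) y(1) ax(1)] join_seq_Xpos[OF x'(1) y(1) ax(2)] by auto
    have "\<forall>i<0. x i = x' i" using x x' by (simp add: Xpos_iff)
    then have agree: "\<forall>i<int n. ?j i = ?j' i" using join_seq_agree[of 0 x x' n y] by simp
    have fj: "f ?j \<le> exp \<epsilon> * f ?j'"
    proof -
      have "\<bar>ln (f ?j) - ln (f ?j')\<bar> < \<epsilon>" using agree n by (intro K j) auto
      then have "ln (f ?j) \<le> \<epsilon> + ln (f ?j')" by linarith
      then have "exp (ln (f ?j)) \<le> exp (\<epsilon> + ln (f ?j'))" by simp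
      then show ?thesis using f_pos[OF j(1)] f_pos[OF j(2)] by (simp add: exp_add)
    qed
    have chj: "ch ?j' ?b \<le> exp \<epsilon> * ch ?j ?b" using agree n by (intro N(2) j) auto
    have p: "f ?j > 0" "f ?j' > 0" "ch ?j ?b > 0" "ch ?j' ?b > 0" "gibbs n y > 0"
      using j by (auto intro: f_pos chi_pos gibbs_pos)
    have le: "exp \<epsilon> * (gibbs n y * f ?j / ch ?j ?b) \<le> exp (4 * \<epsilon>) * (exp (- \<epsilon>) * (gibbs n y * f ?j' / ch ?j' ?b))"
    proof -
      have "f ?j / ch ?j ?b \<le> (exp \<epsilon> * f ?j') / (ch ?j' ?b / exp \<epsilon>)"
        using fj chj p by (intro frac_le) (auto simp: field_simps)
      also have "\<dots> = exp (2 * \<epsilon>) * (f ?j' / ch ?j' ?b)" by (simp add: exp_double power2_eq_square)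
      finally have "exp \<epsilon> * gibbs n y * (f ?j / ch ?j ?b) \<le> exp \<epsilon> * gibbs n y * (exp (2 * \<epsilon>) * (f ?j' / ch ?j' ?b))"
        using p by (intro mult_left_mono) auto
      also have "\<dots> = exp (\<epsilon> + 2 * \<epsilon>) * (gibbs n y * f ?j' / ch ?j' ?b)" unfolding exp_add by simp
      also have "exp (\<epsilon> + 2 * \<epsilon>) = exp (4 * \<epsilon>) * exp (- \<epsilon>)" by (simp flip: exp_add)
      finally show ?thesis by (simp add: mult.assoc)
    qed
    have up: "emeasure (tilt x) (cyl A n y) \<le> ennreal (exp \<epsilon> * (gibbs n y * f ?j / ch ?j ?b))"
      by (rule tilt_cyl_bounds(2)[OF x(1) y(1) ax(1) n1 close[OF x(1)]])
    also have "\<dots> \<le> ennreal (exp (4 * \<epsilon>) * (exp (- \<epsilon>) * (gibbs n y * f ?j' / ch ?j' ?b)))"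
      using le by (rule ennreal_leI)
    also have "\<dots> = ennreal (exp (4 * \<epsilon>)) * ennreal (exp (- \<epsilon>) * (gibbs n y * f ?j' / ch ?j' ?b))"
      by (rule ennreal_mult') simp
    also have "\<dots> \<le> ennreal (exp (4 * \<epsilon>)) * emeasure (tilt x') (cyl A n y)"
      by (intro mult_left_mono tilt_cyl_bounds(1)[OF x'(1) y(1) ax(2) n1 close[OF x'(1)]]) simp_all
    finally show "emeasure (tilt x) (cyl A n y) < \<infinity> \<and>
        emeasure (tilt x) (cyl A n y) \<le> ennreal (exp (4 * \<epsilon>)) * emeasure (tilt x') (cyl A n y)"
      using up by (auto simp: less_top[symmetric] top_unique)
  qed
qed

lemma emeasure_Union_disjoint:
  assumes "sets M = sets (Bneg A)" "finite \<C>" "disjoint \<C>" "\<And>C. C \<in> \<C> \<Longrightarrow> C \<in> sets (Bneg A)"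
  shows "emeasure M (\<Union>\<C>) = (\<Sum>C\<in>\<C>. emeasure M C)"
proof -
  have "(\<lambda>C. C) ` \<C> \<subseteq> sets M" using assms(1,4) by auto
  moreover have "disjoint_family_on (\<lambda>C. C) \<C>"
    using assms(3) by (auto simp: disjoint_family_on_def disjoint_def)
  ultimately show ?thesis using sum_emeasure[of "\<lambda>C. C" \<C> M] assms(2) by simp
qed

lemma tilt_cyl_finite:
  assumes x: "x \<in> Xpos A" "A c (x 0) = 1" and m: "1 \<le> m" and y: "y \<in> last_cyl A c"
  shows "emeasure (tilt x) (cyl A m y) < \<infinity>"
proof -
  \<comment> \<open>Comparing x with itself, at \<epsilon> = 1, yields finiteness on long
    cylinders.\<close>
  obtain n0 where n0: "\<And>n y. n0 \<le> n \<Longrightarrow> y \<in> last_cyl A c \<Longrightarrow> emeasure (tilt x) (cyl A n y) < \<infinity>"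
    using tilt_close[OF x x zero_less_one] by blast
  show ?thesis
  proof (rule cyl_refine_induct[where P = "\<lambda>C. emeasure (tilt x) C < \<infinity>" and n = "max m n0" and c = c])
    fix \<C> :: "(int \<Rightarrow> 's) set set"
    assume \<C>: "finite \<C>" "disjoint \<C>" "\<And>C. C \<in> \<C> \<Longrightarrow> C \<in> sets (Bneg A) \<and> emeasure (tilt x) C < \<infinity>"
    then have "emeasure (tilt x) (\<Union>\<C>) = (\<Sum>C\<in>\<C>. emeasure (tilt x) C)"
      by (intro emeasure_Union_disjoint sets_tilt x) auto
    then show "emeasure (tilt x) (\<Union>\<C>) < \<infinity>" using \<C> by simp
  qed (use n0 m y in auto)
qed

text \<open>For fixed \<epsilon> the bound on long cylinders descends to the given one. The length
  required depends on \<epsilon> but the given cylinder does not, so \<epsilon> may tend to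
  0.\<close>

lemma tilt_cyl_le:
  assumes x: "x \<in> Xpos A" "A c (x 0) = 1" and x': "x' \<in> Xpos A" "A c (x' 0) = 1"
    and m: "1 \<le> m" and y: "y \<in> last_cyl A c"
  shows "emeasure (tilt x) (cyl A m y) \<le> emeasure (tilt x') (cyl A m y)"
proof -
  have le: "emeasure (tilt x) (cyl A m y) \<le> ennreal (exp (4 * \<epsilon>)) * emeasure (tilt x') (cyl A m y)"
    if eps: "\<epsilon> > 0" for \<epsilon>
  proof -
    obtain n0 where n0: "\<And>n y. n0 \<le> n \<Longrightarrow> y \<in> last_cyl A c \<Longrightarrow>
        emeasure (tilt x) (cyl A n y) \<le> ennreal (exp (4 * \<epsilon>)) * emeasure (tilt x') (cyl A n y)"
      using tilt_close[OF x x' eps] by blast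
    show ?thesis
    proof (rule cyl_refine_induct[where P = "\<lambda>C. emeasure (tilt x) C \<le> ennreal (exp (4 * \<epsilon>)) * emeasure (tilt x') C"
          and n = "max m n0" and c = c])
      fix \<C> :: "(int \<Rightarrow> 's) set set"
      assume \<C>: "finite \<C>" "disjoint \<C>" "\<And>C. C \<in> \<C> \<Longrightarrow> C \<in> sets (Bneg A) \<and>
        emeasure (tilt x) C \<le> ennreal (exp (4 * \<epsilon>)) * emeasure (tilt x') C"
      then have "emeasure (tilt x) (\<Union>\<C>) = (\<Sum>C\<in>\<C>. emeasure (tilt x) C)"
        "emeasure (tilt x') (\<Union>\<C>) = (\<Sum>C\<in>\<C>. emeasure (tilt x') C)"
        by (auto intro!: emeasure_Union_disjoint sets_tilt x x')
      then show "emeasure (tilt x) (\<Union>\<C>) \<le> ennreal (exp (4 * \<epsilon>)) * emeasure (tilt x') (\<Union>\<C>)"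
        using \<C> by (simp add: sum_distrib_left sum_mono)
    qed (use n0 m y in auto)
  qed
  \<comment> \<open>Finiteness on both sides lets the limit be taken among real numbers.\<close>
  obtain r where r: "r \<ge> 0" "emeasure (tilt x') (cyl A m y) = ennreal r"
    using tilt_cyl_finite[OF x' m y] by (metis ennreal_cases less_irrefl infinity_ennreal_def)
  obtain s where s: "s \<ge> 0" "emeasure (tilt x) (cyl A m y) = ennreal s"
    using tilt_cyl_finite[OF x m y] by (metis ennreal_cases less_irrefl infinity_ennreal_def)
  have *: "s \<le> exp (4 * \<epsilon>) * r" if "\<epsilon> > 0" for \<epsilon>
    using le[OF that] r s by (simp flip: ennreal_mult')
  have "((\<lambda>\<epsilon>. exp (4 * \<epsilon>) * r) \<longlongrightarrow> exp (4 * 0) * r) (at_right 0)"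
    by (intro tendsto_intros)
  moreover have "\<forall>\<^sub>F \<epsilon> in at_right 0. s \<le> exp (4 * \<epsilon>) * r"
    using eventually_at_right_less[of 0] by (rule eventually_mono) (rule *)
  ultimately have "s \<le> exp (4 * 0) * r"
    by (rule tendsto_lowerbound) simp
  then show ?thesis using r s by (simp add: ennreal_leI)
qed

text \<open>Exchanging x and x' in \<open>tilt_cyl_le\<close> gives equality on cylinders. The
  restrictions to \<open>last_cyl A c\<close> are finite, so they agree on all Borel sets, and the
  local quotients can be glued.\<close>

lemma tilt_consistent:
  assumes x: "x \<in> Xpos A" "A c (x 0) = 1" and x': "x' \<in> Xpos A" "A c (x' 0) = 1"
    and B: "B \<in> sets (Bneg A)"
  shows "emeasure (tilt x) (last_cyl A c \<inter> B) = emeasure (tilt x') (last_cyl A c \<inter> B)"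
proof -
  note [measurable_cong, simp] = sets_tilt[OF x(1)] sets_tilt[OF x'(1)]
  have cyl: "emeasure (tilt x) (cyl A m y) = emeasure (tilt x') (cyl A m y)" if "1 \<le> m" "y \<in> last_cyl A c" for m y
    using tilt_cyl_le[OF x x' that] tilt_cyl_le[OF x' x that] by (rule antisym)
  have last: "\<exists>y. y \<in> last_cyl A c \<and> last_cyl A c = cyl A (Suc 0) y"
  proof -
    obtain b where b: "A c b = 1" using succ_ex by blast
    obtain y where "y \<in> Xneg A" "A (y 0) c = 1" using exists_Xneg by blast
    then have "snoc y c \<in> last_cyl A c" by (simp add: last_cyl_def snoc_Xneg)
    moreover from this have "last_cyl A c = cyl A (Suc 0) (snoc y c)"
      using last_cyl_eq[of "snoc y c" A] by (simp add: last_cyl_def)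
    ultimately show ?thesis by blast
  qed
  let ?D = "\<lambda>x. density (tilt x) (indicator (last_cyl A c))"
  have D: "emeasure (?D z) K = emeasure (tilt z) (last_cyl A c \<inter> K)"
    if "K \<in> sets (Bneg A)" "sets (tilt z) = sets (Bneg A)" for z K
    using that by (simp add: emeasure_restricted)
  have "?D x = ?D x'"
  proof (rule measure_eqI_cyl[OF cnt])
    fix n y assume y: "y \<in> Xneg A"
    show "emeasure (?D x) (cyl A n y) = emeasure (?D x') (cyl A n y)"
    \<comment> \<open>The empty word is reduced to the one-letter cylinder, since the estimates
      concern nonempty words.\<close>
    proof (cases "n = 0")
      case True
      then have "last_cyl A c \<inter> cyl A n y = last_cyl A c" using y by (auto simp: cyl_0 last_cyl_def)
      then show ?thesis using last cyl[of "Suc 0"] by (auto simp: D)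
    next
      case False
      then have n: "1 \<le> n" by simp
      show ?thesis
      proof (cases "y 0 = c")
        case True
        then have "last_cyl A c \<inter> cyl A n y = cyl A n y" using cyl_sub_last[OF n, of A y] by auto
        moreover have "y \<in> last_cyl A c" using y True by (simp add: last_cyl_def)
        ultimately show ?thesis using cyl[OF n, of y] by (simp add: D)
      next
        case False
        then have "last_cyl A c \<inter> cyl A n y = {}" using cyl_sub_last[OF n, of A y] by (auto simp: last_cyl_def)
        then show ?thesis by (simp add: D)
      qed
    qed
  next
    obtain y where y: "y \<in> last_cyl A c" "last_cyl A c = cyl A (Suc 0) y" using last by auto
    have "last_cyl A c \<inter> Xneg A = cyl A (Suc 0) y" using y(2) by (auto simp: last_cyl_def)
    then show "emeasure (?D x) (Xneg A) \<noteq> \<infinity>"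
      using tilt_cyl_finite[OF x _ y(1), of "Suc 0"] by (simp add: D level_sets[OF level_Xneg] less_top[symmetric])
  qed simp_all
  then show ?thesis using D[OF B, of x] D[OF B, of x'] by simp
qed

section \<open>Gluing the quotients to one conformal measure\<close>

definition succ_point :: "'s \<Rightarrow> int \<Rightarrow> 's" where
  "succ_point c = (SOME x. x \<in> Xpos A \<and> A c (x 0) = 1)"

lemma succ_point: "succ_point c \<in> Xpos A" "A c (succ_point c 0) = 1"
  using someI_ex[of "\<lambda>x. x \<in> Xpos A \<and> A c (x 0) = 1"] exists_Xpos[of c] unfolding succ_point_def by blast+

text \<open>On the piece with last letter c the measure is \<nu>_x / \<chi>_x for one chosen x that
  may follow c; \<open>tilt_consistent\<close> makes the choice immaterial. The counting integral
  sums the pieces and allows infinite total mass.\<close>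

definition eig_measure :: "(int \<Rightarrow> 's) measure" where
  "eig_measure = measure_of (Xneg A) (sets (Bneg A))
     (\<lambda>B. \<integral>\<^sup>+c. emeasure (tilt (succ_point c)) (last_cyl A c \<inter> B) \<partial>count_space UNIV)"

lemma sets_eig_measure [simp]: "sets eig_measure = sets (Bneg A)"
  unfolding eig_measure_def
  using sets.sigma_algebra_axioms[of "Bneg A"] by (simp add: sigma_algebra.sets_measure_of_eq)

lemma space_eig_measure [simp]: "space eig_measure = Xneg A"
  using sets_eq_imp_space_eq[OF sets_eig_measure] by simp

lemma emeasure_eig_measure:
  assumes "B \<in> sets (Bneg A)"
  shows "emeasure eig_measure B = (\<integral>\<^sup>+c. emeasure (tilt (succ_point c)) (last_cyl A c \<inter> B) \<partial>count_space UNIV)"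
  unfolding eig_measure_def
proof (rule emeasure_measure_of_sigma)
  show "sigma_algebra (Xneg A) (sets (Bneg A))" using sets.sigma_algebra_axioms[of "Bneg A"] by simp
  show "countably_additive (sets (Bneg A)) (\<lambda>B. \<integral>\<^sup>+c. emeasure (tilt (succ_point c)) (last_cyl A c \<inter> B) \<partial>count_space UNIV)"
    unfolding countably_additive_def
  proof (intro allI impI)
    fix L :: "nat \<Rightarrow> (int \<Rightarrow> 's) set"
    assume L: "range L \<subseteq> sets (Bneg A)" "disjoint_family L"
    have "(\<Sum>i. emeasure (tilt (succ_point c)) (last_cyl A c \<inter> L i)) = emeasure (tilt (succ_point c)) (last_cyl A c \<inter> (\<Union>i. L i))" for c
    proof -
      have "(\<Sum>i. emeasure (tilt (succ_point c)) (last_cyl A c \<inter> L i)) = emeasure (tilt (succ_point c)) (\<Union>i. last_cyl A c \<inter> L i)"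
        using L by (intro suminf_emeasure) (auto simp: sets_tilt succ_point disjoint_family_on_def)
      then show ?thesis by simp
    qed
    then show "(\<Sum>i. \<integral>\<^sup>+c. emeasure (tilt (succ_point c)) (last_cyl A c \<inter> L i) \<partial>count_space UNIV) =
        (\<integral>\<^sup>+c. emeasure (tilt (succ_point c)) (last_cyl A c \<inter> (\<Union>i. L i)) \<partial>count_space UNIV)"
      by (subst nn_integral_suminf[symmetric]) simp_all
  qed
qed (use assms in \<open>simp_all add: positive_def\<close>)

lemma eig_measure_last_cyl:
  assumes x: "x \<in> Xpos A" "A c (x 0) = 1" and B: "B \<in> sets (Bneg A)"
  shows "emeasure eig_measure (last_cyl A c \<inter> B) = emeasure (tilt x) (last_cyl A c \<inter> B)"
proof -
  have "emeasure eig_measure (last_cyl A c \<inter> B) =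
      (\<integral>\<^sup>+b. emeasure (tilt (succ_point b)) (last_cyl A b \<inter> (last_cyl A c \<inter> B)) \<partial>count_space UNIV)"
    using B by (intro emeasure_eig_measure) simp
  also have "\<dots> = (\<Sum>b\<in>{c}. emeasure (tilt (succ_point b)) (last_cyl A b \<inter> (last_cyl A c \<inter> B)))"
  proof (rule nn_integral_count_space')
    fix b assume "b \<notin> {c}"
    then have "last_cyl A b \<inter> (last_cyl A c \<inter> B) = {}" by (auto simp: last_cyl_def)
    then show "emeasure (tilt (succ_point b)) (last_cyl A b \<inter> (last_cyl A c \<inter> B)) = 0" by simp
  qed auto
  also have "\<dots> = emeasure (tilt (succ_point c)) (last_cyl A c \<inter> B)" by simp
  also have "\<dots> = emeasure (tilt x) (last_cyl A c \<inter> B)"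
    by (rule tilt_consistent[OF succ_point x B])
  finally show ?thesis .
qed

lemma nn_integral_eig_measure_last_cyl:
  assumes x: "x \<in> Xpos A" "A c (x 0) = 1" and h: "h \<in> borel_measurable (Bneg A)"
  shows "(\<integral>\<^sup>+y. indicator (last_cyl A c) y * h y \<partial>eig_measure) =
    (\<integral>\<^sup>+y. indicator (last_cyl A c) y * (h y * ennreal (inverse (ch x y))) \<partial>kernel x)"
proof -
  note [measurable_cong, simp] = sets_eig_measure kernel(1)[OF x(1)] sets_tilt[OF x(1)]
  note [measurable] = h chi_measurable[OF x(1)]
  have "density eig_measure (indicator (last_cyl A c)) = density (tilt x) (indicator (last_cyl A c))"
    by (rule measure_eqI) (simp_all add: emeasure_restricted eig_measure_last_cyl[OF x])
  then have "(\<integral>\<^sup>+y. h y \<partial>density eig_measure (indicator (last_cyl A c))) =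
      (\<integral>\<^sup>+y. h y \<partial>density (tilt x) (indicator (last_cyl A c)))" by simp
  then have "(\<integral>\<^sup>+y. indicator (last_cyl A c) y * h y \<partial>eig_measure) = (\<integral>\<^sup>+y. indicator (last_cyl A c) y * h y \<partial>tilt x)"
    by (simp add: nn_integral_density)
  also have "\<dots> = (\<integral>\<^sup>+y. indicator (last_cyl A c) y * (h y * ennreal (inverse (ch x y))) \<partial>kernel x)"
    unfolding tilt_def by (simp add: nn_integral_density ac_simps)
  finally show ?thesis .
qed

text \<open>All letters c in the finite sum may precede the same x, so a single kernel serves for
  every piece.\<close>

lemma nn_integral_eig_measure_before:
  assumes x: "x \<in> Xpos A" and h: "h \<in> borel_measurable (Bneg A)"
  shows "(\<integral>\<^sup>+y. indicator (before A (x 0)) y * h y \<partial>eig_measure) =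
    (\<integral>\<^sup>+y. h y * ennreal (inverse (ch x y)) \<partial>kernel x)"
proof -
  note [measurable] = h chi_measurable[OF x]
  have "(\<integral>\<^sup>+y. indicator (before A (x 0)) y * h y \<partial>eig_measure) =
      (\<Sum>c | A c (x 0) = 1. \<integral>\<^sup>+y. indicator (last_cyl A c) y * h y \<partial>eig_measure)"
    by (rule nn_integral_before[OF sets_eig_measure h])
  also have "\<dots> = (\<Sum>c | A c (x 0) = 1. \<integral>\<^sup>+y. indicator (last_cyl A c) y * (h y * ennreal (inverse (ch x y))) \<partial>kernel x)"
    by (intro sum.cong refl nn_integral_eig_measure_last_cyl x h) auto
  also have "\<dots> = (\<integral>\<^sup>+y. indicator (before A (x 0)) y * (h y * ennreal (inverse (ch x y))) \<partial>kernel x)"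
    by (rule nn_integral_before[symmetric]) (use kernel(1)[OF x] in \<open>simp_all\<close>)
  also have "\<dots> = (\<integral>\<^sup>+y. h y * ennreal (inverse (ch x y)) \<partial>kernel x)"
    using kernel_before[OF x] by (intro nn_integral_cong_AE) (auto elim!: eventually_mono)
  finally show ?thesis .
qed

text \<open>With x following c and x' = c x, the kernel at x' is carried by
  \<open>before A c\<close>. \<open>chi_cons\<close>, read for reciprocals, turns the quotient at x'
  into that at x, and the recursion becomes \<open>transfers\<close>.\<close>

lemma finite_transfers_eig_measure: "finite_transfers eig_measure"
  unfolding finite_transfers_def transfers_def
proof (intro conjI allI ballI)
  show "sets eig_measure = sets (Bneg A)" by simp
next
  fix c
  obtain y where "y \<in> Xneg A" "A (y 0) c = 1" using exists_Xneg by blast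
  then have "snoc y c \<in> last_cyl A c" by (simp add: last_cyl_def snoc_Xneg)
  moreover then have "last_cyl A c = cyl A (Suc 0) (snoc y c)"
    using last_cyl_eq[of "snoc y c" A] by (simp add: last_cyl_def)
  ultimately show "emeasure eig_measure (last_cyl A c) < \<infinity>"
    using eig_measure_last_cyl[OF succ_point, of "last_cyl A c" c]
      tilt_cyl_finite[OF succ_point, of "Suc 0" "snoc y c" c] by simp
next
  fix c and g :: "_ \<Rightarrow> ennreal" assume g [measurable]: "g \<in> borel_measurable (Bneg A)"
  let ?x = "succ_point c"
  let ?x' = "cons c ?x"
  have x': "?x' \<in> Xpos A" using succ_point by (intro cons_Xpos)
  note [measurable] = chi_measurable[OF x'] chi_measurable[OF succ_point(1)]
  note [measurable_cong, simp] = kernel(1)[OF x']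
  have "(\<integral>\<^sup>+u. indicator (before A c) u * ennreal (exp (\<phi>m (app A c u))) * g (app A c u) \<partial>eig_measure) =
    (\<integral>\<^sup>+u. ennreal (exp (\<phi>m (app A c u))) * g (app A c u) * ennreal (inverse (ch ?x' u)) \<partial>kernel ?x')"
    using nn_integral_eig_measure_before[OF x', of "\<lambda>u. ennreal (exp (\<phi>m (app A c u))) * g (app A c u)"]
    by (simp add: mult.assoc)
  also have "\<dots> = (\<integral>\<^sup>+u. ennreal (exp (\<phi> ?x')) * (g (app A c u) * ennreal (inverse (ch ?x (app A c u)))) \<partial>kernel ?x')"
  proof (intro nn_integral_cong_AE)
    show "AE u in kernel ?x'. ennreal (exp (\<phi>m (app A c u))) * g (app A c u) * ennreal (inverse (ch ?x' u)) =
        ennreal (exp (\<phi> ?x')) * (g (app A c u) * ennreal (inverse (ch ?x (app A c u))))"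
      using kernel_before[OF x']
    proof (rule eventually_mono)
      fix u assume "u \<in> before A (?x' 0)"
      then have u: "u \<in> Xneg A" "A (u 0) c = 1" by (auto simp: before_def)
      have p: "ch ?x' u > 0" "ch ?x (snoc u c) > 0" using u succ_point by (auto intro!: chi_pos)
      have "exp (\<phi>m (snoc u c)) * inverse (ch ?x' u) = exp (\<phi> ?x') * inverse (ch ?x (snoc u c))"
        using chi_cons[OF succ_point u] p by (simp add: field_simps)
      then have "ennreal (exp (\<phi>m (snoc u c))) * ennreal (inverse (ch ?x' u)) = ennreal (exp (\<phi> ?x')) * ennreal (inverse (ch ?x (snoc u c)))"
        by (simp flip: ennreal_mult')
      then show "ennreal (exp (\<phi>m (app A c u))) * g (app A c u) * ennreal (inverse (ch ?x' u)) =
        ennreal (exp (\<phi> ?x')) * (g (app A c u) * ennreal (inverse (ch ?x (app A c u))))"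
        using u by (simp add: app_def mult.assoc mult.left_commute[of _ "g _"])
    qed
  qed
  also have "\<dots> = ennreal (exp (\<phi> ?x')) * (\<integral>\<^sup>+u. g (app A c u) * ennreal (inverse (ch ?x (app A c u))) \<partial>kernel ?x')"
    by (intro nn_integral_cmult) simp
  also have "\<dots> = ennreal lam * (\<integral>\<^sup>+y. indicator (last_cyl A c) y * (g y * ennreal (inverse (ch ?x y))) \<partial>kernel ?x)"
    by (rule kernel_familyD(4)[OF kernel_family_kernel succ_point, of "\<lambda>y. g y * ennreal (inverse (ch ?x y))"]) simp
  also have "\<dots> = ennreal lam * (\<integral>\<^sup>+y. indicator (last_cyl A c) y * g y \<partial>eig_measure)"
    by (simp add: nn_integral_eig_measure_last_cyl[OF succ_point])
  finally show "(\<integral>\<^sup>+u. indicator (before A c) u * ennreal (exp (\<phi>m (app A c u))) * g (app A c u) \<partial>eig_measure) =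
    ennreal lam * (\<integral>\<^sup>+y. indicator (last_cyl A c) y * g y \<partial>eig_measure)" .
qed

text \<open>The factor \<chi>_x cancels its reciprocal off a null set and leaves the total mass of
  \<open>kernel x\<close>.\<close>

lemma chi_integral_eig_measure:
  assumes x: "x \<in> Xpos A"
  shows "chi_integral eig_measure x = ennreal (f x)"
proof -
  note [measurable] = chi_measurable[OF x]
  have "chi_integral eig_measure x = (\<integral>\<^sup>+y. indicator (before A (x 0)) y * ennreal (ch x y) \<partial>eig_measure)"
    unfolding chi_integral_def
    by (intro nn_integral_cong) (auto simp: before_def indicator_def chi_def)
  also have "\<dots> = (\<integral>\<^sup>+y. ennreal (ch x y) * ennreal (inverse (ch x y)) \<partial>kernel x)"
    by (rule nn_integral_eig_measure_before[OF x]) simp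
  also have "\<dots> = (\<integral>\<^sup>+y. 1 \<partial>kernel x)"
  proof (intro nn_integral_cong_AE)
    show "AE y in kernel x. ennreal (ch x y) * ennreal (inverse (ch x y)) = 1"
      using kernel_before[OF x]
    proof (rule eventually_mono)
      fix y assume "y \<in> before A (x 0)"
      then have "ch x y > 0" by (auto simp: before_def intro: chi_pos)
      then show "ennreal (ch x y) * ennreal (inverse (ch x y)) = 1" by (simp flip: ennreal_mult')
    qed
  qed
  also have "\<dots> = ennreal (f x)"
    using kernel_Xneg[OF x] sets_eq_imp_space_eq[OF kernel(1)[OF x]] by simp
  finally show ?thesis .
qed

lemma pi_map_eig_measure: "pi_map A \<psi> eig_measure = f"
proof (rule extensionalityI[of _ "Xpos A"])
  show "pi_map A \<psi> eig_measure \<in> extensional (Xpos A)" by (simp add: pi_map_def)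
  show "f \<in> extensional (Xpos A)" using f by (simp add: eigenfunctions_def)
  fix x assume x: "x \<in> Xpos A"
  then show "pi_map A \<psi> eig_measure x = f x"
    using f_pos[OF x] by (simp add: pi_map_eq[OF finite_transfers_eig_measure] chi_integral_eig_measure)
qed

text \<open>The zero measure would integrate \<chi>_x to 0 instead of f(x) > 0.\<close>

lemma eig_measure_nonzero: "emeasure eig_measure (space eig_measure) \<noteq> 0"
proof
  assume z: "emeasure eig_measure (space eig_measure) = 0"
  obtain x where x: "x \<in> Xpos A" using exists_Xpos by blast
  have "eig_measure = null_measure eig_measure"
  proof (rule measure_eqI)
    fix B assume "B \<in> sets eig_measure"
    then have "emeasure eig_measure B \<le> emeasure eig_measure (space eig_measure)"
      by (intro emeasure_mono sets.sets_into_space sets.top)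
    then show "emeasure eig_measure B = emeasure (null_measure eig_measure) B" using z by simp
  qed simp
  then have "chi_integral eig_measure x = (\<integral>\<^sup>+y. ennreal (ch x y) \<partial>null_measure eig_measure)"
    by (simp add: chi_integral_def)
  then show False using chi_integral_eig_measure[OF x] f_pos[OF x] by simp
qed

end

theorem theorem5p7:
  fixes A :: "'s \<Rightarrow> 's \<Rightarrow> nat"
    and \<phi> \<phi>m \<psi> :: "(int \<Rightarrow> 's) \<Rightarrow> real"
    and lam :: real
  assumes "countable (UNIV :: 's set)" and "infinite (UNIV :: 's set)"
    and "\<And>a b. A a b \<in> {0, 1}"
    and "transitive_shift A"
    and "locally_compact_shift A"
    and "summable_variations (Xpos A) \<phi>"
    and "summable_variations (Xneg A) \<phi>m"
    and "uniformly_continuous_map (shift_metric A UNIV) euclidean_metric \<psi>"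
    and "cohomologous_via A \<phi> \<phi>m \<psi>"
    and "lam > 0"
  shows "bij_betw (pi_map A \<psi>) (nonzero_conformal_measures A \<phi>m lam) (eigenfunctions A \<phi> lam) \<and>
    (\<forall>\<mu>\<in>nonzero_conformal_measures A \<phi>m lam. \<forall>\<nu>\<in>nonzero_conformal_measures A \<phi>m lam.
       add_measure \<mu> \<nu> \<in> nonzero_conformal_measures A \<phi>m lam \<and>
       pi_map A \<psi> (add_measure \<mu> \<nu>) = (\<lambda>x\<in>Xpos A. pi_map A \<psi> \<mu> x + pi_map A \<psi> \<nu> x)) \<and>
    (\<forall>\<mu>\<in>nonzero_conformal_measures A \<phi>m lam. \<forall>c>0.
       scale_measure (ennreal c) \<mu> \<in> nonzero_conformal_measures A \<phi>m lam \<and>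
       pi_map A \<psi> (scale_measure (ennreal c) \<mu>) = (\<lambda>x\<in>Xpos A. c * pi_map A \<psi> \<mu> x))"
proof -
  have fin: "finite {b. A a b = 1} \<and> finite {b. A b a = 1}" for a
  proof -
    have sum: "(\<Sum>\<^sub>\<infinity>b. of_nat (A a b)) + (\<Sum>\<^sub>\<infinity>b. of_nat (A b a)) < (\<infinity> :: ennreal)"
      using assms(5) unfolding locally_compact_shift_def by blast
    have fin: "finite {b. g b = 1}" if fin_g: "(\<Sum>\<^sub>\<infinity>b. of_nat (g b)) < (\<infinity> :: ennreal)" for g :: "'s \<Rightarrow> nat"
    proof (rule ccontr)
      assume inf: "infinite {b. g b = 1}"
      \<comment> \<open>n is taken above the sum, but n entries equal to 1 already contribute
        n.\<close>
      obtain n :: nat where n: "(\<Sum>\<^sub>\<infinity>b. of_nat (g b)) < (of_nat n :: ennreal)"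
        using ennreal_Ex_less_of_nat fin_g by auto
      obtain F where F: "finite F" "card F = n" "F \<subseteq> {b. g b = 1}"
        using infinite_arbitrarily_large[OF inf] by blast
      have "(of_nat n :: ennreal) = (\<Sum>b\<in>F. of_nat (g b))"
        using F by (simp add: subset_iff)
      also have "\<dots> \<le> (\<Sum>\<^sub>\<infinity>b. of_nat (g b))"
        using F(1) by (subst nonneg_infsum_complete) (auto intro!: SUP_upper)
      finally show False using n by simp
    qed
    show ?thesis using sum fin[of "A a"] fin[of "\<lambda>b. A b a"] by (auto simp: less_top[symmetric])
  qed
  \<comment> \<open>A closed path of positive length through a has a first arrow leaving a and a
    last arrow entering it.\<close>
  have ex: "(\<exists>b. A a b = 1) \<and> (\<exists>b. A b a = 1)" for a
  proof -
    obtain n :: nat and p where p: "1 \<le> n" "p 0 = a" "p n = a" "\<forall>i<n. A (p i) (p (i + 1)) = 1"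
      using assms(4)[unfolded transitive_shift_def, rule_format, of a a] by (elim exE conjE)
    have "A a (p 1) = 1" using p(4)[rule_format, of 0] p(1,2) by simp
    moreover have "A (p (n - 1)) a = 1" using p(4)[rule_format, of "n - 1"] p(1,3) by simp
    ultimately show ?thesis by blast
  qed
  interpret ruelle_pair A \<phi> \<phi>m \<psi> lam
    by unfold_locales (use assms fin ex summable_variations_loc_cont[OF assms(7)] in auto)
  have nc: "\<mu> \<in> nonzero_conformal_measures A \<phi>m lam \<longleftrightarrow>
      finite_transfers \<mu> \<and> emeasure \<mu> (space \<mu>) \<noteq> 0" for \<mu>
    by (simp add: nonzero_conformal_measures_def conformal_iff finite_transfers_def)
  have bij: "bij_betw (pi_map A \<psi>) (nonzero_conformal_measures A \<phi>m lam) (eigenfunctions A \<phi> lam)"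
  proof (rule bij_betw_imageI)
    show "inj_on (pi_map A \<psi>) (nonzero_conformal_measures A \<phi>m lam)"
      by (rule inj_onI) (auto simp: nc intro: pi_map_inj)
    show "pi_map A \<psi> ` nonzero_conformal_measures A \<phi>m lam = eigenfunctions A \<phi> lam"
    proof
      show "pi_map A \<psi> ` nonzero_conformal_measures A \<phi>m lam \<subseteq> eigenfunctions A \<phi> lam"
        using pi_map_eigenfunction by (auto simp: nc)
      show "eigenfunctions A \<phi> lam \<subseteq> pi_map A \<psi> ` nonzero_conformal_measures A \<phi>m lam"
      proof
        fix f assume "f \<in> eigenfunctions A \<phi> lam"
        then interpret eigenfunction A \<phi> \<phi>m \<psi> lam f by unfold_locales
        show "f \<in> pi_map A \<psi> ` nonzero_conformal_measures A \<phi>m lam"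
          using pi_map_eig_measure finite_transfers_eig_measure eig_measure_nonzero
          by (intro image_eqI[of _ _ eig_measure]) (auto simp: nc)
      qed
    qed
  qed
  have add: "add_measure \<mu> \<nu> \<in> nonzero_conformal_measures A \<phi>m lam \<and>
       pi_map A \<psi> (add_measure \<mu> \<nu>) = (\<lambda>x\<in>Xpos A. pi_map A \<psi> \<mu> x + pi_map A \<psi> \<nu> x)"
    if "\<mu> \<in> nonzero_conformal_measures A \<phi>m lam" "\<nu> \<in> nonzero_conformal_measures A \<phi>m lam" for \<mu> \<nu>
  proof -
    have ft: "finite_transfers \<mu>" "finite_transfers \<nu>" using that by (auto simp: nc)
    have "emeasure (add_measure \<mu> \<nu>) (space \<mu>) \<noteq> 0"
      using that finite_transfersD(1)[OF ft(1)] finite_transfersD(1)[OF ft(2)]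
      by (subst emeasure_add_measure) (auto simp: nc)
    moreover have "pi_map A \<psi> (add_measure \<mu> \<nu>) = (\<lambda>x\<in>Xpos A. pi_map A \<psi> \<mu> x + pi_map A \<psi> \<nu> x)"
      by (rule extensionalityI[of _ "Xpos A"]) (simp_all add: add_measure_transfers(2)[OF ft], simp add: pi_map_def)
    ultimately show ?thesis using add_measure_transfers(1)[OF ft] by (simp add: nc)
  qed
  have scale: "scale_measure (ennreal c) \<mu> \<in> nonzero_conformal_measures A \<phi>m lam \<and>
       pi_map A \<psi> (scale_measure (ennreal c) \<mu>) = (\<lambda>x\<in>Xpos A. c * pi_map A \<psi> \<mu> x)"
    if "\<mu> \<in> nonzero_conformal_measures A \<phi>m lam" "c > 0" for \<mu> c
  proof -
    have ft: "finite_transfers \<mu>" using that by (auto simp: nc)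
    have "pi_map A \<psi> (scale_measure (ennreal c) \<mu>) = (\<lambda>x\<in>Xpos A. c * pi_map A \<psi> \<mu> x)"
      by (rule extensionalityI[of _ "Xpos A"]) (simp_all add: scale_measure_transfers(2)[OF ft that(2)], simp add: pi_map_def)
    then show ?thesis using that scale_measure_transfers(1)[OF ft that(2)] by (simp add: nc space_scale_measure)
  qed
  show ?thesis using bij add scale by blast
qed

end
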